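(* (1) For a fixed positive real number $\gamma$, there exists a positive integer $p_{0}=p_{0}(\gamma)$ such that for all integers $p\ge p_{0}$, $$t_{3}(\lfloor\gamma p\rfloor+1,p+1)=\begin{cases}\frac{7}{9}, & \text{if } \frac{3}{2}\le\gamma<\frac{5}{3},\\ \frac{19}{27}, & \text{if } \frac{5}{3}\le\gamma<\frac{7}{4},\\ \frac{1}{4}, & \text{if } 2\le\gamma<\frac{7}{3},\\ \frac{1}{9}, & \text{if } 3\le\gamma<\frac{22}{7}.\end{cases}$$ (2) Let $\gamma$ be a real number with $\frac{4}{3}\le\gamma<\frac{7}{5}$. There exists a positive integer $p_{0}=p_{0}(\gamma)$ such that for all integers $p\ge p_{0}$, $t_{4}(\lfloor\gamma p\rfloor+1,p+1)=1-\frac{4!}{4^{4}}$. (3) For integers $r\ge 3$ and $p\ge r^{2}-r-1$, $t_{r}(rp+1,(r-1)p+1)=1-\frac{r!}{r^{r}}$.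
   Context: For an $r$-uniform hypergraph $H$, a vertex set $X$ is a clique if every $r$-subset of $X$ is an edge. For integers $q\ge p\ge r\ge 2$, an $r$-uniform hypergraph $H$ has property $(q,p)$ if every $q$-element vertex subset $Q$ contains a $p$-element subset which is a clique in $H$. Let $T_{r}(n,q,p)=\min\{e(H): H\subseteq\binom{[n]}{r},\ H \text{ has property } (q,p)\}$ and $t_r(q,p)=\lim_{n\to\infty}T_r(n,q,p)/\binom{n}{r}$. *)

theory Defs
  imports Complex_Main "HOL-Library.Ramsey"
begin

text \<open>The set \<open>nsets V r\<close> of all \<open>r\<close>-element subsets of \<open>V\<close> is the complete \<open>r\<close>-uniform
  hypergraph on \<open>V\<close>; an \<open>r\<close>-uniform hypergraph on \<open>V\<close> is given by its edge set
  \<open>E \<subseteq> nsets V r\<close>.\<close>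

definition hyperclique :: "nat \<Rightarrow> 'a set set \<Rightarrow> 'a set \<Rightarrow> bool" where
  "hyperclique r E X \<longleftrightarrow> nsets X r \<subseteq> E"

definition qp_property :: "nat \<Rightarrow> 'a set \<Rightarrow> 'a set set \<Rightarrow> nat \<Rightarrow> nat \<Rightarrow> bool" where
  "qp_property r V E q p \<longleftrightarrow>
     (\<forall>Q \<in> nsets V q. \<exists>P \<in> nsets Q p. hyperclique r E P)"

definition turan_num :: "nat \<Rightarrow> nat \<Rightarrow> nat \<Rightarrow> nat \<Rightarrow> nat" where
  "turan_num r n q p = Min {card E |E. E \<subseteq> nsets {1..n} r \<and> qp_property r {1..n} E q p}"

definition turan_dens :: "nat \<Rightarrow> nat \<Rightarrow> nat \<Rightarrow> real" where
  "turan_dens r q p = lim (\<lambda>n. real (turan_num r n q p) / real (n choose r))"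

text \<open>The minimum and the limit above are well defined for \<open>p \<le> q\<close>.\<close>

lemma finite_turan_set:
  assumes "finite V"
  shows "finite {card E |E. E \<subseteq> nsets V r \<and> qp_property r V E q p}"
proof -
  have "finite (card ` Pow (nsets V r))"
    using assms by (simp add: finite_imp_finite_nsets)
  thus ?thesis by (rule finite_subset[rotated]) auto
qed

lemma qp_property_complete:
  assumes "p \<le> q"
  shows "qp_property r V (nsets V r) q p"
  unfolding qp_property_def hyperclique_def
proof
  fix Q assume Q: "Q \<in> nsets V q"
  then obtain P where "P \<subseteq> Q" "card P = p" "finite P"
    using assms obtain_subset_with_card_n[of p Q] by (auto simp: nsets_def)
  with Q show "\<exists>P\<in>nsets Q p. nsets P r \<subseteq> nsets V r"
    by (intro bexI[of _ P]) (auto simp: nsets_def)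
qed

lemma turan_num_attained:
  assumes "p \<le> q"
  obtains E where "E \<subseteq> nsets {1..n} r" "qp_property r {1..n} E q p" "card E = turan_num r n q p"
proof -
  have "turan_num r n q p \<in> {card E |E. E \<subseteq> nsets {1..n} r \<and> qp_property r {1..n} E q p}"
    unfolding turan_num_def using qp_property_complete[OF assms] by (intro Min_in finite_turan_set) auto
  thus ?thesis using that by auto
qed

lemma turan_num_le_card:
  assumes V: "finite V" and E: "E \<subseteq> nsets V r" "qp_property r V E q p"
  shows "turan_num r (card V) q p \<le> card E"
proof -
  obtain f where f: "bij_betw f V {1..card V}"
    using finite_same_card_bij[OF V, of "{1..card V}"] by auto
  define F where "F = (`) f ` E"
  have inj: "inj_on f V" and im: "f ` V = {1..card V}"
    using f by (auto simp: bij_betw_def)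
  have F: "F \<subseteq> nsets {1..card V} r"
  proof
    fix e assume "e \<in> F"
    then obtain d where d: "d \<in> E" "e = f ` d" by (auto simp: F_def)
    with E have dd: "d \<subseteq> V" "finite d" "card d = r" by (auto simp: nsets_def)
    hence "card (f ` d) = r" using inj by (auto simp: card_image inj_on_subset)
    with dd d im show "e \<in> nsets {1..card V} r" by (auto simp: nsets_def)
  qed
  have Fp: "qp_property r {1..card V} F q p"
    unfolding qp_property_def
  proof
    fix Q assume Q: "Q \<in> nsets {1..card V} q"
    then obtain Q' where Q': "Q' \<subseteq> V" "Q = f ` Q'"
      using im subset_image_iff[of Q f V] by (auto simp: nsets_def)
    have "card Q' = q"
      using Q Q' card_image[OF inj_on_subset[OF inj Q'(1)]] by (auto simp: nsets_def)
    hence "Q' \<in> nsets V q" using Q' V by (auto simp: nsets_def finite_subset)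
    then obtain P where P: "P \<in> nsets Q' p" "nsets P r \<subseteq> E"
      using E(2) unfolding qp_property_def hyperclique_def by blast
    have PV: "P \<subseteq> V" using P Q' by (auto simp: nsets_def)
    have "card (f ` P) = p"
      using P(1) card_image[OF inj_on_subset[OF inj PV]] by (auto simp: nsets_def)
    hence 1: "f ` P \<in> nsets Q p" using P Q' by (auto simp: nsets_def)
    have "nsets (f ` P) r \<subseteq> F"
    proof
      fix e assume e: "e \<in> nsets (f ` P) r"
      then obtain d where d: "d \<subseteq> P" "e = f ` d" by (auto simp: nsets_def subset_image_iff)
      have "d \<subseteq> V" using d PV by auto
      hence "card d = r"
        using e d card_image[OF inj_on_subset[OF inj]] by (auto simp: nsets_def)
      moreover have "finite d" using d PV V by (meson finite_subset)
      ultimately have "d \<in> E" using d P by (auto simp: nsets_def)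
      thus "e \<in> F" using d by (auto simp: F_def)
    qed
    with 1 show "\<exists>P\<in>nsets Q p. hyperclique r F P" unfolding hyperclique_def by blast
  qed
  have "turan_num r (card V) q p \<le> card F"
    unfolding turan_num_def using F Fp by (intro Min_le finite_turan_set) auto
  also have "card F \<le> card E"
  proof -
    have "finite E" using E(1) V finite_imp_finite_nsets finite_subset by blast
    thus ?thesis unfolding F_def by (rule card_image_le)
  qed
  finally show ?thesis .
qed

lemma turan_num_averaging:
  assumes "p \<le> q" "r \<le> n"
  shows "Suc n * turan_num r n q p \<le> (Suc n - r) * turan_num r (Suc n) q p"
proof -
  obtain E where E: "E \<subseteq> nsets {1..Suc n} r" "qp_property r {1..Suc n} E q p"
      "card E = turan_num r (Suc n) q p"
    using turan_num_attained[OF assms(1)] .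
  have finE: "finite E" using E(1) finite_imp_finite_nsets finite_subset by blast
  let ?V = "{1..Suc n}"
  have le: "turan_num r n q p \<le> card {e \<in> E. v \<notin> e}" if v: "v \<in> ?V" for v
  proof -
    have "qp_property r (?V - {v}) {e \<in> E. v \<notin> e} q p"
      unfolding qp_property_def
    proof
      fix Q assume Q: "Q \<in> nsets (?V - {v}) q"
      hence "Q \<in> nsets ?V q" by (auto simp: nsets_def)
      then obtain P where P: "P \<in> nsets Q p" "nsets P r \<subseteq> E"
        using E(2) unfolding qp_property_def hyperclique_def by blast
      have "nsets P r \<subseteq> {e \<in> E. v \<notin> e}" using P Q by (auto simp: nsets_def)
      thus "\<exists>P\<in>nsets Q p. hyperclique r {e \<in> E. v \<notin> e} P"
        using P(1) unfolding hyperclique_def by blast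
    qed
    moreover have "{e \<in> E. v \<notin> e} \<subseteq> nsets (?V - {v}) r" using E(1) by (auto simp: nsets_def)
    ultimately have "turan_num r (card (?V - {v})) q p \<le> card {e \<in> E. v \<notin> e}"
      by (intro turan_num_le_card) auto
    thus ?thesis using v by simp
  qed
  have "Suc n * turan_num r n q p = (\<Sum>v\<in>?V. turan_num r n q p)" by simp
  also have "\<dots> \<le> (\<Sum>v\<in>?V. card {e \<in> E. v \<notin> e})" by (rule sum_mono) (rule le)
  also have "\<dots> = (\<Sum>e\<in>E. card {v \<in> ?V. v \<notin> e})"
    using finE by (intro sum_multicount_gen) auto
  also have "\<dots> = (\<Sum>e\<in>E. Suc n - r)"
  proof (rule sum.cong)
    fix e assume "e \<in> E"
    hence e: "e \<subseteq> ?V" "finite e" "card e = r" using E(1) by (auto simp: nsets_def)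
    have "{v \<in> ?V. v \<notin> e} = ?V - e" by auto
    thus "card {v \<in> ?V. v \<notin> e} = Suc n - r" using e by (simp add: card_Diff_subset)
  qed simp
  also have "\<dots> = (Suc n - r) * turan_num r (Suc n) q p" using E(3) by simp
  finally show ?thesis .
qed

lemma ratio_step:
  fixes k a m b x y :: real
  assumes "m * x \<le> k * y" "k * a = m * b" "b > 0" "a > 0" "m > 0"
  shows "x / b \<le> y / a"
proof -
  have "m * (x * a) = (m * x) * a" by simp
  also have "\<dots> \<le> (k * y) * a" using assms by (intro mult_right_mono) auto
  also have "\<dots> = (k * a) * y" by simp
  also have "\<dots> = m * (b * y)" using assms(2) by simp
  finally have "x * a \<le> b * y" using \<open>m > 0\<close> by simp
  thus ?thesis using assms by (simp add: divide_simps mult.commute)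
qed

lemma turan_dens_limit:
  assumes "p \<le> q"
  shows "(\<lambda>n. real (turan_num r n q p) / real (n choose r)) \<longlonglongrightarrow> turan_dens r q p"
proof -
  let ?d = "\<lambda>n. real (turan_num r n q p) / real (n choose r)"
  have "incseq ?d"
  proof (rule incseq_SucI)
    fix n show "?d n \<le> ?d (Suc n)"
    proof (cases "r \<le> n")
      case True
      have "real (Suc n) * real (turan_num r n q p) \<le> real (Suc n - r) * real (turan_num r (Suc n) q p)"
        using turan_num_averaging[OF assms True] by (metis of_nat_le_iff of_nat_mult)
      moreover have "real (Suc n - r) * real (Suc n choose r) = real (Suc n) * real (n choose r)"
        using binomial_absorb_comp[of "Suc n" r] by (metis diff_Suc_1 of_nat_mult)
      moreover have "n choose r > 0" "Suc n choose r > 0" "Suc n - r > 0" using True by auto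
      ultimately show ?thesis
        by - (rule ratio_step, assumption, assumption, simp_all)
    qed (simp add: binomial_eq_0)
  qed
  moreover have "\<And>n. ?d n \<le> 1"
  proof -
    fix n
    have "turan_num r n q p \<le> card (nsets {1..n} r)"
      using turan_num_le_card[OF _ subset_refl qp_property_complete[OF assms], of "{1..n}" r] by simp
    also have "\<dots> = n choose r" by (simp add: card_nsets)
    finally have "real (turan_num r n q p) \<le> real (n choose r)" by simp
    thus "?d n \<le> 1" by (cases "r \<le> n") (auto simp: divide_le_eq_1 binomial_eq_0)
  qed
  ultimately have "convergent ?d"
    unfolding convergent_def by (blast elim: incseq_convergent)
  thus ?thesis unfolding turan_dens_def by (simp add: convergent_LIMSEQ_iff)
qed

end

(* A hypergraph with property (q,p) is the complement of a hypergraph G in which every q vertices contain p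
   vertices independent in G, so the problem is to maximize the density of G. By supersaturation a dense G
   contains large blow-ups of a dense pattern F, and the Lagrangian of F, attained at weights x with minimal
   support, is at least the density of G up to a small error. At such an optimum all links have the same
   weight and any two vertices lie in an edge. The property forces every small integer weighting of F to
   have an independent set carrying more than a fraction theta (about p/q) of it. Weightings of suitable
   small configurations therefore exclude these configurations, and each extremal value follows by counting:
   - for 1 - r!/r^r, F is a single edge, or any two of its edges meet in fewer than r - 1 vertices, which
     makes the Lagrangian even smaller;
   - for 19/27, once F contains K4^- (three of the four triples on four vertices), the four links of such
     a configuration overlap so little that the degree condition bounds the density;
   - for 1/4 and 1/9, a density of G above 3/4 or 8/9 produces K4 or K6, and overlaying the links of its
     vertices produces a forbidden configuration.
   For 19/27 and 1/9 the presence of K4^- or K6 uses an independent set of real weight more than 4/7 or 7/22,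
   which the condition on small integer weightings supplies only when the support is bounded; hence the
   optimum is first replaced by one supported on a bounded sample of its blow-up. *)

theory Submission
  imports Defs "HOL-Analysis.Analysis"
begin

section \<open>Lagrangians\<close>

text \<open>A range of \<open>\<gamma>\<close> ends where \<open>1 / \<gamma>\<close> meets the
  largest share of the weight that an independent set of an excluded configuration can carry: 3/5
  and 5/7 for two edges sharing \<open>r - 1\<close> vertices together with an edge covering the
  other two, 4/7 around K4^-, 3/7 for K4 with three further vertices, 7/22 for a K6 of weight 3 with
  four further vertices. A range begins where the construction for the upper bound acquires the
  property: \<open>r\<close> equal parts without transversal edges, the complement of a blow-up of
  K4^- with parts 3:2:2:2, or two or three disjoint cliques. Passing to an optimum gives exactly
  equal degrees and covered pairs, which a dense hypergraph need not have; the price is that only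
  integer weightings of a pattern remain to express the property. Since the weights of coinciding
  vertices add up, degenerate copies of a configuration are excluded together with the proper ones.
  In the result for general \<open>r\<close> the number \<open>p\<close> is explicit, so its
  weighting depends on \<open>p\<close> and has total exactly \<open>r * p + 1\<close>.\<close>

definition lag :: "'a set set \<Rightarrow> ('a \<Rightarrow> real) \<Rightarrow> real" where
  "lag E x = (\<Sum>e\<in>E. \<Prod>i\<in>e. x i)"

text \<open>The partial derivative of \<open>lag E\<close> in the variable \<open>v\<close>,
  equivalently the Lagrange polynomial of the link of \<open>v\<close>.\<close>

definition dlag :: "'a set set \<Rightarrow> 'a \<Rightarrow> ('a \<Rightarrow> real) \<Rightarrow> real" where
  "dlag E v x = (\<Sum>e\<in>{e\<in>E. v \<in> e}. \<Prod>i\<in>e - {v}. x i)"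

text \<open>Records the consequences of maximality at minimal support. The multiplier
  \<open>real r * lag E x\<close> in the first-order condition is forced by Euler's identity for
  homogeneous polynomials of degree \<open>r\<close>.\<close>

definition opt_weights :: "nat \<Rightarrow> 'a set \<Rightarrow> 'a set set \<Rightarrow> ('a \<Rightarrow> real) \<Rightarrow> bool" where
  "opt_weights r S E x \<longleftrightarrow> finite S \<and> E \<subseteq> nsets S r \<and> (\<forall>i\<in>S. 0 < x i) \<and> sum x S = 1 \<and>
     (\<forall>v\<in>S. dlag E v x = real r * lag E x) \<and>
     (\<forall>u\<in>S. \<forall>v\<in>S. u \<noteq> v \<longrightarrow> (\<exists>e\<in>E. u \<in> e \<and> v \<in> e))"

lemma finite_edges: "finite V \<Longrightarrow> E \<subseteq> nsets V r \<Longrightarrow> finite E"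
  using finite_imp_finite_nsets finite_subset by blast

lemma edgeD: "E \<subseteq> nsets V r \<Longrightarrow> e \<in> E \<Longrightarrow> e \<subseteq> V \<and> finite e \<and> card e = r"
  by (auto simp: nsets_def)

text \<open>Euler's identity: an edge contributes its monomial once for each of its \<open>r\<close>
  vertices.\<close>

lemma sum_dlag:
  assumes "finite V" "E \<subseteq> nsets V r"
  shows "(\<Sum>v\<in>V. x v * dlag E v x) = real r * lag E x"
proof -
  have fE: "finite E" using assms finite_edges by blast
  have "(\<Sum>v\<in>V. x v * dlag E v x) = (\<Sum>v\<in>V. \<Sum>e\<in>{e\<in>E. v \<in> e}. \<Prod>i\<in>e. x i)"
    unfolding dlag_def sum_distrib_left
  proof (intro sum.cong refl)
    fix v e assume "e \<in> {e \<in> E. v \<in> e}"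
    thus "x v * prod x (e - {v}) = prod x e" using edgeD[OF assms(2)] by (subst prod.remove[of e v]) auto
  qed
  also have "\<dots> = (\<Sum>v\<in>V. \<Sum>e\<in>E. if v \<in> e then \<Prod>i\<in>e. x i else 0)"
    using fE by (intro sum.cong refl sum.mono_neutral_cong_left) auto
  also have "\<dots> = (\<Sum>e\<in>E. \<Sum>v\<in>V. if v \<in> e then \<Prod>i\<in>e. x i else 0)" by (rule sum.swap)
  also have "\<dots> = (\<Sum>e\<in>E. real r * (\<Prod>i\<in>e. x i))"
  proof (intro sum.cong refl)
    fix e assume "e \<in> E"
    hence e: "e \<subseteq> V" "card e = r" using edgeD[OF assms(2)] by auto
    have "(\<Sum>v\<in>V. if v \<in> e then prod x e else 0) = (\<Sum>v\<in>e. prod x e)"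
      using assms(1) e(1) by (intro sum.mono_neutral_cong_right) auto
    thus "(\<Sum>v\<in>V. if v \<in> e then prod x e else 0) = real r * prod x e" using e by simp
  qed
  finally show ?thesis by (simp add: lag_def sum_distrib_left)
qed

text \<open>The Lagrange polynomial is multilinear, so with all other coordinates frozen it is
  bilinear in those of \<open>u\<close> and \<open>v\<close>. The mixed coefficient comes from the
  common link and vanishes when no edge contains both vertices. Both exchange arguments for a
  maximizer read off this formula.\<close>

lemma lag_two_variables:
  assumes "finite V" "E \<subseteq> nsets V r" "u \<noteq> v"
  shows "\<exists>a b c d. (\<forall>y. (\<forall>i. i \<noteq> u \<longrightarrow> i \<noteq> v \<longrightarrow> y i = x i) \<longrightarrow>
      lag E y = y u * y v * d + y u * a + y v * b + c \<and> dlag E u y = y v * d + a \<and> dlag E v y = y u * d + b) \<and>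
    ((\<forall>i\<in>V. 0 \<le> x i) \<longrightarrow> 0 \<le> d) \<and> (\<not> (\<exists>e\<in>E. u \<in> e \<and> v \<in> e) \<longrightarrow> d = 0)"
proof -
  define link where "link = (\<lambda>(F :: 'a set set) w. (\<lambda>e. e - {w}) ` {e\<in>F. w \<in> e})"
  define del where "del = (\<lambda>(F :: 'a set set) w. {e\<in>F. w \<notin> e})"
  have inj: "inj_on (\<lambda>e. e - {w}) {e\<in>F. w \<in> e}" for F :: "'a set set" and w by (auto simp: inj_on_def)
  have dlag: "dlag F w y = lag (link F w) y" for F w and y :: "'a \<Rightarrow> real"
    unfolding dlag_def lag_def link_def by (simp add: sum.reindex[OF inj])
  have expand: "lag F y = y w * lag (link F w) y + lag (del F w) y" if F: "finite F" "\<forall>e\<in>F. finite e" for F w y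
  proof -
    have "lag F y = (\<Sum>e\<in>{e\<in>F. w \<in> e}. prod y e) + lag (del F w) y"
      unfolding lag_def del_def using F(1) by (subst sum.union_disjoint[symmetric]) (auto intro: sum.cong)
    also have "(\<Sum>e\<in>{e\<in>F. w \<in> e}. prod y e) = (\<Sum>e\<in>{e\<in>F. w \<in> e}. y w * prod y (e - {w}))"
      using F(2) by (intro sum.cong refl prod.remove) auto
    finally show ?thesis by (simp add: dlag[symmetric] dlag_def sum_distrib_left)
  qed
  have fE: "finite E" "\<forall>e\<in>E. finite e" using finite_edges[OF assms(1,2)] assms(2) by (auto simp: nsets_def)
  have fl: "finite (link F w)" "\<forall>e\<in>link F w. finite e" "finite (del F w)" "\<forall>e\<in>del F w. finite e"
    if "finite F" "\<forall>e\<in>F. finite e" for F w using that by (auto simp: link_def del_def)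
  have filter: "{e\<in>(\<lambda>e. e - {w}) ` F. z \<in> e} = (\<lambda>e. e - {w}) ` {e\<in>F. z \<in> e}"
    "{e\<in>(\<lambda>e. e - {w}) ` F. z \<notin> e} = (\<lambda>e. e - {w}) ` {e\<in>F. z \<notin> e}" if "z \<noteq> w" for F :: "'a set set" and w z
    using that by auto
  have comm: "link (link E v) u = link (link E u) v"
    unfolding link_def filter[OF assms(3)] filter[OF assms(3)[symmetric]] image_image by (intro image_cong) auto
  have comm': "del (link E v) u = link (del E u) v"
    unfolding link_def del_def filter[OF assms(3)] by (intro image_cong) auto
  \<comment> \<open>The edges split into those containing both vertices, only \<open>u\<close>, only
    \<open>v\<close>, or neither; the four coefficients collect these classes in this order.\<close>
  define d where "d = lag (link (link E u) v) x"
  define a where "a = lag (del (link E u) v) x"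
  define b where "b = lag (link (del E u) v) x"
  define c where "c = lag (del (del E u) v) x"
  have key: "lag E y = y u * y v * d + y u * a + y v * b + c \<and> dlag E u y = y v * d + a \<and> dlag E v y = y u * d + b"
    if y: "\<forall>i. i \<noteq> u \<longrightarrow> i \<noteq> v \<longrightarrow> y i = x i" for y
  proof -
    have same: "lag F y = lag F x" if "\<And>e. e \<in> F \<Longrightarrow> u \<notin> e \<and> v \<notin> e" for F
      unfolding lag_def using that y by (intro sum.cong prod.cong refl) metis
    have eq: "lag (link (link E u) v) y = d" "lag (del (link E u) v) y = a" "lag (link (del E u) v) y = b"
      "lag (del (del E u) v) y = c"
      unfolding d_def a_def b_def c_def by (intro same; auto simp: link_def del_def)+
    show ?thesis
      using expand[OF fE, of y u] expand[OF fl(1,2)[OF fE, of u], of y v] expand[OF fl(3,4)[OF fE, of u], of y v]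
        expand[OF fl(1,2)[OF fE, of v], of y u]
      by (simp add: dlag comm comm' eq algebra_simps)
  qed
  have "e \<subseteq> V" if "e \<in> link (link E u) v" for e using that edgeD[OF assms(2)] by (fastforce simp: link_def)
  hence "(\<forall>i\<in>V. 0 \<le> x i) \<longrightarrow> 0 \<le> d"
    unfolding d_def lag_def by (intro impI sum_nonneg prod_nonneg) auto
  moreover have "\<not> (\<exists>e\<in>E. u \<in> e \<and> v \<in> e) \<longrightarrow> d = 0" by (auto simp: d_def lag_def link_def intro!: sum.neutral)
  ultimately show ?thesis using key by blast
qed

text \<open>Coordinates outside \<open>V\<close> are pinned to 0, which makes the simplex a closed
  part of a product of compact sets even over an infinite type, so Tychonoff's theorem
  applies.\<close>

lemma compact_weights:
  assumes "finite V"
  shows "compact {x :: 'a \<Rightarrow> real. (\<forall>i\<in>V. 0 \<le> x i) \<and> (\<forall>i. i \<notin> V \<longrightarrow> x i = 0) \<and> sum x V = 1}" (is "compact ?D")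
proof -
  define B where "B = (\<lambda>i. if i \<in> V then {0..1::real} else {0})"
  have "compactin (product_topology (\<lambda>i. euclidean) UNIV) (PiE UNIV B)"
    by (simp add: compactin_PiE B_def)
  hence B: "compact (PiE UNIV B)" by (simp add: euclidean_product_topology)
  have c: "continuous_on UNIV (\<lambda>x::'a \<Rightarrow> real. x i)" for i
    by (rule continuous_on_product_coordinates)
  have "closed {x :: 'a \<Rightarrow> real. sum x V = 1}"
    by (intro closed_Collect_eq continuous_on_sum continuous_on_const c)
  with B have "compact (PiE UNIV B \<inter> {x. sum x V = 1})" by (rule compact_Int_closed)
  also have "PiE UNIV B \<inter> {x. sum x V = 1} = ?D"
  proof (intro equalityI subsetI)
    fix x assume "x \<in> PiE UNIV B \<inter> {x. sum x V = 1}"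
    hence x: "\<And>i. x i \<in> B i" "sum x V = 1" by auto
    have "0 \<le> x i" if "i \<in> V" for i using x(1)[of i] that by (simp add: B_def)
    moreover have "x i = 0" if "i \<notin> V" for i using x(1)[of i] that by (simp add: B_def)
    ultimately show "x \<in> ?D" using x(2) by simp
  next
    fix x assume "x \<in> ?D"
    hence x: "\<forall>i\<in>V. 0 \<le> x i" "\<forall>i. i \<notin> V \<longrightarrow> x i = 0" "sum x V = 1" by auto
    have "x i \<le> 1" if "i \<in> V" for i
      using member_le_sum[of i V x] that x assms by auto
    thus "x \<in> PiE UNIV B \<inter> {x. sum x V = 1}" using x by (auto simp: B_def)
  qed
  finally show ?thesis .
qed

lemma continuous_on_lag: "continuous_on A (lag E)"
  unfolding lag_def[abs_def]
  by (intro continuous_on_sum continuous_on_prod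
        continuous_on_subset[OF continuous_on_product_coordinates subset_UNIV])

text \<open>An edge leaving \<open>S\<close> carries a vertex of weight zero; for the derivative
  that vertex survives the removal of \<open>v\<close> because \<open>v\<close> lies in
  \<open>S\<close>.\<close>

lemma lag_restrict:
  assumes "finite V" "E \<subseteq> nsets V r" "\<And>i. i \<notin> S \<Longrightarrow> x i = 0"
  shows "lag (E \<inter> nsets S r) x = lag E x" and "v \<in> S \<Longrightarrow> dlag (E \<inter> nsets S r) v x = dlag E v x"
proof -
  have fE: "finite E" using assms finite_edges by blast
  have z: "\<exists>i\<in>e. i \<notin> S" if "e \<in> E" "e \<notin> nsets S r" for e
    using that edgeD[OF assms(2)] by (auto simp: nsets_def)
  show "lag (E \<inter> nsets S r) x = lag E x"
    unfolding lag_def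
  proof (intro sum.mono_neutral_left ballI)
    fix e assume "e \<in> E - E \<inter> nsets S r"
    then obtain i where "i \<in> e" "i \<notin> S" "finite e" using z edgeD[OF assms(2)] by blast
    thus "prod x e = 0" using assms(3) by (intro prod_zero) auto
  qed (use fE in auto)
  assume v: "v \<in> S"
  show "dlag (E \<inter> nsets S r) v x = dlag E v x"
    unfolding dlag_def
  proof (intro sum.mono_neutral_left ballI)
    fix e assume "e \<in> {e\<in>E. v \<in> e} - {e \<in> E \<inter> nsets S r. v \<in> e}"
    then obtain i where "i \<in> e" "i \<notin> S" "finite e" using z edgeD[OF assms(2)] by blast
    thus "prod x (e - {v}) = 0" using assms(3) v by (intro prod_zero bexI[of _ i]) auto
  qed (use fE in auto)
qed

text \<open>A maximizer whose support is smallest possible: if two vertices of the support were in no common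
  edge, the Lagrange polynomial would be affine along the line that moves weight between them, and one
  of them could be emptied.\<close>

lemma optimal_weights_exist:
  fixes V :: "'a set"
  assumes V: "finite V" and E: "E \<subseteq> nsets V r" and y: "\<And>i. i \<in> V \<Longrightarrow> 0 \<le> y i" "sum y V = 1"
  obtains S x where "S \<subseteq> V" "opt_weights r S (E \<inter> nsets S r) x" "lag (E \<inter> nsets S r) x \<ge> lag E y"
proof -
  define D where "D = {x :: 'a \<Rightarrow> real. (\<forall>i\<in>V. 0 \<le> x i) \<and> (\<forall>i. i \<notin> V \<longrightarrow> x i = 0) \<and> sum x V = 1}"
  define y' where "y' = (\<lambda>i. if i \<in> V then y i else 0)"
  have "sum y' V = 1" using y(2) by (simp add: y'_def)
  hence y': "y' \<in> D" using y by (auto simp: D_def y'_def)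
  have ly: "lag E y' = lag E y"
    unfolding lag_def y'_def using edgeD[OF E] by (intro sum.cong prod.cong refl) auto
  have "compact D" unfolding D_def by (rule compact_weights[OF V])
  then obtain x0 where x0: "x0 \<in> D" "\<And>z. z \<in> D \<Longrightarrow> lag E z \<le> lag E x0"
    using continuous_attains_sup[of D "lag E"] continuous_on_lag y' by blast
  define supp where "supp = (\<lambda>x :: 'a \<Rightarrow> real. {i\<in>V. x i \<noteq> 0})"
  define Opt where "Opt = {x\<in>D. \<forall>z\<in>D. lag E z \<le> lag E x}"
  have "x0 \<in> Opt" using x0 by (auto simp: Opt_def)
  then obtain x where x: "x \<in> Opt" and xm: "\<And>z. z \<in> Opt \<Longrightarrow> card (supp x) \<le> card (supp z)"
    using arg_min_nat_lemma[of "\<lambda>x. x \<in> Opt" x0 "\<lambda>x. card (supp x)"] by blast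
  define S where "S = supp x"
  have xD: "\<And>i. i \<in> V \<Longrightarrow> 0 \<le> x i" "\<And>i. i \<notin> V \<Longrightarrow> x i = 0" "sum x V = 1"
    and opt: "\<And>z. z \<in> D \<Longrightarrow> lag E z \<le> lag E x"
    using x by (auto simp: Opt_def D_def)
  have SV: "S \<subseteq> V" "finite S" using V by (auto simp: S_def supp_def)
  have pos: "0 < x i" if "i \<in> S" for i using that xD(1)[of i] by (auto simp: S_def supp_def)
  have z: "x i = 0" if "i \<notin> S" for i using that xD(2) by (auto simp: S_def supp_def)
  have s1: "sum x S = 1"
    using xD(3) SV V z by (subst sum.mono_neutral_left[of V S x]) auto
  have move: "x(u := x u + t, v := x v - t) \<in> D" if "u \<in> S" "v \<in> S" "u \<noteq> v" "- x u \<le> t" "t \<le> x v" for u v t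
  proof -
    have uv: "u \<in> V" "v \<in> V" using that SV by auto
    have "sum (x(u := x u + t, v := x v - t)) V
        = (\<Sum>i\<in>V. x i + (if i = u then t else 0) - (if i = v then t else 0))"
      using that(3) by (intro sum.cong) auto
    also have "\<dots> = 1" using uv V xD(3) by (simp add: sum.distrib sum_subtractf)
    finally have sm: "sum (x(u := x u + t, v := x v - t)) V = 1" .
    have nn: "0 \<le> (x(u := x u + t, v := x v - t)) i" if "i \<in> V" for i
      using xD(1)[OF that] \<open>- x u \<le> t\<close> \<open>t \<le> x v\<close> by auto
    have zz: "(x(u := x u + t, v := x v - t)) i = 0" if "i \<notin> V" for i
      using xD(2)[OF that] uv that by auto
    show ?thesis unfolding D_def using sm nn zz by blast
  qed
  have eqd: "dlag E u x \<le> dlag E v x" if uv: "u \<in> S" "v \<in> S" for u v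
  proof (cases "u = v")
    case False
    obtain a b c d where abcd: "\<forall>y. (\<forall>i. i \<noteq> u \<longrightarrow> i \<noteq> v \<longrightarrow> y i = x i) \<longrightarrow>
        lag E y = y u * y v * d + y u * a + y v * b + c \<and> dlag E u y = y v * d + a \<and> dlag E v y = y u * d + b"
      and d0': "(\<forall>i\<in>V. 0 \<le> x i) \<longrightarrow> 0 \<le> d"
      using lag_two_variables[OF V E False, of x] by - (elim exE conjE, rule that, assumption+)
    have d0: "d \<ge> 0" using d0' xD(1) by blast
    show ?thesis
    proof (rule ccontr)
      assume "\<not> ?thesis"
      hence lt: "dlag E u x - dlag E v x > 0" by simp
      define g where "g = dlag E u x - dlag E v x"
      \<comment> \<open>Moving weight \<open>t\<close> from \<open>v\<close> to \<open>u\<close>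
        gains \<open>t * g - t * t * d\<close>. The cap \<open>x v\<close> keeps the weight
        nonnegative; the second bound makes \<open>t * d < g\<close>, with \<open>d + 1\<close>
        guarding against \<open>d = 0\<close>.\<close>
      define t where "t = min (x v) (g / (2 * (d + 1)))"
      have t: "t > 0" "t \<le> x v" using pos[OF uv(2)] lt d0 by (auto simp: t_def g_def)
      define x' where "x' = x(u := x u + t, v := x v - t)"
      have "lag E x' \<le> lag E x"
        unfolding x'_def using t pos[OF uv(1)] by (intro opt move uv False) auto
      moreover have "lag E x' = lag E x + t * g - t * t * d"
      proof -
        have "lag E x' = x' u * x' v * d + x' u * a + x' v * b + c"
          by (rule abcd[THEN spec, THEN mp, THEN conjunct1]) (simp add: x'_def)
        moreover have "x' u = x u + t" "x' v = x v - t" using False by (auto simp: x'_def)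
        moreover have "lag E x = x u * x v * d + x u * a + x v * b + c \<and> dlag E u x = x v * d + a \<and> dlag E v x = x u * d + b"
          by (rule abcd[THEN spec, THEN mp]) simp
        ultimately show ?thesis unfolding g_def by (simp only:) (simp add: algebra_simps)
      qed
      ultimately have "t * g \<le> t * (t * d)" by simp
      hence "g \<le> t * d" using t by simp
      also have "t * d < t * (2 * (d + 1))" using t d0 by (intro mult_strict_left_mono) auto
      also have "t * (2 * (d + 1)) \<le> g"
      proof -
        have "t \<le> g / (2 * (d + 1))" by (simp add: t_def)
        thus ?thesis using d0 by (subst (asm) pos_le_divide_eq) auto
      qed
      finally show False by simp
    qed
  qed simp
  have deg: "dlag E v x = real r * lag E x" if v: "v \<in> S" for v
  proof -
    have "real r * lag E x = (\<Sum>u\<in>V. x u * dlag E u x)" by (simp add: sum_dlag[OF V E])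
    also have "\<dots> = (\<Sum>u\<in>S. x u * dlag E u x)"
      using SV V z by (intro sum.mono_neutral_right) auto
    also have "\<dots> = (\<Sum>u\<in>S. x u * dlag E v x)"
    proof (intro sum.cong refl)
      fix u assume "u \<in> S"
      thus "x u * dlag E u x = x u * dlag E v x" using eqd[of u v] eqd[of v u] v by simp
    qed
    also have "\<dots> = dlag E v x" using s1 by (simp flip: sum_distrib_right)
    finally show ?thesis by simp
  qed
  have cov: "\<exists>e\<in>E. u \<in> e \<and> v \<in> e \<and> e \<subseteq> S" if uv: "u \<in> S" "v \<in> S" "u \<noteq> v" for u v
  proof (rule ccontr)
    assume no: "\<not> ?thesis"
    have E': "E \<inter> nsets S r \<subseteq> nsets V r" using E by auto
    have no': "\<not> (\<exists>e\<in>E \<inter> nsets S r. u \<in> e \<and> v \<in> e)" using no by (auto simp: nsets_def)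
    obtain a b c d where abcd: "\<forall>y. (\<forall>i. i \<noteq> u \<longrightarrow> i \<noteq> v \<longrightarrow> y i = x i) \<longrightarrow>
        lag (E \<inter> nsets S r) y = y u * y v * d + y u * a + y v * b + c \<and>
        dlag (E \<inter> nsets S r) u y = y v * d + a \<and> dlag (E \<inter> nsets S r) v y = y u * d + b"
      and d0': "\<not> (\<exists>e\<in>E \<inter> nsets S r. u \<in> e \<and> v \<in> e) \<longrightarrow> d = 0"
      using lag_two_variables[OF V E' uv(3), of x] by - (elim exE conjE, rule that, assumption+)
    have d0: "d = 0" using d0' no' by blast
    have "a = dlag E u x" "b = dlag E v x"
    proof -
      have "dlag (E \<inter> nsets S r) u x = x v * d + a \<and> dlag (E \<inter> nsets S r) v x = x u * d + b"
        by (rule abcd[THEN spec, THEN mp, THEN conjunct2]) simp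
      thus "a = dlag E u x" "b = dlag E v x"
        using d0 lag_restrict(2)[OF V E, of S x] z uv by auto
    qed
    hence ab: "a = b" using deg uv by simp
    define x' where "x' = x(u := x u + x v, v := x v - x v)"
    have x'D: "x' \<in> D" unfolding x'_def using pos[OF uv(1)] pos[OF uv(2)] uv by (intro move) auto
    have x'z: "x' i = 0" if "i \<notin> S" for i using that uv z by (auto simp: x'_def)
    have "lag E x' = lag (E \<inter> nsets S r) x'" using lag_restrict(1)[OF V E, of S x'] x'z by simp
    also have "\<dots> = lag (E \<inter> nsets S r) x"
    proof -
      have "lag (E \<inter> nsets S r) x' = x' u * x' v * d + x' u * a + x' v * b + c"
        by (rule abcd[THEN spec, THEN mp, THEN conjunct1]) (simp add: x'_def)
      moreover have "lag (E \<inter> nsets S r) x = x u * x v * d + x u * a + x v * b + c"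
        by (rule abcd[THEN spec, THEN mp, THEN conjunct1]) simp
      moreover have "x' u = x u + x v" "x' v = 0" using uv(3) by (auto simp: x'_def)
      ultimately show ?thesis using d0 ab by (simp add: algebra_simps)
    qed
    also have "\<dots> = lag E x" using lag_restrict(1)[OF V E, of S x] z by simp
    finally have "x' \<in> Opt" using x'D opt by (auto simp: Opt_def)
    hence "card S \<le> card (supp x')" using xm by (simp add: S_def)
    moreover have "supp x' \<subseteq> S - {v}" 
    proof
      fix i assume "i \<in> supp x'"
      hence "x' i \<noteq> 0" by (simp add: supp_def)
      moreover have "x' v = 0" by (simp add: x'_def)
      ultimately show "i \<in> S - {v}" using x'z by auto
    qed
    hence "card (supp x') \<le> card (S - {v})" using SV by (intro card_mono) auto
    moreover have "card (S - {v}) < card S" using uv SV by (intro psubset_card_mono) auto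
    ultimately show False by simp
  qed
  have le: "lag (E \<inter> nsets S r) x = lag E x" using lag_restrict(1)[OF V E, of S x] z by simp
  have "opt_weights r S (E \<inter> nsets S r) x"
    unfolding opt_weights_def
  proof (intro conjI ballI impI)
    fix v assume "v \<in> S" thus "dlag (E \<inter> nsets S r) v x = real r * lag (E \<inter> nsets S r) x"
      using lag_restrict(2)[OF V E, of S x] z deg le by simp
  next
    fix u v assume "u \<in> S" "v \<in> S" "u \<noteq> v"
    thus "\<exists>e\<in>E \<inter> nsets S r. u \<in> e \<and> v \<in> e" using cov[of u v] edgeD[OF E] by (auto simp: nsets_def)
  qed (use SV pos s1 in auto)
  moreover have "lag E y \<le> lag (E \<inter> nsets S r) x" using opt[OF y'] ly le by simp
  ultimately show ?thesis using SV that by blast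
qed

section \<open>Supersaturation\<close>

definition indep :: "'a set set \<Rightarrow> 'a set \<Rightarrow> bool" where
  "indep E I \<longleftrightarrow> (\<forall>e\<in>E. \<not> e \<subseteq> I)"

text \<open>Erdos's theorem on complete partite subhypergraphs, for ordered tuples, so that
  positions can carry the labels of a pattern. By induction on the length: many tails have many
  first entries, hence some \<open>t\<close> first entries are shared by a positive proportion of
  the tails.\<close>

lemma dense_lists_contain_box:
  fixes \<delta> :: real
  assumes "\<delta> > 0" "t \<ge> 1"
  shows "\<exists>N. \<forall>n\<ge>N. \<forall>V :: 'a set. \<forall>L. finite V \<longrightarrow> card V = n \<longrightarrow>
    L \<subseteq> {xs. set xs \<subseteq> V \<and> length xs = m} \<longrightarrow> \<delta> * real n ^ m \<le> real (card L) \<longrightarrow>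
    (\<exists>T. (\<forall>i<m. T i \<subseteq> V \<and> card (T i) = t) \<and> {xs. length xs = m \<and> (\<forall>i<m. xs ! i \<in> T i)} \<subseteq> L)"
  using assms(1)
proof (induction m arbitrary: \<delta>)
  case 0
  show ?case
  proof (intro exI[of _ 0] allI impI)
    fix n and V :: "'a set" and L
    assume "L \<subseteq> {xs. set xs \<subseteq> V \<and> length xs = 0}" "\<delta> * real n ^ 0 \<le> real (card L)"
    hence "L \<noteq> {}" "L \<subseteq> {[]}" using 0 by auto
    thus "\<exists>T. (\<forall>i<0. T i \<subseteq> V \<and> card (T i) = t) \<and> {xs. length xs = 0 \<and> (\<forall>i<0. xs ! i \<in> T i)} \<subseteq> L"
      by auto
  qed
next
  case (Suc m)
  \<comment> \<open>Half of \<open>\<delta>\<close> is the proportion of tails kept; the power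
    bounds from below the share of the \<open>t\<close>-sets of vertices that lie in the
    neighbourhood of a kept tail.\<close>
  define \<delta>' where "\<delta>' = \<delta> / 2 * (\<delta> / (2 * real t)) ^ t"
  have "\<delta>' > 0" using Suc.prems assms(2) by (simp add: \<delta>'_def)
  from Suc.IH[OF this] obtain N where N: "\<forall>n\<ge>N. \<forall>V :: 'a set. \<forall>L. finite V \<longrightarrow> card V = n \<longrightarrow>
    L \<subseteq> {xs. set xs \<subseteq> V \<and> length xs = m} \<longrightarrow> \<delta>' * real n ^ m \<le> real (card L) \<longrightarrow>
    (\<exists>T. (\<forall>i<m. T i \<subseteq> V \<and> card (T i) = t) \<and> {xs. length xs = m \<and> (\<forall>i<m. xs ! i \<in> T i)} \<subseteq> L)" ..
  define N' where "N' = max N (nat \<lceil>2 * real t / \<delta>\<rceil> + 1)"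
  show ?case
  proof (intro exI[of _ N'] allI impI)
    fix n and V :: "'a set" and L
    assume n: "n \<ge> N'" and V: "finite V" "card V = n" and L: "L \<subseteq> {xs. set xs \<subseteq> V \<and> length xs = Suc m}"
      and big: "\<delta> * real n ^ Suc m \<le> real (card L)"
    have n1: "n \<ge> N" "n > 0" "real n \<ge> 2 * real t / \<delta>"
      using n by (auto simp: N'_def) linarith
    have nt: "\<delta> * real n / 2 \<ge> real t" using n1(3) Suc.prems by (simp add: field_simps)
    define Ys where "Ys = {ys. set ys \<subseteq> V \<and> length ys = m}"
    have fY: "finite Ys" "card Ys = n ^ m"
      using V finite_lists_length_eq[of V m] card_lists_length_eq[of V m] by (auto simp: Ys_def)
    define d where "d = (\<lambda>ys. {x\<in>V. x # ys \<in> L})"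
    have fd: "finite (d ys)" "d ys \<subseteq> V" for ys using V by (auto simp: d_def)
    have dn: "card (d ys) \<le> n" for ys using card_mono[OF V(1) fd(2)] V(2) by simp
    have "L = (\<lambda>(ys, x). x # ys) ` (SIGMA ys:Ys. d ys)"
    proof (intro equalityI subsetI)
      fix xs assume xs: "xs \<in> L"
      then obtain x ys where e: "xs = x # ys" using L by (cases xs) auto
      moreover have "set (x # ys) \<subseteq> V \<and> length (x # ys) = Suc m" using xs L e by blast
      ultimately have "(ys, x) \<in> (SIGMA ys:Ys. d ys)" using xs by (auto simp: Ys_def d_def)
      thus "xs \<in> (\<lambda>(ys, x). x # ys) ` (SIGMA ys:Ys. d ys)" using e by force
    qed (auto simp: d_def)
    moreover have "inj_on (\<lambda>(ys, x). x # ys) (SIGMA ys:Ys. d ys)" by (auto simp: inj_on_def)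
    ultimately have cL: "card L = (\<Sum>ys\<in>Ys. card (d ys))"
      using fY fd by (simp add: card_image)
    define Good where "Good = {ys\<in>Ys. \<delta> * real n / 2 \<le> real (card (d ys))}"
    have fG: "finite Good" "Good \<subseteq> Ys" using fY by (auto simp: Good_def)
    have "real (card L) = (\<Sum>ys\<in>Ys. real (card (d ys)))" using cL by simp
    also have "\<dots> \<le> (\<Sum>ys\<in>Ys. (if ys \<in> Good then real n else 0) + \<delta> * real n / 2)"
    proof (rule sum_mono)
      fix ys assume "ys \<in> Ys"
      thus "real (card (d ys)) \<le> (if ys \<in> Good then real n else 0) + \<delta> * real n / 2"
        using dn[of ys] Suc.prems by (auto simp: Good_def intro: add_increasing2)
    qed
    also have "\<dots> = real (card Good) * real n + real n ^ m * (\<delta> * real n / 2)"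
      using fY fG by (simp add: sum.distrib sum.If_cases Int_absorb1)
    finally have "\<delta> * real n ^ Suc m \<le> real (card Good) * real n + real n ^ m * (\<delta> * real n / 2)"
      using big by linarith
    hence "(\<delta> / 2 * real n ^ m) * real n \<le> real (card Good) * real n" by (simp add: algebra_simps)
    hence cG: "\<delta> / 2 * real n ^ m \<le> real (card Good)" using n1(2) by simp
    define a where "a = nat \<lceil>\<delta> * real n / 2\<rceil>"
    have a: "real a \<ge> \<delta> * real n / 2" unfolding a_def by linarith
    have at: "a \<ge> t" using a nt by linarith
    have ad: "a \<le> card (d ys)" if "ys \<in> Good" for ys
      using that unfolding a_def Good_def by (simp add: nat_le_iff ceiling_le_iff)
    define F where "F = (\<lambda>T. {ys\<in>Good. T \<subseteq> d ys})"
    have "(\<Sum>T\<in>nsets V t. card (F T)) = (\<Sum>ys\<in>Good. card {T\<in>nsets V t. T \<subseteq> d ys})"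
      unfolding F_def using V fG finite_imp_finite_nsets by (intro sum_multicount_gen) auto
    also have "\<dots> = (\<Sum>ys\<in>Good. card (d ys) choose t)"
    proof (intro sum.cong refl)
      fix ys
      have "{T\<in>nsets V t. T \<subseteq> d ys} = nsets (d ys) t" using fd by (auto simp: nsets_def)
      thus "card {T\<in>nsets V t. T \<subseteq> d ys} = card (d ys) choose t" by (simp add: card_nsets)
    qed
    also have "\<dots> \<ge> (\<Sum>ys\<in>Good. a choose t)"
      using ad by (intro sum_mono binomial_right_mono) auto
    finally have S: "card Good * (a choose t) \<le> (\<Sum>T\<in>nsets V t. card (F T))" by simp
    have "Good \<noteq> {}"
    proof
      assume "Good = {}"
      hence "\<delta> / 2 * real n ^ m \<le> 0" using cG by simp
      moreover have "\<delta> / 2 * real n ^ m > 0" using Suc.prems n1(2) by simp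
      ultimately show False by simp
    qed
    then obtain ys where "ys \<in> Good" by blast
    hence "t \<le> n" using at ad[of ys] dn[of ys] by linarith
    hence ne: "n choose t > 0" by simp
    \<comment> \<open>Averaging over all \<open>t\<close>-sets: some \<open>T\<close> lies in the
      neighbourhoods of at least the mean number of good tails.\<close>
    obtain T where T: "T \<in> nsets V t" "card Good * (a choose t) \<le> card (F T) * (n choose t)"
    proof (rule ccontr)
      assume "\<not> thesis"
      hence lt: "\<And>T. T \<in> nsets V t \<Longrightarrow> card (F T) * (n choose t) < card Good * (a choose t)"
        using that by (meson not_le)
      have fin: "finite (nsets V t)" "card (nsets V t) = n choose t"
        using V by (auto simp: finite_imp_finite_nsets card_nsets)
      hence "card (nsets V t) \<noteq> 0" using ne by linarith
      hence "nsets V t \<noteq> {}" by (metis card.empty)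
      have "(\<Sum>T\<in>nsets V t. card (F T) * (n choose t)) < (\<Sum>T\<in>nsets V t. card Good * (a choose t))"
        using fin \<open>nsets V t \<noteq> {}\<close> lt by (intro sum_strict_mono) auto
      hence "(\<Sum>T\<in>nsets V t. card (F T)) * (n choose t) < card (nsets V t) * (card Good * (a choose t))"
        by (simp only: sum_distrib_right sum_constant of_nat_id)
      with mult_le_mono1[OF S, of "n choose t"] show False
        by (simp only: fin(2) mult.commute[of "n choose t"] not_less[symmetric])
    qed
    have "\<delta>' * real n ^ m * real n ^ t = (\<delta> / 2 * real n ^ m) * ((\<delta> * real n / 2) / real t) ^ t"
      by (simp add: \<delta>'_def power_mult_distrib power_divide)
    also have "\<dots> \<le> real (card Good) * (real a / real t) ^ t"
      using cG a Suc.prems by (intro mult_mono power_mono divide_right_mono) auto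
    also have "\<dots> \<le> real (card Good) * real (a choose t)"
      using binomial_ge_n_over_k_pow_k[OF at, where 'a = real] by (intro mult_left_mono) auto
    also have "\<dots> \<le> real (card (F T)) * real (n choose t)"
      using T(2) by (metis of_nat_le_iff of_nat_mult)
    also have "\<dots> \<le> real (card (F T)) * real n ^ t"
      using binomial_le_pow[OF \<open>t \<le> n\<close>] by (intro mult_left_mono) (auto simp flip: of_nat_power)
    finally have bF: "\<delta>' * real n ^ m \<le> real (card (F T))" using n1(2) by simp
    have FV: "F T \<subseteq> {xs. set xs \<subseteq> V \<and> length xs = m}" using fG by (auto simp: F_def Ys_def)
    from N[rule_format, OF n1(1) V FV bF] obtain T' where T': "\<forall>i<m. T' i \<subseteq> V \<and> card (T' i) = t"
      "{xs. length xs = m \<and> (\<forall>i<m. xs ! i \<in> T' i)} \<subseteq> F T" by blast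
    define T'' where "T'' = (\<lambda>i. case i of 0 \<Rightarrow> T | Suc j \<Rightarrow> T' j)"
    have "T'' i \<subseteq> V \<and> card (T'' i) = t" if "i < Suc m" for i
      using that T(1) T'(1) by (cases i) (auto simp: T''_def nsets_def)
    moreover have "{xs. length xs = Suc m \<and> (\<forall>i<Suc m. xs ! i \<in> T'' i)} \<subseteq> L"
    proof
      fix xs assume xs: "xs \<in> {xs. length xs = Suc m \<and> (\<forall>i<Suc m. xs ! i \<in> T'' i)}"
      then obtain x ys where e: "xs = x # ys" by (cases xs) auto
      have "x \<in> T" using xs e by (auto simp: T''_def dest: spec[of _ 0])
      moreover have "ys ! i \<in> T' i" if "i < m" for i
        using xs e that by (auto simp: T''_def dest!: spec[of _ "Suc i"])
      hence "ys \<in> F T" using T'(2) xs e by auto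
      ultimately show "xs \<in> L" using e by (auto simp: F_def d_def)
    qed
    ultimately show "\<exists>T. (\<forall>i<Suc m. T i \<subseteq> V \<and> card (T i) = t) \<and>
        {xs. length xs = Suc m \<and> (\<forall>i<Suc m. xs ! i \<in> T i)} \<subseteq> L" by blast
  qed
qed

text \<open>The mean density of \<open>G\<close> on the \<open>m\<close>-sets is its density, at
  least \<open>c + \<epsilon>\<close>. A good set counts at most 1 and any other less than
  \<open>c\<close>, so the good ones have a share of at least \<open>\<epsilon>\<close>.\<close>

lemma many_dense_subsets:
  fixes c \<epsilon> :: real
  assumes V: "finite V" "card V = n" and G: "G \<subseteq> nsets V r" and m: "r \<le> m" "m \<le> n"
    and c: "c \<ge> 0" and dense: "(c + \<epsilon>) * real (n choose r) \<le> real (card G)"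
  shows "\<epsilon> * real (n choose m) \<le> real (card {A\<in>nsets V m. c * real (m choose r) \<le> real (card (G \<inter> nsets A r))})"
proof -
  define Good where "Good = {A\<in>nsets V m. c * real (m choose r) \<le> real (card (G \<inter> nsets A r))}"
  have fin: "finite (nsets V m)" "card (nsets V m) = n choose m"
    using V by (auto simp: finite_imp_finite_nsets card_nsets)
  have fG: "finite G" using G V finite_edges by blast
  have "(\<Sum>A\<in>nsets V m. card {e\<in>G. e \<subseteq> A}) = (\<Sum>e\<in>G. card {A\<in>nsets V m. e \<subseteq> A})"
    using fin fG by (intro sum_multicount_gen) auto
  also have "\<dots> = (\<Sum>e\<in>G. (n - r) choose (m - r))"
  proof (intro sum.cong refl)
    fix e assume "e \<in> G"
    hence e: "e \<subseteq> V" "finite e" "card e = r" using edgeD[OF G] by auto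
    have "{A\<in>nsets V m. e \<subseteq> A} = (\<lambda>B. B \<union> e) ` nsets (V - e) (m - r)"
    proof (intro equalityI subsetI)
      fix A assume A: "A \<in> {A\<in>nsets V m. e \<subseteq> A}"
      hence "A - e \<in> nsets (V - e) (m - r)" using e by (auto simp: nsets_def card_Diff_subset)
      moreover have "A = (A - e) \<union> e" using A by auto
      ultimately show "A \<in> (\<lambda>B. B \<union> e) ` nsets (V - e) (m - r)" by blast
    next
      fix A assume "A \<in> (\<lambda>B. B \<union> e) ` nsets (V - e) (m - r)"
      then obtain B where B: "B \<subseteq> V - e" "finite B" "card B = m - r" "A = B \<union> e" by (auto simp: nsets_def)
      have "card A = card B + card e" unfolding B(4) using B e by (intro card_Un_disjoint) auto
      thus "A \<in> {A\<in>nsets V m. e \<subseteq> A}" using B e m by (auto simp: nsets_def)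
    qed
    moreover have "inj_on (\<lambda>B. B \<union> e) (nsets (V - e) (m - r))" by (auto simp: inj_on_def nsets_def)
    ultimately show "card {A\<in>nsets V m. e \<subseteq> A} = (n - r) choose (m - r)"
      using e V by (simp add: card_image card_nsets card_Diff_subset)
  qed
  finally have "(\<Sum>A\<in>nsets V m. card {e\<in>G. e \<subseteq> A}) = card G * ((n - r) choose (m - r))" by simp
  moreover have "{e\<in>G. e \<subseteq> A} = G \<inter> nsets A r" for A using edgeD[OF G] by (auto simp: nsets_def)
  ultimately have S: "(\<Sum>A\<in>nsets V m. card (G \<inter> nsets A r)) = card G * ((n - r) choose (m - r))" by simp
  have mult: "(n choose m) * (m choose r) = (n choose r) * ((n - r) choose (m - r))"
    using m by (intro choose_mult)
  have "(c + \<epsilon>) * (real (n choose m) * real (m choose r))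
      = (c + \<epsilon>) * real (n choose r) * real ((n - r) choose (m - r))"
    using arg_cong[OF mult, of real] by simp
  also have "\<dots> \<le> real (card G) * real ((n - r) choose (m - r))"
    using dense by (intro mult_right_mono) auto
  also have "\<dots> = (\<Sum>A\<in>nsets V m. real (card (G \<inter> nsets A r)))"
    using arg_cong[OF S, of real] by simp
  also have "\<dots> \<le> (\<Sum>A\<in>nsets V m. (if A \<in> Good then real (m choose r) else 0) + c * real (m choose r))"
  proof (rule sum_mono)
    fix A assume A: "A \<in> nsets V m"
    have "card (G \<inter> nsets A r) \<le> card (nsets A r)"
      using A by (intro card_mono finite_imp_finite_nsets) (auto simp: nsets_def)
    also have "\<dots> = m choose r" unfolding card_nsets using A by (simp add: nsets_def)
    finally show "real (card (G \<inter> nsets A r)) \<le> (if A \<in> Good then real (m choose r) else 0) + c * real (m choose r)"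
      using A c by (auto simp: Good_def intro: add_increasing2)
  qed
  also have "\<dots> = real (card Good) * real (m choose r) + real (n choose m) * (c * real (m choose r))"
  proof -
    have "Good \<subseteq> nsets V m" by (auto simp: Good_def)
    thus ?thesis using fin by (simp add: sum.distrib sum.If_cases Int_absorb1)
  qed
  finally have "(\<epsilon> * real (n choose m)) * real (m choose r) \<le> real (card Good) * real (m choose r)"
    by (simp add: algebra_simps)
  thus ?thesis using m by (simp add: Good_def)
qed

text \<open>A positive share of the \<open>m\<close>-sets is dense in the complement, and by
  pigeonhole a positive share of all \<open>m\<close>-sets shows the same pattern when listed
  increasingly. The box theorem with sides of size \<open>q\<close> yields a blow-up of one pattern
  \<open>M\<close>. A weighting is realized by that many vertices of each part, and the clique of
  size \<open>p\<close> found among them meets only an independent set of parts.\<close>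

lemma dense_pattern:
  fixes c \<epsilon> :: real
  assumes rm: "r \<le> m" and c: "c \<ge> 0" and \<epsilon>: "\<epsilon> > 0" and q: "q \<ge> 1"
    and ex: "\<And>n0. \<exists>n\<ge>n0. \<exists>E. E \<subseteq> nsets {1..n::nat} r \<and> qp_property r {1..n} E q p \<and>
        real (card E) \<le> (1 - c - \<epsilon>) * real (n choose r)"
  shows "\<exists>M. M \<subseteq> nsets {..<m} r \<and> c * real (m choose r) \<le> real (card M) \<and>
    (\<forall>w. q \<le> sum w {..<m} \<longrightarrow> (\<exists>I\<subseteq>{..<m}. indep M I \<and> p \<le> sum w I))"
proof -
  \<comment> \<open>The number of labelled \<open>r\<close>-graphs on \<open>m\<close> vertices. In
    \<open>\<delta>\<close> below, \<open>real m ^ m\<close> pays for comparing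
    \<open>n choose m\<close> with the number of \<open>m\<close>-tuples.\<close>
  define K where "K = (2::nat) ^ (m choose r)"
  have K0: "K > 0" by (simp add: K_def)
  define \<delta> where "\<delta> = \<epsilon> / (real m ^ m * real K)"
  have mm: "real m ^ m > 0" by (cases m) auto
  have \<delta>: "\<delta> > 0" using \<epsilon> mm K0 by (simp add: \<delta>_def)
  obtain N where N: "\<forall>n\<ge>N. \<forall>V :: nat set. \<forall>L. finite V \<longrightarrow> card V = n \<longrightarrow>
    L \<subseteq> {xs. set xs \<subseteq> V \<and> length xs = m} \<longrightarrow> \<delta> * real n ^ m \<le> real (card L) \<longrightarrow>
    (\<exists>T. (\<forall>i<m. T i \<subseteq> V \<and> card (T i) = q) \<and> {xs. length xs = m \<and> (\<forall>i<m. xs ! i \<in> T i)} \<subseteq> L)"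
    using dense_lists_contain_box[OF \<delta> q] ..
  obtain n E where n: "n \<ge> max N (m + 1)" and E: "E \<subseteq> nsets {1..n} r" "qp_property r {1..n} E q p"
    "real (card E) \<le> (1 - c - \<epsilon>) * real (n choose r)" using ex by blast
  define V where "V = {1..n}"
  have V: "finite V" "card V = n" by (auto simp: V_def)
  define G where "G = nsets V r - E"
  have finV: "finite (nsets V k)" for k using V finite_imp_finite_nsets by blast
  have "card G = card (nsets V r) - card E"
    unfolding G_def using E(1) finV finite_subset by (subst card_Diff_subset) (auto simp: V_def)
  moreover have "card E \<le> card (nsets V r)" using E(1) finV by (intro card_mono) (auto simp: V_def)
  ultimately have "real (card G) = real (n choose r) - real (card E)" using V by (simp add: card_nsets of_nat_diff)
  hence dense: "(c + \<epsilon>) * real (n choose r) \<le> real (card G)" using E(3) by (simp add: algebra_simps)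
  have G: "G \<subseteq> nsets V r" by (auto simp: G_def)
  define Good where "Good = {A\<in>nsets V m. c * real (m choose r) \<le> real (card (G \<inter> nsets A r))}"
  have cGood: "\<epsilon> * real (n choose m) \<le> real (card Good)"
    unfolding Good_def using n by (intro many_dense_subsets[OF V G rm _ c dense]) auto
  have fGood: "finite Good" using finV by (simp add: Good_def)
  define sl where "sl = (sorted_list_of_set :: nat set \<Rightarrow> nat list)"
  have sl: "set (sl A) = A" "distinct (sl A)" "length (sl A) = m" if "A \<in> Good" for A
    using that by (auto simp: Good_def nsets_def sl_def)
  define pat where "pat = (\<lambda>xs. {e\<in>nsets {..<m} r. (!) xs ` e \<in> G})"
  have patc: "c * real (m choose r) \<le> real (card (pat (sl A)))" if A: "A \<in> Good" for A
  proof -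
    have "G \<inter> nsets A r \<subseteq> (\<lambda>f. (!) (sl A) ` f) ` pat (sl A)"
    proof
      fix e assume e: "e \<in> G \<inter> nsets A r"
      define f where "f = {i. i < m \<and> sl A ! i \<in> e}"
      have 1: "(!) (sl A) ` f = e"
      proof
        show "e \<subseteq> (!) (sl A) ` f"
        proof
          fix x assume x: "x \<in> e"
          hence "x \<in> set (sl A)" using e sl(1)[OF A] by (auto simp: nsets_def)
          then obtain i where "i < m" "sl A ! i = x" using sl(3)[OF A] by (metis in_set_conv_nth)
          thus "x \<in> (!) (sl A) ` f" using x by (auto simp: f_def)
        qed
      qed (auto simp: f_def)
      have "inj_on ((!) (sl A)) f"
        using sl(2,3)[OF A] by (auto simp: inj_on_def f_def nth_eq_iff_index_eq)
      from card_image[OF this] have "card f = r" using 1 e by (simp add: nsets_def)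
      hence "f \<in> pat (sl A)" using 1 e by (auto simp: pat_def nsets_def f_def)
      thus "e \<in> (\<lambda>f. (!) (sl A) ` f) ` pat (sl A)" using 1 by blast
    qed
    hence "card (G \<inter> nsets A r) \<le> card (pat (sl A))"
      by (intro surj_card_le) (auto simp: pat_def finite_imp_finite_nsets)
    thus ?thesis using A by (auto simp: Good_def)
  qed
  define Fib where "Fib = (\<lambda>M. {A\<in>Good. pat (sl A) = M})"
  define Ms where "Ms = Pow (nsets {..<m} r)"
  have fMs: "finite Ms" "card Ms = K" by (auto simp: Ms_def K_def card_Pow card_nsets finite_imp_finite_nsets)
  have "(\<Sum>M\<in>Ms. card (Fib M)) = card Good"
    using sum.group[OF fGood fMs(1), of "\<lambda>A. pat (sl A)" "\<lambda>_. 1::nat"]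
    by (auto simp: Fib_def Ms_def pat_def)
  moreover have "\<exists>M\<in>Ms. card Good \<le> K * card (Fib M)"
  proof (rule ccontr)
    assume "\<not> ?thesis"
    hence lt: "\<And>M. M \<in> Ms \<Longrightarrow> K * card (Fib M) < card Good" by (auto simp: not_le)
    have "Ms \<noteq> {}" by (auto simp: Ms_def)
    hence "(\<Sum>M\<in>Ms. K * card (Fib M)) < (\<Sum>M\<in>Ms. card Good)"
      using fMs lt by (intro sum_strict_mono) auto
    thus False using calculation fMs by (simp flip: sum_distrib_left)
  qed
  ultimately obtain M where M: "M \<in> Ms" "card Good \<le> K * card (Fib M)" by blast
  have "card Good > 0"
  proof -
    have "n choose m > 0" using n by simp
    hence "\<epsilon> * real (n choose m) > 0" using \<epsilon> by simp
    thus ?thesis using cGood by linarith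
  qed
  hence "card (Fib M) \<noteq> 0" using M(2) by (intro notI) simp
  hence "Fib M \<noteq> {}" by (intro notI) simp
  then obtain A0 where "A0 \<in> Good" "pat (sl A0) = M" by (auto simp: Fib_def)
  hence cM: "c * real (m choose r) \<le> real (card M)" using patc[of A0] by simp
  define L where "L = sl ` Fib M"
  have "inj_on sl (Fib M)"
  proof (rule inj_onI)
    fix A B assume AB: "A \<in> Fib M" "B \<in> Fib M" "sl A = sl B"
    have "A = set (sl A)" using sl(1)[of A] AB(1) by (simp add: Fib_def)
    also have "\<dots> = set (sl B)" by (rule arg_cong[OF AB(3)])
    also have "\<dots> = B" using sl(1)[of B] AB(2) by (simp add: Fib_def)
    finally show "A = B" .
  qed
  hence cL: "card L = card (Fib M)" unfolding L_def by (rule card_image)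
  have "\<delta> * real n ^ m = \<epsilon> * (real n / real m) ^ m / real K" by (simp add: \<delta>_def power_divide)
  also have "\<dots> \<le> \<epsilon> * real (n choose m) / real K"
    using n \<epsilon> binomial_ge_n_over_k_pow_k[of m n, where 'a = real]
    by (intro divide_right_mono mult_left_mono) auto
  also have "\<dots> \<le> real (card Good) / real K" using cGood by (intro divide_right_mono) auto
  also have "\<dots> \<le> real (card L)"
  proof -
    have "real (card Good) \<le> real K * real (card L)" using M(2) cL by (metis of_nat_le_iff of_nat_mult)
    thus ?thesis using K0 by (simp add: field_simps)
  qed
  finally have bL: "\<delta> * real n ^ m \<le> real (card L)" .
  have LL: "L \<subseteq> {xs. set xs \<subseteq> V \<and> length xs = m}"
  proof
    fix xs assume "xs \<in> L"
    then obtain A where A: "A \<in> Good" "xs = sl A" by (auto simp: L_def Fib_def)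
    thus "xs \<in> {xs. set xs \<subseteq> V \<and> length xs = m}" using sl[OF A(1)] by (auto simp: Good_def nsets_def)
  qed
  obtain T where T: "\<forall>i<m. T i \<subseteq> V \<and> card (T i) = q" "{xs. length xs = m \<and> (\<forall>i<m. xs ! i \<in> T i)} \<subseteq> L"
    using N[rule_format, OF _ V LL bL] n by auto
  have Lpat: "distinct xs \<and> pat xs = M" if "xs \<in> L" for xs
    using that sl(2) by (auto simp: L_def Fib_def)
  have fT: "finite (T i)" "T i \<noteq> {}" if "i < m" for i
    using that T(1) V(1) q finite_subset by (blast, force)
  have box: "distinct (map y [0..<m]) \<and> pat (map y [0..<m]) = M" if "\<And>i. i < m \<Longrightarrow> y i \<in> T i" for y
    using that T(2) by (intro Lpat) auto
  define t0 where "t0 = (\<lambda>i. SOME x. x \<in> T i)"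
  have t0: "t0 i \<in> T i" if "i < m" for i using fT(2)[OF that] by (simp add: t0_def some_in_eq)
  \<comment> \<open>A vertex shared by two sides could fill both positions of one tuple, but the
    tuples in \<open>L\<close> are distinct lists.\<close>
  have disj: "T i \<inter> T j = {}" if "i < m" "j < m" "i \<noteq> j" for i j
  proof (rule ccontr)
    assume "T i \<inter> T j \<noteq> {}"
    then obtain x where x: "x \<in> T i" "x \<in> T j" by blast
    define y where "y = t0(i := x, j := x)"
    have "distinct (map y [0..<m])" using box[of y] t0 x by (auto simp: y_def)
    hence "inj_on y {0..<m}" by (simp add: distinct_map)
    moreover have "y i = y j" by (simp add: y_def)
    ultimately show False using that by (auto simp: inj_on_def)
  qed
  have "\<exists>I\<subseteq>{..<m}. indep M I \<and> p \<le> sum w I" if w: "q \<le> sum w {..<m}" for w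
  proof -
    \<comment> \<open>The sides have only \<open>q\<close> vertices, so weights are cut off at
      \<open>q\<close>; the total stays at least \<open>q\<close>.\<close>
    have "\<exists>W. \<forall>i\<in>{..<m}. W i \<subseteq> T i \<and> card (W i) = min (w i) q"
    proof (intro bchoice ballI)
      fix i assume "i \<in> {..<m}"
      hence "min (w i) q \<le> card (T i)" using T(1) by auto
      from obtain_subset_with_card_n[OF this] show "\<exists>W. W \<subseteq> T i \<and> card W = min (w i) q" by metis
    qed
    then obtain W where W: "\<And>i. i < m \<Longrightarrow> W i \<subseteq> T i" "\<And>i. i < m \<Longrightarrow> card (W i) = min (w i) q" by auto
    have fW: "finite (W i)" if "i < m" for i using W(1) fT(1) finite_subset that by blast
    define U where "U = (\<Union>i<m. W i)"
    have "card U = (\<Sum>i<m. card (W i))"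
      unfolding U_def
    proof (intro card_UN_disjoint ballI impI)
      fix i j assume "i \<in> {..<m}" "j \<in> {..<m}" "i \<noteq> j"
      thus "W i \<inter> W j = {}" using disj[of i j] W(1)[of i] W(1)[of j] by auto
    qed (use fW in auto)
    also have "\<dots> = (\<Sum>i<m. min (w i) q)" using W(2) by auto
    also have "\<dots> \<ge> q"
    proof (cases "\<exists>i<m. w i \<ge> q")
      case True
      then obtain i where i: "i < m" "w i \<ge> q" by blast
      hence "q = min (w i) q" by simp
      also have "\<dots> \<le> (\<Sum>i<m. min (w i) q)" using i by (intro member_le_sum) auto
      finally show ?thesis .
    next
      case False
      hence "(\<Sum>i<m. min (w i) q) = sum w {..<m}" by (intro sum.cong) auto
      thus ?thesis using w by simp
    qed
    finally have "q \<le> card U" .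
    then obtain Q where Q: "Q \<subseteq> U" "card Q = q" "finite Q" by (rule obtain_subset_with_card_n)
    have WV: "W i \<subseteq> V" if "i < m" for i using W(1)[OF that] T(1) that by blast
    have "Q \<subseteq> V"
    proof
      fix z assume "z \<in> Q"
      then obtain i where "i < m" "z \<in> W i" using Q(1) by (auto simp: U_def)
      thus "z \<in> V" using WV by blast
    qed
    hence "Q \<in> nsets V q" using Q by (auto simp: nsets_def)
    then obtain R where R: "R \<in> nsets Q p" "nsets R r \<subseteq> E"
      using E(2) unfolding qp_property_def hyperclique_def V_def by blast
    define I where "I = {i. i < m \<and> R \<inter> W i \<noteq> {}}"
    have "R \<subseteq> (\<Union>i\<in>I. W i)"
    proof
      fix z assume z: "z \<in> R"
      hence "z \<in> U" using R(1) Q(1) by (auto simp: nsets_def)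
      then obtain i where "i < m" "z \<in> W i" by (auto simp: U_def)
      thus "z \<in> (\<Union>i\<in>I. W i)" using z by (auto simp: I_def)
    qed
    moreover have "finite (\<Union>i\<in>I. W i)" using fW by (auto simp: I_def)
    ultimately have "card R \<le> card (\<Union>i\<in>I. W i)" by (intro card_mono)
    also have "\<dots> \<le> (\<Sum>i\<in>I. card (W i))" by (intro card_UN_le) (auto simp: I_def)
    also have "\<dots> \<le> sum w I" using W(2) by (intro sum_mono) (auto simp: I_def)
    finally have "p \<le> sum w I" using R(1) by (simp add: nsets_def)
    moreover have "indep M I"
      unfolding indep_def
    proof (intro ballI notI)
      fix e assume e: "e \<in> M" "e \<subseteq> I"
      \<comment> \<open>An edge of \<open>M\<close> inside \<open>I\<close> picks one vertex of the
        clique in each of its parts; the tuple through these vertices has pattern \<open>M\<close>,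
        so they would form a non-edge inside the clique.\<close>
      define y where "y = (\<lambda>i. if i \<in> I then SOME x. x \<in> R \<inter> W i else t0 i)"
      have yI: "y i \<in> R \<inter> W i" if "i \<in> I" for i
        using that some_in_eq[of "R \<inter> W i"] by (auto simp: y_def I_def)
      have "y i \<in> T i" if "i < m" for i
        using that yI[of i] W(1)[of i] t0 by (cases "i \<in> I") (auto simp: y_def)
      from box[OF this] have "e \<in> pat (map y [0..<m])" using e by simp
      hence "(!) (map y [0..<m]) ` e \<in> G" by (simp add: pat_def)
      also have "(!) (map y [0..<m]) ` e = y ` e" using e(2) by (intro image_cong) (auto simp: I_def)
      finally have yG: "y ` e \<in> G" .
      moreover have "y ` e \<subseteq> R" using e(2) yI by auto
      ultimately have "y ` e \<in> nsets R r" using edgeD[OF G] by (auto simp: nsets_def)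
      thus False using R(2) yG by (auto simp: G_def)
    qed
    moreover have "I \<subseteq> {..<m}" by (auto simp: I_def)
    ultimately show ?thesis by blast
  qed
  thus ?thesis using M(1) cM by (auto simp: Ms_def)
qed

text \<open>If the density were smaller, dense patterns on arbitrarily many vertices would exist;
  uniform weights on such a pattern, improved to an optimum, would violate
  \<open>core\<close>.\<close>

lemma turan_dens_ge:
  fixes c :: real
  assumes pq: "p \<le> q" and q: "q \<ge> 1" and c: "c \<ge> 0"
    and core: "\<And>S E x. opt_weights r (S :: nat set) E x \<Longrightarrow>
      (\<And>w. q \<le> sum w S \<Longrightarrow> \<exists>I\<subseteq>S. indep E I \<and> p \<le> sum w I) \<Longrightarrow> fact r * lag E x \<le> c"
  shows "1 - c \<le> turan_dens r q p"
proof (rule ccontr)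
  assume "\<not> ?thesis"
  hence lt: "turan_dens r q p < 1 - c" by simp
  \<comment> \<open>Three shares of the gap: one raises the pattern density above \<open>c\<close>,
    one feeds supersaturation, one keeps the comparison with the limit strict.\<close>
  define \<epsilon> where "\<epsilon> = (1 - c - turan_dens r q p) / 3"
  have \<epsilon>: "\<epsilon> > 0" using lt by (simp add: \<epsilon>_def)
  have "turan_dens r q p < 1 - c - \<epsilon> - \<epsilon>" using \<epsilon> by (simp add: \<epsilon>_def field_simps)
  hence ev: "eventually (\<lambda>n. real (turan_num r n q p) / real (n choose r) < 1 - c - \<epsilon> - \<epsilon>) sequentially"
    using order_tendstoD(2)[OF turan_dens_limit[OF pq]] by blast
  have ex: "\<exists>n\<ge>n0. \<exists>E. E \<subseteq> nsets {1..n::nat} r \<and> qp_property r {1..n} E q p \<and>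
      real (card E) \<le> (1 - (c + \<epsilon>) - \<epsilon>) * real (n choose r)" for n0
  proof -
    obtain n where n: "n \<ge> max n0 r" "real (turan_num r n q p) / real (n choose r) < 1 - c - \<epsilon> - \<epsilon>"
      using eventually_happens[OF eventually_conj[OF ev eventually_ge_at_top[of "max n0 r"]]] by auto
    hence "real (turan_num r n q p) \<le> (1 - c - \<epsilon> - \<epsilon>) * real (n choose r)" by (simp add: field_simps)
    moreover obtain E where "E \<subseteq> nsets {1..n} r" "qp_property r {1..n} E q p" "card E = turan_num r n q p"
      using turan_num_attained[OF pq] .
    ultimately show ?thesis using n(1) by (intro exI[of _ n] conjI exI[of _ E]) (auto simp: algebra_simps)
  qed
  \<comment> \<open>Uniform weights compare \<open>m choose r\<close> with
    \<open>m ^ r / fact r\<close>. The loss is at most the factor shown, which tends to 1, so a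
    large \<open>m\<close> lets \<open>c + \<epsilon>\<close> absorb it.\<close>
  have "(\<lambda>m. (c + \<epsilon>) * (1 - real r / real m) ^ r) \<longlonglongrightarrow> (c + \<epsilon>) * (1 - 0) ^ r"
    by (intro tendsto_intros lim_const_over_n)
  hence "eventually (\<lambda>m. c < (c + \<epsilon>) * (1 - real r / real m) ^ r) sequentially"
    using \<epsilon> by (intro order_tendstoD(1)) auto
  then obtain m where m: "m \<ge> max r 1" "c < (c + \<epsilon>) * (1 - real r / real m) ^ r"
    using eventually_happens[OF eventually_conj[OF _ eventually_ge_at_top[of "max r 1"]]] by auto
  obtain M where M: "M \<subseteq> nsets {..<m} r" "(c + \<epsilon>) * real (m choose r) \<le> real (card M)"
    "\<And>w. q \<le> sum w {..<m} \<Longrightarrow> \<exists>I\<subseteq>{..<m}. indep M I \<and> p \<le> sum w I"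
    using dense_pattern[of r m "c + \<epsilon>" \<epsilon> q p, OF _ _ \<epsilon> q ex] m(1) c \<epsilon> by auto
  define y where "y = (\<lambda>i::nat. 1 / real m)"
  have "sum y {..<m} = 1" "\<And>i. 0 \<le> y i" using m by (auto simp: y_def)
  then obtain S x where S: "S \<subseteq> {..<m}" "opt_weights r S (M \<inter> nsets S r) x" "lag (M \<inter> nsets S r) x \<ge> lag M y"
    using optimal_weights_exist[OF _ M(1), of y] by auto
  have "lag M y = real (card M) * (1 / real m) ^ r"
  proof -
    have "lag M y = (\<Sum>e\<in>M. (1 / real m) ^ r)"
      unfolding lag_def y_def using edgeD[OF M(1)] by (intro sum.cong) auto
    thus ?thesis by simp
  qed
  moreover have "fact r * real (m choose r) \<ge> (real m - real r) ^ r"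
  proof -
    have "fact r * real (m choose r) = (\<Prod>i<r. real m - real i)"
      by (simp add: binomial_gbinomial gbinomial_prod_rev lessThan_atLeast0)
    also have "\<dots> \<ge> (\<Prod>i<r. real m - real r)" using m(1) by (intro prod_mono) auto
    finally show ?thesis by simp
  qed
  ultimately have "fact r * lag M y \<ge> (c + \<epsilon>) * ((real m - real r) ^ r * (1 / real m) ^ r)"
  proof -
    assume a: "lag M y = real (card M) * (1 / real m) ^ r" and b: "(real m - real r) ^ r \<le> fact r * real (m choose r)"
    have "(c + \<epsilon>) * ((real m - real r) ^ r * (1 / real m) ^ r)
        \<le> (c + \<epsilon>) * ((fact r * real (m choose r)) * (1 / real m) ^ r)"
      using b c \<epsilon> by (intro mult_left_mono mult_right_mono) auto
    also have "\<dots> = fact r * ((c + \<epsilon>) * real (m choose r)) * (1 / real m) ^ r" by simp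
    also have "\<dots> \<le> fact r * real (card M) * (1 / real m) ^ r"
      using M(2) by (intro mult_right_mono mult_left_mono) auto
    finally show ?thesis using a by simp
  qed
  also have "(real m - real r) ^ r * (1 / real m) ^ r = (1 - real r / real m) ^ r"
    using m(1) by (simp add: field_simps flip: power_mult_distrib)
  finally have "c < fact r * lag M y" using m(2) by simp
  also have "\<dots> \<le> fact r * lag (M \<inter> nsets S r) x" using S(3) by (intro mult_left_mono) auto
  also have "\<dots> \<le> c"
  proof (rule core[OF S(2)])
    fix w assume w: "q \<le> sum w S"
    define w' where "w' = (\<lambda>i. if i \<in> S then w i else 0)"
    have "sum w' {..<m} = sum w S"
      unfolding w'_def using S(1) by (simp add: sum.If_cases Int_absorb1)
    then obtain I where I: "I \<subseteq> {..<m}" "indep M I" "p \<le> sum w' I" using M(3)[of w'] w by auto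
    have "sum w' I = sum w (I \<inter> S)"
      unfolding w'_def using finite_subset[OF I(1)] by (simp add: sum.If_cases Int_commute Collect_conj_eq)
    moreover have "indep (M \<inter> nsets S r) (I \<inter> S)" using I(2) by (auto simp: indep_def)
    ultimately show "\<exists>I\<subseteq>S. indep (M \<inter> nsets S r) I \<and> p \<le> sum w I"
      using I(3) by (intro exI[of _ "I \<inter> S"]) auto
  qed
  finally show False by simp
qed

text \<open>The fractional chromatic number of \<open>E\<close> is below \<open>1/\<theta>\<close>, as far as weightings of total at most \<open>K\<close> can
  tell. The bound \<open>K\<close> makes the condition a consequence of the \<open>(q,p)\<close>-property for large \<open>p\<close>: scale \<open>w\<close> up to
  total \<open>q\<close>.\<close>

definition rich :: "real \<Rightarrow> nat \<Rightarrow> 'a set \<Rightarrow> 'a set set \<Rightarrow> bool" where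
  "rich \<theta> K S E \<longleftrightarrow> (\<forall>w :: 'a \<Rightarrow> nat. 0 < sum w S \<longrightarrow> sum w S \<le> K \<longrightarrow>
     (\<exists>I\<subseteq>S. indep E I \<and> \<theta> * real (sum w S) < real (sum w I)))"

text \<open>Multiply \<open>w\<close>, of total \<open>N\<close>, by about
  \<open>p / (\<theta> * N)\<close>. As \<open>1 / \<theta>\<close> exceeds \<open>\<gamma>\<close>
  by \<open>d\<close>, the scaled total exceeds \<open>\<gamma> * p\<close> once
  \<open>p * d\<close> beats the rounding loss, which is at most \<open>K\<close>. An independent
  set of scaled weight more than \<open>p\<close> has original weight more than
  \<open>\<theta> * N\<close>, because the factor was rounded down.\<close>

lemma rich_eventually:
  assumes \<theta>: "\<theta> > 0" "\<theta> * \<gamma> < 1" and \<gamma>: "\<gamma> \<ge> 0"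
  obtains p0 where "\<And>p S E. p \<ge> p0 \<Longrightarrow>
      (\<And>w. nat \<lfloor>\<gamma> * real p\<rfloor> + 1 \<le> sum w S \<Longrightarrow> \<exists>I\<subseteq>S. indep E I \<and> p + 1 \<le> sum w I) \<Longrightarrow> rich \<theta> K S E"
proof -
  define d where "d = 1 / \<theta> - \<gamma>"
  have d: "d > 0" using \<theta> by (simp add: d_def field_simps)
  define p0 where "p0 = nat \<lceil>(real K + 1) / d\<rceil> + 1"
  have "rich \<theta> K S E" if p: "p \<ge> p0"
    and ex: "\<And>w. nat \<lfloor>\<gamma> * real p\<rfloor> + 1 \<le> sum w S \<Longrightarrow> \<exists>I\<subseteq>S. indep E I \<and> p + 1 \<le> sum w I" for p S E
    unfolding rich_def
  proof (intro allI impI)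
    fix w assume w: "0 < sum w S" "sum w S \<le> K"
    define N where "N = sum w S"
    define k where "k = nat \<lfloor>real p / (\<theta> * real N)\<rfloor>"
    have N0: "N > 0" "real N \<le> real K" using w by (auto simp: N_def simp del: of_nat_sum)
    have "real p > (real K + 1) / d" using p unfolding p0_def by linarith
    hence pd: "real p * d > real K + 1" using d by (simp add: field_simps)
    have k1: "real k > real p / (\<theta> * real N) - 1" unfolding k_def by linarith
    have "real k = real_of_int \<lfloor>real p / (\<theta> * real N)\<rfloor>"
      unfolding k_def using \<theta> N0 by (intro of_nat_nat) auto
    hence k2: "real k \<le> real p / (\<theta> * real N)" by simp
    have "real (k * N) = real k * real N" by simp
    also have "\<dots> \<ge> (real p / (\<theta> * real N) - 1) * real N" using k1 N0 by (intro mult_right_mono) auto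
    also have "(real p / (\<theta> * real N) - 1) * real N = real p / \<theta> - real N" using N0 \<theta> by (simp add: field_simps)
    also have "real p / \<theta> = real p * d + \<gamma> * real p" by (simp add: d_def algebra_simps)
    finally have "real (k * N) \<ge> \<gamma> * real p + 1" using pd N0 by linarith
    moreover have "real (nat \<lfloor>\<gamma> * real p\<rfloor>) \<le> \<gamma> * real p" using \<gamma> by (intro of_nat_floor) auto
    ultimately have "real (nat \<lfloor>\<gamma> * real p\<rfloor> + 1) \<le> real (k * N)" by simp
    hence kN: "nat \<lfloor>\<gamma> * real p\<rfloor> + 1 \<le> k * N" by (simp only: of_nat_le_iff)
    have "nat \<lfloor>\<gamma> * real p\<rfloor> + 1 \<le> (\<Sum>i\<in>S. k * w i)" using kN by (simp add: N_def sum_distrib_left)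
    from ex[OF this] obtain I where I: "I \<subseteq> S" "indep E I" "p + 1 \<le> (\<Sum>i\<in>I. k * w i)" by blast
    hence "real p < real k * real (sum w I)"
      by (metis Suc_eq_plus1 Suc_le_eq of_nat_less_iff of_nat_mult sum_distrib_left)
    also have "\<dots> \<le> real p / (\<theta> * real N) * real (sum w I)" using k2 by (intro mult_right_mono) (auto intro!: sum_nonneg)
    finally have *: "real p < real p / (\<theta> * real N) * real (sum w I)" .
    hence "real p > 0" by (cases "p = 0") auto
    with * have "\<theta> * real N < real (sum w I)" using \<theta> N0 by (simp add: field_simps)
    thus "\<exists>I\<subseteq>S. indep E I \<and> \<theta> * real (sum w S) < real (sum w I)" using I by (auto simp: N_def)
  qed
  thus ?thesis using that by blast
qed

lemma turan_dens_ge_gamma: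
  assumes \<gamma>: "\<gamma> \<ge> 1" and \<theta>: "\<theta> > 0" "\<theta> * \<gamma> < 1" and c: "c \<ge> 0"
    and core: "\<And>S E x. opt_weights r (S :: nat set) E x \<Longrightarrow> rich \<theta> K S E \<Longrightarrow> fact r * lag E x \<le> c"
  shows "\<exists>p0>0. \<forall>p\<ge>p0. 1 - c \<le> turan_dens r (nat \<lfloor>\<gamma> * real p\<rfloor> + 1) (p + 1)"
proof -
  obtain p0 where p0: "\<And>p S E. p \<ge> p0 \<Longrightarrow>
      (\<And>w. nat \<lfloor>\<gamma> * real p\<rfloor> + 1 \<le> sum w S \<Longrightarrow> \<exists>I\<subseteq>S. indep E I \<and> p + 1 \<le> sum w I) \<Longrightarrow>
      rich \<theta> K (S :: nat set) E"
    using rich_eventually[OF \<theta>, where K = K] \<gamma> by auto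
  have "1 - c \<le> turan_dens r (nat \<lfloor>\<gamma> * real p\<rfloor> + 1) (p + 1)" if p: "p \<ge> p0" for p
  proof (rule turan_dens_ge[OF _ _ c])
    have "real p \<le> \<gamma> * real p" using \<gamma> by (simp add: mult_le_cancel_right1)
    thus "p + 1 \<le> nat \<lfloor>\<gamma> * real p\<rfloor> + 1" by (simp add: le_nat_floor)
  qed (use core p0[OF p] in auto)
  thus ?thesis by (intro exI[of _ "p0 + 1"]) auto
qed

text \<open>The limit is known to exist, so infinitely many \<open>n\<close> suffice and the
  constructions can use multiples of a fixed number.\<close>

lemma turan_dens_le:
  assumes pq: "p \<le> q" and ex: "\<And>n0. \<exists>n\<ge>n0. real (turan_num r n q p) \<le> L * real (n choose r)"
  shows "turan_dens r q p \<le> L"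
proof (rule ccontr)
  assume "\<not> ?thesis"
  hence "eventually (\<lambda>n. L < real (turan_num r n q p) / real (n choose r)) sequentially"
    using order_tendstoD(1)[OF turan_dens_limit[OF pq]] by auto
  then obtain N where N: "\<And>n. n \<ge> N \<Longrightarrow> L < real (turan_num r n q p) / real (n choose r)"
    by (auto simp: eventually_sequentially)
  obtain n where n: "n \<ge> max N r" "real (turan_num r n q p) \<le> L * real (n choose r)" using ex by blast
  have "n choose r > 0" using n by simp
  thus False using N[of n] n by (simp add: field_simps)
qed

section \<open>Constructions\<close>

text \<open>In the blow-up with part sizes \<open>s\<close>, different choice functions on
  \<open>j\<close> give different transversals, and \<open>fst\<close> recovers \<open>j\<close>
  from each of them.\<close>

lemma card_transversals:
  assumes J: "J \<subseteq> nsets I r" and I: "finite (I :: 'i set)"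
  shows "(\<Sum>j\<in>J. prod s j) \<le> card {e \<in> nsets (SIGMA i:I. {..<s i}) r. fst ` e \<in> J}"
proof -
  define V where "V = (SIGMA i:I. {..<s i})"
  define G where "G = {e\<in>nsets V r. fst ` e \<in> J}"
  define G' where "G' = (\<lambda>j. (\<lambda>f. (\<lambda>i. (i, f i)) ` j) ` PiE j (\<lambda>i. {..<s i}))"
  have fJ: "finite J" using J I finite_edges by blast
  have im: "fst ` e = j" if "e \<in> G' j" for e j using that by (force simp: G'_def)
  have c: "card (G' j) = prod s j" if "j \<in> J" for j
  proof -
    have fj: "finite j" using that J by (auto simp: nsets_def)
    have "inj_on (\<lambda>f. (\<lambda>i. (i, f i)) ` j) (PiE j (\<lambda>i. {..<s i}))"
    proof (rule inj_onI)
      fix f g assume f: "f \<in> PiE j (\<lambda>i. {..<s i})" and g: "g \<in> PiE j (\<lambda>i. {..<s i})"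
        and eq: "(\<lambda>i. (i, f i)) ` j = (\<lambda>i. (i, g i)) ` j"
      have "f i = g i" if "i \<in> j" for i
      proof -
        have "(i, f i) \<in> (\<lambda>i. (i, g i)) ` j" using that eq by blast
        thus ?thesis by auto
      qed
      thus "f = g" using f g by (intro PiE_ext) auto
    qed
    thus ?thesis using fj by (simp add: G'_def card_image card_PiE)
  qed
  have fG': "finite (G' j)" if "j \<in> J" for j
    using that J by (auto simp: G'_def nsets_def intro!: finite_imageI finite_PiE)
  have "(\<Union>j\<in>J. G' j) \<subseteq> G"
  proof
    fix e assume "e \<in> (\<Union>j\<in>J. G' j)"
    then obtain j f where j: "j \<in> J" "e \<in> G' j" and f: "f \<in> PiE j (\<lambda>i. {..<s i})" "e = (\<lambda>i. (i, f i)) ` j"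
      by (auto simp: G'_def)
    have jI: "j \<subseteq> I" "finite j" "card j = r" using j J by (auto simp: nsets_def)
    have "card e = r" unfolding f(2) using jI by (subst card_image) (auto simp: inj_on_def)
    moreover have "e \<subseteq> V" using f jI by (auto simp: V_def dest!: PiE_mem)
    ultimately show "e \<in> G" using im[OF j(2)] j jI f(2) by (auto simp: G_def nsets_def)
  qed
  moreover have "finite V" using I by (simp add: V_def)
  hence "finite G" by (simp add: G_def finite_imp_finite_nsets)
  ultimately have "card (\<Union>j\<in>J. G' j) \<le> card G" by (intro card_mono)
  moreover have "card (\<Union>j\<in>J. G' j) = (\<Sum>j\<in>J. card (G' j))"
  proof (intro card_UN_disjoint ballI impI fJ)
    fix i j :: "'i set" assume "i \<noteq> j"
    thus "G' i \<inter> G' j = {}" using im by blast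
  qed (use fG' in auto)
  ultimately show ?thesis using c by (simp add: G_def V_def)
qed

text \<open>Non-edges are the transversal sets whose set of parts belongs to the pattern \<open>J\<close>.\<close>

lemma turan_num_pattern:
  assumes J: "J \<subseteq> nsets I r" and I: "finite (I :: 'i set)"
    and small: "\<And>a. sum a I = q \<Longrightarrow> \<exists>I0\<subseteq>I. indep J I0 \<and> p \<le> sum a I0"
  shows "turan_num r (sum s I) q p + (\<Sum>j\<in>J. prod s j) \<le> sum s I choose r"
proof -
  define V where "V = (SIGMA i:I. {..<s i})"
  define G where "G = {e\<in>nsets V r. fst ` e \<in> J}"
  define E where "E = nsets V r - G"
  have V: "finite V" "card V = sum s I" using I by (auto simp: V_def)
  have fin: "finite (nsets V r)" using V finite_imp_finite_nsets by blast
  have cG: "(\<Sum>j\<in>J. prod s j) \<le> card G"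
    unfolding G_def V_def by (rule card_transversals[OF J I])
  have "qp_property r V E q p"
    unfolding qp_property_def hyperclique_def
  proof
    fix Q assume Q: "Q \<in> nsets V q"
    hence Q': "Q \<subseteq> V" "finite Q" "card Q = q" by (auto simp: nsets_def)
    \<comment> \<open>Only the number of vertices of \<open>Q\<close> in each part matters: the
      parts of an independent \<open>I0\<close> contain no transversal of a pattern edge.\<close>
    define a where "a = (\<lambda>i. card {x\<in>Q. fst x = i})"
    have sa: "sum a I' = card {x\<in>Q. fst x \<in> I'}" if "I' \<subseteq> I" for I'
    proof -
      have "card (\<Union>i\<in>I'. {x\<in>Q. fst x = i}) = sum a I'"
        unfolding a_def using Q' finite_subset[OF that I] by (intro card_UN_disjoint) auto
      moreover have "(\<Union>i\<in>I'. {x\<in>Q. fst x = i}) = {x\<in>Q. fst x \<in> I'}" by auto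
      ultimately show ?thesis by simp
    qed
    have "{x\<in>Q. fst x \<in> I} = Q" using Q' by (auto simp: V_def)
    hence "sum a I = q" using sa[of I] Q' by simp
    then obtain I0 where I0: "I0 \<subseteq> I" "indep J I0" "p \<le> sum a I0" using small by blast
    hence "p \<le> card {x\<in>Q. fst x \<in> I0}" using sa by simp
    then obtain P where P: "P \<subseteq> {x\<in>Q. fst x \<in> I0}" "card P = p" "finite P"
      by (rule obtain_subset_with_card_n)
    have "nsets P r \<subseteq> E"
    proof
      fix e assume e: "e \<in> nsets P r"
      hence "fst ` e \<subseteq> I0" "e \<in> nsets V r" using P Q' by (auto simp: nsets_def)
      thus "e \<in> E" using I0(2) by (auto simp: E_def G_def indep_def)
    qed
    thus "\<exists>P\<in>nsets Q p. nsets P r \<subseteq> E" using P by (intro bexI[of _ P]) (auto simp: nsets_def)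
  qed
  hence "turan_num r (card V) q p \<le> card E" using V by (intro turan_num_le_card) (auto simp: E_def)
  moreover have "card E = card (nsets V r) - card G"
    unfolding E_def using fin by (intro card_Diff_subset) (auto simp: G_def)
  moreover have "card G \<le> card (nsets V r)" using fin by (intro card_mono) (auto simp: G_def)
  ultimately show ?thesis using cG V by (simp add: card_nsets)
qed

text \<open>Take \<open>a\<close> disjoint cliques: more than \<open>a * (p - 1)\<close> vertices
  put \<open>p\<close> into one of them. The hypothesis expresses this without subtraction.\<close>

lemma turan_num_cliques:
  assumes q: "a * p < q + a" and p: "p \<ge> 1"
  shows "turan_num r (a * k) q p \<le> a * (k choose r)"
proof -
  define V where "V = {..<a} \<times> {..<k}"
  define E where "E = (\<Union>i<a. nsets ({i} \<times> {..<k}) r)"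
  have V: "finite V" "card V = a * k" by (auto simp: V_def)
  have "qp_property r V E q p"
    unfolding qp_property_def hyperclique_def
  proof
    fix Q assume Q: "Q \<in> nsets V q"
    hence Q': "Q \<subseteq> V" "finite Q" "card Q = q" by (auto simp: nsets_def)
    have "\<exists>i<a. p \<le> card {x\<in>Q. fst x = i}"
    proof (rule ccontr)
      assume "\<not> ?thesis"
      hence lt: "card {x\<in>Q. fst x = i} \<le> p - 1" if "i < a" for i using that by fastforce
      have "Q = (\<Union>i\<in>{..<a}. {x\<in>Q. fst x = i})" using Q' by (auto simp: V_def)
      hence "card Q \<le> (\<Sum>i<a. card {x\<in>Q. fst x = i})" using card_UN_le[of "{..<a}" "\<lambda>i. {x\<in>Q. fst x = i}"] by simp
      also have "\<dots> \<le> (\<Sum>i<a. p - 1)" using lt by (intro sum_mono) auto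
      finally have "q \<le> a * (p - 1)" using Q' by simp
      moreover obtain p' where "p = Suc p'" using p by (cases p) auto
      ultimately show False using q by simp
    qed
    then obtain i where i: "i < a" "p \<le> card {x\<in>Q. fst x = i}" by blast
    obtain P where P: "P \<subseteq> {x\<in>Q. fst x = i}" "card P = p" "finite P"
      using obtain_subset_with_card_n[OF i(2)] .
    have "nsets P r \<subseteq> E"
    proof
      fix e assume e: "e \<in> nsets P r"
      hence "e \<subseteq> {i} \<times> {..<k}" using P Q' by (force simp: nsets_def V_def)
      thus "e \<in> E" using e i by (auto simp: E_def nsets_def)
    qed
    thus "\<exists>P\<in>nsets Q p. nsets P r \<subseteq> E" using P by (intro bexI[of _ P]) (auto simp: nsets_def)
  qed
  moreover have "E \<subseteq> nsets V r" by (auto simp: E_def V_def nsets_def)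
  ultimately have "turan_num r (card V) q p \<le> card E" using V by (intro turan_num_le_card)
  also have "\<dots> \<le> (\<Sum>i<a. card (nsets ({i} \<times> {..<k}) r))" unfolding E_def by (intro card_UN_le) auto
  also have "\<dots> = a * (k choose r)" by (simp add: card_nsets card_cartesian_product)
  finally show ?thesis using V by simp
qed

lemma fact_binomial_prod: "k \<le> n \<Longrightarrow> fact k * real (n choose k) = (\<Prod>i<k. real n - real i)"
  by (simp add: binomial_gbinomial gbinomial_prod_rev lessThan_atLeast0)

lemma turan_dens_cliques:
  assumes q: "a * p < q + a" and p: "p \<ge> 1" "p \<le> q" and a: "a \<ge> 1" and r: "r \<ge> 1"
  shows "turan_dens r q p \<le> 1 / real a ^ (r - 1)"
proof (rule turan_dens_le[OF p(2)])
  fix n0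
  define k where "k = n0 + r"
  have kr: "r \<le> k" "r \<le> a * k" "n0 \<le> a * k"
  proof -
    have "k \<le> a * k" using mult_le_mono1[of 1 a k] a by simp
    thus "r \<le> k" "r \<le> a * k" "n0 \<le> a * k" unfolding k_def by linarith+
  qed
  \<comment> \<open>The factors compare one by one, \<open>a * (k - i)\<close> against
    \<open>a * k - i\<close>, so the bound holds for each \<open>k\<close> and not only in the
    limit.\<close>
  have "real a ^ r * (fact r * real (k choose r)) = (\<Prod>i<r. real a * (real k - real i))"
    using fact_binomial_prod[OF kr(1)] by (simp add: prod.distrib)
  also have "\<dots> \<le> (\<Prod>i<r. real (a * k) - real i)"
  proof (intro prod_mono conjI)
    fix i assume "i \<in> {..<r}"
    hence "real i \<le> real k" using kr by simp
    thus "0 \<le> real a * (real k - real i)" by simp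
    have "real i \<le> real a * real i" using a by (simp add: mult_le_cancel_right1)
    thus "real a * (real k - real i) \<le> real (a * k) - real i" by (simp add: algebra_simps)
  qed
  also have "\<dots> = fact r * real (a * k choose r)" using fact_binomial_prod[OF kr(2)] by simp
  finally have "real a ^ r * real (k choose r) \<le> real (a * k choose r)" by simp
  moreover have "real a ^ r = real a ^ (r - 1) * real a" using r by (cases r) auto
  ultimately have "real (a * (k choose r)) \<le> 1 / real a ^ (r - 1) * real (a * k choose r)"
    using a by (simp add: field_simps)
  moreover have "real (turan_num r (a * k) q p) \<le> real (a * (k choose r))"
    using turan_num_cliques[OF q p(1)] of_nat_le_iff by blast
  ultimately show "\<exists>n\<ge>n0. real (turan_num r n q p) \<le> 1 / real a ^ (r - 1) * real (n choose r)"
    using kr(3) by (intro exI[of _ "a * k"]) auto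
qed

text \<open>Part sizes \<open>s i * k\<close> keep the proportions fixed. Since
  \<open>fact r * (n choose r)\<close> is at most \<open>n ^ r\<close>, the density of transversals
  is at least its limiting value for every \<open>k\<close>.\<close>

lemma turan_dens_pattern:
  assumes J: "J \<subseteq> nsets I r" and I: "finite (I :: 'i set)" and s: "sum s I \<ge> 1" and pq: "p \<le> q"
    and small: "\<And>a. sum a I = q \<Longrightarrow> \<exists>I0\<subseteq>I. indep J I0 \<and> p \<le> sum a I0"
  shows "turan_dens r q p \<le> 1 - fact r * (\<Sum>j\<in>J. \<Prod>i\<in>j. real (s i)) / real (sum s I) ^ r"
proof (rule turan_dens_le[OF pq])
  fix n0
  define k where "k = Suc n0"
  define n where "n = sum s I * k"
  have "k \<le> n" using mult_le_mono1[OF s, of k] by (simp add: n_def)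
  hence n: "n \<ge> n0" by (simp add: k_def)
  have "turan_num r (\<Sum>i\<in>I. s i * k) q p + (\<Sum>j\<in>J. \<Prod>i\<in>j. s i * k) \<le> (\<Sum>i\<in>I. s i * k) choose r"
    by (rule turan_num_pattern[OF J I small])
  moreover have "(\<Sum>i\<in>I. s i * k) = n" by (simp add: n_def sum_distrib_right)
  moreover have "(\<Sum>j\<in>J. \<Prod>i\<in>j. s i * k) = (\<Sum>j\<in>J. \<Prod>i\<in>j. s i) * k ^ r"
    unfolding sum_distrib_right using J by (intro sum.cong) (auto simp: prod.distrib nsets_def)
  ultimately have le: "turan_num r n q p + (\<Sum>j\<in>J. \<Prod>i\<in>j. s i) * k ^ r \<le> n choose r" by simp
  have "(n choose r) * fact r \<le> n ^ r" by (rule binomial_fact_pow)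
  hence "real (n choose r) * fact r \<le> real n ^ r"
    by (metis of_nat_fact of_nat_le_iff of_nat_mult of_nat_power)
  also have "\<dots> = real (sum s I) ^ r * real k ^ r" by (simp add: n_def power_mult_distrib)
  finally have b: "fact r * real (n choose r) / real (sum s I) ^ r \<le> real k ^ r"
    using s by (subst pos_divide_le_eq) (auto simp: mult.commute simp del: of_nat_sum)
  define A where "A = real (\<Sum>j\<in>J. \<Prod>i\<in>j. s i)"
  have "A * (fact r * real (n choose r) / real (sum s I) ^ r) \<le> A * real k ^ r"
    using b by (intro mult_left_mono) (auto simp: A_def intro!: sum_nonneg prod_nonneg)
  moreover have "real (turan_num r n q p) + A * real k ^ r \<le> real (n choose r)"
    using le unfolding A_def by (metis of_nat_add of_nat_le_iff of_nat_mult of_nat_power)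
  ultimately have "real (turan_num r n q p) \<le> (1 - fact r * A / real (sum s I) ^ r) * real (n choose r)"
    by (simp add: algebra_simps)
  moreover have "A = (\<Sum>j\<in>J. \<Prod>i\<in>j. real (s i))" by (simp add: A_def)
  ultimately show "\<exists>n\<ge>n0. real (turan_num r n q p)
      \<le> (1 - fact r * (\<Sum>j\<in>J. \<Prod>i\<in>j. real (s i)) / real (sum s I) ^ r) * real (n choose r)"
    using n by blast
qed

text \<open>The pattern is one edge, with \<open>r\<close> equal parts. Leaving out the part that
  \<open>Q\<close> meets least keeps at least \<open>(r - 1) * q / r\<close> vertices; the
  hypothesis says that this, rounded up, is at least \<open>p\<close>.\<close>

lemma turan_dens_partite:
  assumes r: "r \<ge> 1" and pq: "p \<le> q" and q: "r * p < (r - 1) * q + r"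
  shows "turan_dens r q p \<le> 1 - fact r / real r ^ r"
proof -
  have "turan_dens r q p \<le> 1 - fact r * (\<Sum>j\<in>{{..<r}}. \<Prod>i\<in>j. real 1) / real (\<Sum>i<r. 1) ^ r"
  proof (rule turan_dens_pattern[OF _ _ _ pq])
    fix a assume a: "sum a {..<r} = q"
    have "\<exists>i<r. r * a i \<le> q"
    proof (rule ccontr)
      assume "\<not> ?thesis"
      hence "(\<Sum>i<r. q) < (\<Sum>i<r. r * a i)" using r by (intro sum_strict_mono) (auto simp: not_le lessThan_empty_iff)
      thus False using a by (simp flip: sum_distrib_left)
    qed
    then obtain i where i: "i < r" "r * a i \<le> q" by blast
    have "sum a {..<r} = a i + sum a ({..<r} - {i})" using i by (intro sum.remove) auto
    hence "r * q = r * a i + r * sum a ({..<r} - {i})" using a by (simp add: distrib_left)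
    hence "r * q \<le> q + r * sum a ({..<r} - {i})" using i by linarith
    moreover have "r * q = (r - 1) * q + q" using r by (cases r) auto
    ultimately have "(r - 1) * q \<le> r * sum a ({..<r} - {i})" by linarith
    hence "r * p < r * (sum a ({..<r} - {i}) + 1)" using q by simp
    hence "p < sum a ({..<r} - {i}) + 1" by (simp only: mult_less_cancel1)
    hence "p \<le> sum a ({..<r} - {i})" by simp
    thus "\<exists>I0\<subseteq>{..<r}. indep {{..<r}} I0 \<and> p \<le> sum a I0"
      using i by (intro exI[of _ "{..<r} - {i}"]) (auto simp: indep_def)
  qed (use r in \<open>auto simp: nsets_def\<close>)
  thus ?thesis by simp
qed

text \<open>The pattern is K4^- with apex 0. Parts in ratio 3:2:2:2 realize the weights 1/3, 2/9,
  2/9, 2/9 that maximize its Lagrange polynomial.\<close>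

lemma turan_dens_K4_minus:
  assumes pq: "p \<le> q" and q: "5 * p < 3 * q + 5"
  shows "turan_dens 3 q p \<le> 19 / 27"
proof -
  define J where "J = {{0,1,2},{0,1,3},{0,2,3::nat}}"
  define s where "s = (\<lambda>i::nat. if i = 0 then 3 else 2 :: nat)"
  have I: "{..<4} = {0,1,2,3::nat}" by auto
  have "turan_dens 3 q p \<le> 1 - fact 3 * (\<Sum>j\<in>J. \<Prod>i\<in>j. real (s i)) / real (sum s {..<4}) ^ 3"
  proof (rule turan_dens_pattern[OF _ _ _ pq])
    fix a assume "sum a {..<4::nat} = q"
    hence a: "a 0 + a 1 + a 2 + a 3 = q" by (simp add: eval_nat_numeral)
    \<comment> \<open>The base taken twice and the three pairs taken once cover every part three
      times, so these five sets have total \<open>3 * q\<close> and one of them reaches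
      \<open>3 * q / 5\<close>.\<close>
    have "p \<le> a 1 + a 2 + a 3 \<or> p \<le> a 0 + a 1 \<or> p \<le> a 0 + a 2 \<or> p \<le> a 0 + a 3"
      using a q by linarith
    moreover have "indep J {1,2,3}" "indep J {0,1}" "indep J {0,2}" "indep J {0,3}" by (auto simp: indep_def J_def)
    moreover have "sum a {1,2,3} = a 1 + a 2 + a 3" "sum a {0,1} = a 0 + a 1" "sum a {0,2} = a 0 + a 2"
      "sum a {0,3} = a 0 + a 3" by auto
    ultimately show "\<exists>I0\<subseteq>{..<4}. indep J I0 \<and> p \<le> sum a I0"
      unfolding I by (metis empty_subsetI insert_subset insertCI)
  qed (auto simp: J_def s_def nsets_def eval_nat_numeral)
  moreover have "(\<Sum>j\<in>J. \<Prod>i\<in>j. real (s i)) = 36"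
    unfolding J_def by (subst sum.insert; auto simp: s_def doubleton_eq_iff insert_eq_iff)+
  moreover have "sum s {..<4} = 9" unfolding I by (simp add: s_def)
  ultimately show ?thesis by (simp add: fact_numeral)
qed

section \<open>Sparse hypergraphs\<close>

lemma sum_of_bool_mem: "finite A \<Longrightarrow> (\<Sum>u\<in>A. of_bool (u \<in> B)) = (of_nat (card (A \<inter> B)) :: 'b::semiring_1)"
  by (simp add: of_bool_def sum.If_cases)

lemma opt_weightsD:
  assumes "opt_weights r S E x"
  shows "finite S" "E \<subseteq> nsets S r" "\<And>i. i \<in> S \<Longrightarrow> 0 < x i" "sum x S = 1"
    "\<And>v. v \<in> S \<Longrightarrow> dlag E v x = real r * lag E x"
    "\<And>u v. u \<in> S \<Longrightarrow> v \<in> S \<Longrightarrow> u \<noteq> v \<Longrightarrow> \<exists>e\<in>E. u \<in> e \<and> v \<in> e"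
  using assms by (auto simp: opt_weights_def)

text \<open>The only possible edge is \<open>S\<close> itself, and its monomial is bounded by the
  inequality of arithmetic and geometric means.\<close>

lemma lag_small_support:
  assumes opt: "opt_weights r S E x" and r: "r \<ge> 1" and S: "card S \<le> r"
  shows "lag E x \<le> 1 / real r ^ r"
proof (cases "card S = r")
  case True
  note o = opt_weightsD[OF opt]
  have "E \<subseteq> {S}"
  proof
    fix e assume "e \<in> E"
    hence "e \<subseteq> S" "card e = r" using edgeD[OF o(2)] by auto
    thus "e \<in> {S}" using card_subset_eq[OF o(1)] True by auto
  qed
  moreover have "prod x S > 0" using o(3) by (intro prod_pos) auto
  ultimately have "lag E x \<le> prod x S" by (cases "E = {}") (auto simp: lag_def subset_singleton_iff)
  also have "\<dots> \<le> (1 / real r) ^ r"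
  proof -
    have ne: "S \<noteq> {}" using True r by auto
    have pos: "prod x S > 0" using o(3) by (intro prod_pos) auto
    have "prod x S powr (1 / real (card S)) \<le> (\<Sum>i\<in>S. x i / real (card S))"
      using o(1,3) ne by (intro arith_geom_mean) (auto simp: less_imp_le)
    also have "\<dots> = 1 / real r" using o(4) True by (simp flip: sum_divide_distrib)
    finally have "(prod x S powr (1 / real r)) powr real r \<le> (1 / real r) powr real r"
      using True by (intro powr_mono2) auto
    thus ?thesis using pos r by (simp add: powr_powr powr_realpow)
  qed
  finally show ?thesis by (simp add: power_divide)
next
  case False
  note o = opt_weightsD[OF opt]
  have "E = {}"
  proof (rule ccontr)
    assume "E \<noteq> {}"
    then obtain e where "e \<in> E" by blast
    hence e: "e \<subseteq> S" "card e = r" using edgeD[OF o(2)] by auto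
    thus False using card_mono[OF o(1) e(1)] False S by simp
  qed
  thus ?thesis by (simp add: lag_def)
qed

lemma opt_edge_ex:
  assumes opt: "opt_weights r S E x" and S: "card S > r" "r \<ge> 1"
  obtains e where "e \<in> E"
proof -
  note o = opt_weightsD[OF opt]
  have "card S \<ge> Suc 1" using S by simp
  then obtain u v where "u \<in> S" "v \<in> S" "u \<noteq> v" by (auto simp: card_le_Suc_iff)
  thus ?thesis using o(6) that by blast
qed

text \<open>The weights put \<open>p + 1 - (r - 1)\<^sup>2\<close> on an edge, \<open>(r - 1)\<^sup>2\<close> on a vertex outside it and \<open>r - 1\<close> on
  every remaining vertex of the edges joining the two; here \<open>r = s + 2\<close> and \<open>p + 1 = a + (s + 1)\<^sup>2\<close>.\<close>

lemma lag_le_partite: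
  assumes opt: "opt_weights r S E x" and r: "r = s + 2" and p: "p + 1 = a + (s + 1) ^ 2" "a \<ge> s + 1"
    and ex: "\<And>w. r * p + 1 \<le> sum w S \<Longrightarrow> \<exists>I\<subseteq>S. indep E I \<and> (r - 1) * p + 1 \<le> sum w I"
  shows "lag E x \<le> 1 / real r ^ r"
proof (cases "card S \<le> r")
  case True
  thus ?thesis using lag_small_support[OF opt] r by simp
next
  case False
  note o = opt_weightsD[OF opt]
  obtain e where e: "e \<in> E" by (rule opt_edge_ex[OF opt]) (use False r in auto)
  hence e': "e \<subseteq> S" "finite e" "card e = r" using edgeD[OF o(2)] by auto
  obtain v where v: "v \<in> S" "v \<notin> e"
    using False e' by (metis card_mono e'(2) nle_le subsetI)
  have "\<forall>i\<in>e. \<exists>f. f \<in> E \<and> v \<in> f \<and> i \<in> f"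
    using o(6) v e' by (metis subsetD)
  then obtain f where f: "\<And>i. i \<in> e \<Longrightarrow> f i \<in> E \<and> v \<in> f i \<and> i \<in> f i" by metis
  define h where "h = (\<lambda>i. f i - {v, i})"
  have h: "h i \<subseteq> S" "finite (h i)" "card (h i) = s" if "i \<in> e" for i
  proof -
    have fi: "f i \<subseteq> S" "finite (f i)" "card (f i) = r" using edgeD[OF o(2)] f[OF that] by auto
    thus "h i \<subseteq> S" "finite (h i)" by (auto simp: h_def)
    have "i \<noteq> v" using v that by auto
    thus "card (h i) = s" using f[OF that] fi r by (simp add: h_def card_Diff_subset)
  qed
  \<comment> \<open>Indicators are added, so overlaps of the sets \<open>h i\<close> with each other
    and with \<open>e\<close> do not change the total.\<close>
  define w where "w = (\<lambda>u. a * of_bool (u \<in> e) + (s+1)^2 * of_bool (u \<in> {v}) + (\<Sum>i\<in>e. (s+1) * of_bool (u \<in> h i)))"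
  have sw: "sum w A = a * card (A \<inter> e) + (s+1)^2 * card (A \<inter> {v}) + (s+1) * (\<Sum>i\<in>e. card (A \<inter> h i))"
    if A: "finite A" for A
  proof -
    have "sum w A = a * (\<Sum>u\<in>A. of_bool (u \<in> e)) + (s+1)^2 * (\<Sum>u\<in>A. of_bool (u \<in> {v}))
        + (\<Sum>u\<in>A. \<Sum>i\<in>e. (s+1) * of_bool (u \<in> h i))"
      unfolding w_def by (simp only: sum.distrib sum_distrib_left)
    also have "(\<Sum>u\<in>A. \<Sum>i\<in>e. (s+1) * of_bool (u \<in> h i)) = (\<Sum>i\<in>e. \<Sum>u\<in>A. (s+1) * of_bool (u \<in> h i))"
      by (rule sum.swap)
    also have "\<dots> = (s+1) * (\<Sum>i\<in>e. card (A \<inter> h i))"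
      by (simp only: sum_distrib_left[symmetric] sum_of_bool_mem[OF A] of_nat_id)
    finally show ?thesis by (simp only: sum_of_bool_mem[OF A] of_nat_id)
  qed
  have "(\<Sum>i\<in>e. card (S \<inter> h i)) = (\<Sum>i\<in>e. s)"
    using h by (intro sum.cong refl) (simp add: Int_absorb1)
  hence "sum w S = a * (s + 2) + (s+1)^2 + (s+1) * ((s + 2) * s)"
    using sw[OF o(1)] e' v r by (simp add: Int_absorb1)
  moreover have "\<dots> = (s + 2) * (a + (s+1)^2) - (s + 2) + 1" by (simp add: algebra_simps power2_eq_square)
  moreover have "(s + 2) * (a + (s+1)^2) = (s + 2) * p + (s + 2)" using p(1)[symmetric] by (simp add: algebra_simps)
  ultimately have "sum w S = r * p + 1" using r by simp
  then obtain I where I: "I \<subseteq> S" "indep E I" "(r - 1) * p + 1 \<le> sum w I" using ex[of w] by auto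
  have fI: "finite I" using I(1) o(1) finite_subset by blast
  define k where "k = card (I \<inter> e)"
  have "I \<inter> e \<noteq> e" using I(2) e by (auto simp: indep_def)
  hence "card (I \<inter> e) < card e" using e' by (intro psubset_card_mono) auto
  hence k: "k \<le> s + 1" using e' r by (simp add: k_def)
  have hle: "card (I \<inter> h i) \<le> s" if "i \<in> e" for i
    using card_mono[of "h i" "I \<inter> h i"] h[OF that] by simp
  have "sum w I \<le> (s + 1) * p"
  proof (cases "v \<in> I")
    case False
    have "(\<Sum>i\<in>e. card (I \<inter> h i)) \<le> (\<Sum>i\<in>e. s)" using hle by (intro sum_mono)
    hence H: "(s+1) * (\<Sum>i\<in>e. card (I \<inter> h i)) \<le> (s+1) * ((s+2) * s)" using e' r by (intro mult_le_mono2) simp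
    have "sum w I = a * k + (s+1) * (\<Sum>i\<in>e. card (I \<inter> h i))" using False by (simp add: sw[OF fI] k_def)
    also have "\<dots> \<le> a * (s + 1) + (s+1) * ((s+2) * s)" by (rule add_mono[OF mult_le_mono2[OF k] H])
    also have "\<dots> + (s + 1) = (s + 1) * (p + 1)" unfolding p(1) by (simp add: algebra_simps power2_eq_square)
    finally show ?thesis by simp
  next
    case True
    \<comment> \<open>With \<open>v\<close> in \<open>I\<close>, each \<open>i\<close> of
      \<open>e\<close> in \<open>I\<close> forces \<open>I\<close> to miss a vertex of
      \<open>h i\<close>, a loss of \<open>s + 1\<close>. So \<open>i\<close> brings a net
      \<open>a - (s + 1)\<close>, which is nonnegative by the assumption on \<open>a\<close>; this
      is where the lower bound on \<open>p\<close> enters.\<close>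
    have "card (I \<inter> h i) + card (I \<inter> {i}) \<le> s" if "i \<in> e" for i
    proof (cases "i \<in> I")
      case iI: True
      have "I \<inter> h i \<noteq> h i"
      proof
        assume "I \<inter> h i = h i"
        hence "f i \<subseteq> I" using iI True by (auto simp: h_def)
        thus False using I(2) f[OF that] by (auto simp: indep_def)
      qed
      hence "card (I \<inter> h i) < card (h i)" using h[OF that] by (intro psubset_card_mono) auto
      thus ?thesis using h[OF that] iI by simp
    qed (use hle[OF that] in auto)
    hence "(\<Sum>i\<in>e. card (I \<inter> h i) + card (I \<inter> {i})) \<le> (\<Sum>i\<in>e. s)" by (intro sum_mono)
    moreover have "(\<Sum>i\<in>e. card (I \<inter> {i})) = k"
    proof -
      have "(\<Sum>i\<in>e. card (I \<inter> {i})) = (\<Sum>i\<in>e. of_bool (i \<in> I))" by (intro sum.cong) auto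
      thus ?thesis using sum_of_bool_mem[OF e'(2), of I, where 'b = nat] by (simp add: k_def Int_commute)
    qed
    ultimately have "(\<Sum>i\<in>e. card (I \<inter> h i)) + k \<le> (s + 2) * s" using e' r by (simp add: sum.distrib)
    hence H: "(s+1) * (\<Sum>i\<in>e. card (I \<inter> h i)) + (s+1) * k \<le> (s+1) * ((s+2) * s)"
      by (metis distrib_left mult_le_mono2)
    obtain a' where a': "a = (s + 1) + a'" using p(2) le_Suc_ex by blast
    have "sum w I = a * k + (s+1)^2 + (s+1) * (\<Sum>i\<in>e. card (I \<inter> h i))"
      using True by (simp add: sw[OF fI] k_def)
    also have "\<dots> = a' * k + (s+1)^2 + ((s+1) * (\<Sum>i\<in>e. card (I \<inter> h i)) + (s+1) * k)" by (simp add: a' algebra_simps)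
    also have "\<dots> \<le> a' * (s + 1) + (s+1)^2 + (s+1) * ((s+2) * s)"
      by (rule add_mono[OF add_mono[OF mult_le_mono2[OF k] order_refl] H])
    also have "\<dots> + (s + 1) = (s + 1) * (p + 1)" unfolding p(1) a' by (simp add: algebra_simps power2_eq_square)
    finally show ?thesis by simp
  qed
  thus ?thesis using I(3) r by simp
qed

text \<open>Unit weights on \<open>A \<inter> B\<close>, on the two remaining vertices
  \<open>a\<close>, \<open>b\<close>, and on the rest of an edge through both have total
  \<open>2 * r - 1\<close>, and an independent set misses at least two units. The thresholds are 3/5
  for \<open>r = 3\<close> and 5/7 for \<open>r = 4\<close>.\<close>

lemma rich_sparse:
  assumes opt: "opt_weights r S E x" and r: "r \<ge> 2" and rich: "rich \<theta> K S E"
    and K: "2 * r - 1 \<le> K" and \<theta>: "real (2 * r - 3) \<le> \<theta> * real (2 * r - 1)"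
    and A: "A \<in> E" and B: "B \<in> E" and AB: "A \<noteq> B"
  shows "card (A \<inter> B) \<noteq> r - 1"
proof
  assume c: "card (A \<inter> B) = r - 1"
  note o = opt_weightsD[OF opt]
  have A': "A \<subseteq> S" "finite A" "card A = r" and B': "B \<subseteq> S" "finite B" "card B = r"
    using edgeD[OF o(2)] A B by auto
  have "card (A - B) = 1" "card (B - A) = 1"
    using c A' B' r by (auto simp: card_Diff_subset_Int Int_commute)
  then obtain a b where ab: "A - B = {a}" "B - A = {b}" by (auto simp: card_1_singleton_iff)
  define R where "R = A \<inter> B"
  have AR: "A = insert a R" "B = insert b R" "a \<notin> R" "b \<notin> R" "a \<noteq> b" "finite R" "R \<subseteq> S"
    "a \<in> S" "b \<in> S" using ab A' B' by (auto simp: R_def)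
  obtain C where C: "C \<in> E" "a \<in> C" "b \<in> C" using o(6) AR by blast
  have C': "C \<subseteq> S" "finite C" "card C = r" using edgeD[OF o(2)] C by auto
  define D where "D = C - {a, b}"
  have D: "finite D" "D \<subseteq> S" "card D = r - 2" using C C' AR(5) by (auto simp: D_def card_Diff_subset)
  define w :: "'a \<Rightarrow> nat" where "w = (\<lambda>u. of_bool (u \<in> R) + of_bool (u \<in> {a}) + of_bool (u \<in> {b}) + of_bool (u \<in> D))"
  have sw: "sum w X = card (X \<inter> R) + card (X \<inter> {a}) + card (X \<inter> {b}) + card (X \<inter> D)" if "finite X" for X
    unfolding w_def by (simp only: sum.distrib sum_of_bool_mem[OF that] of_nat_id)
  have total: "sum w S = 2 * r - 1"
    using sw[OF o(1)] AR D c r by (simp add: Int_absorb1 R_def[symmetric])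
  obtain I where I: "I \<subseteq> S" "indep E I" "\<theta> * real (sum w S) < real (sum w I)"
    using rich[unfolded rich_def, rule_format, of w] total K r by auto
  have fI: "finite I" using I(1) o(1) finite_subset by blast
  have no: "\<not> A \<subseteq> I" "\<not> B \<subseteq> I" "\<not> C \<subseteq> I" using I(2) A B C by (auto simp: indep_def)
  have le: "card (I \<inter> R) \<le> r - 1" "card (I \<inter> D) \<le> r - 2"
    using card_mono[of R "I \<inter> R"] card_mono[of D "I \<inter> D"] AR(6) D c by (auto simp: R_def)
  have ltR: "card (I \<inter> R) \<le> r - 2" if "\<not> R \<subseteq> I"
  proof -
    have "I \<inter> R \<subset> R" using that by blast
    hence "card (I \<inter> R) < card R" using AR(6) by (intro psubset_card_mono)
    thus ?thesis using c by (simp add: R_def)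
  qed
  have ltD: "card (I \<inter> D) + 1 \<le> r - 2" if "\<not> D \<subseteq> I"
  proof -
    have "I \<inter> D \<subset> D" using that by blast
    hence "card (I \<inter> D) < card D" using D(1) by (intro psubset_card_mono)
    thus ?thesis using D(3) by simp
  qed
  \<comment> \<open>If \<open>R\<close> lies in \<open>I\<close>, both \<open>a\<close> and
    \<open>b\<close> are missing. Otherwise \<open>R\<close> loses one unit, and the edge
    \<open>C\<close> loses another in \<open>a\<close>, \<open>b\<close> or
    \<open>D\<close>.\<close>
  have "sum w I \<le> 2 * r - 3"
  proof (cases "R \<subseteq> I")
    case True
    hence "a \<notin> I" "b \<notin> I" using no AR by auto
    thus ?thesis using sw[OF fI] le r by auto
  next
    case False
    show ?thesis
    proof (cases "a \<in> I \<and> b \<in> I")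
      case True
      hence "\<not> D \<subseteq> I" using no(3) by (auto simp: D_def)
      thus ?thesis using sw[OF fI] ltR[OF False] ltD True r by auto
    next
      case F: False
      hence "card (I \<inter> {a}) + card (I \<inter> {b}) \<le> 1" by (cases "a \<in> I"; cases "b \<in> I") auto
      thus ?thesis using sw[OF fI] ltR[OF False] le r by linarith
    qed
  qed
  hence "real (sum w I) \<le> real (2 * r - 3)" by (simp only: of_nat_le_iff)
  thus False using I(3) \<theta> unfolding total by linarith
qed

section \<open>Elementary symmetric sums and the Lagrangian of sparse hypergraphs\<close>

lemma dlag_complete:
  assumes "v \<in> A" "k \<ge> 1"
  shows "dlag (nsets A k) v x = lag (nsets (A - {v}) (k - 1)) x"
proof -
  obtain j where "k = Suc j" using assms(2) by (cases k) auto
  hence "bij_betw (\<lambda>e. e - {v}) {e\<in>nsets A k. v \<in> e} (nsets (A - {v}) (k - 1))"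
    by (intro bij_betwI[where g = "insert v"]) (use assms(1) in \<open>auto simp: nsets_def card_insert_if subset_iff\<close>)
  thus ?thesis unfolding dlag_def lag_def by (rule sum.reindex_bij_betw)
qed

lemma lag_pairs:
  assumes "finite A" shows "2 * lag (nsets A 2) x = (sum x A)\<^sup>2 - (\<Sum>i\<in>A. (x i)\<^sup>2)"
proof -
  have one: "lag (nsets B 1) x = sum x B" if "finite B" for B
  proof -
    have "bij_betw (\<lambda>i. {i}) B (nsets B 1)"
      by (auto simp: bij_betw_def nsets_def inj_on_def card_1_singleton_iff)
    hence "lag (nsets B 1) x = (\<Sum>i\<in>B. prod x {i})"
      unfolding lag_def by (rule sum.reindex_bij_betw[symmetric])
    thus ?thesis by simp
  qed
  have "2 * lag (nsets A 2) x = (\<Sum>v\<in>A. x v * dlag (nsets A 2) v x)"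
    using sum_dlag[OF assms, of "nsets A 2" 2 x] by simp
  also have "\<dots> = (\<Sum>v\<in>A. x v * (sum x A - x v))"
    using assms one by (intro sum.cong refl) (simp add: dlag_complete sum_diff1)
  also have "\<dots> = (sum x A)\<^sup>2 - (\<Sum>i\<in>A. (x i)\<^sup>2)"
    by (simp add: right_diff_distrib sum_subtractf sum_distrib_right power2_eq_square)
  finally show ?thesis .
qed

lemma lag_pairs_le:
  assumes "finite A" shows "2 * real (card A) * lag (nsets A 2) x \<le> (real (card A) - 1) * (sum x A)\<^sup>2"
proof -
  have "(sum x A)\<^sup>2 \<le> real (card A) * (\<Sum>i\<in>A. (x i)\<^sup>2)"
    using sum_squared_le_sum_of_squares[of x A] by (simp add: mult.commute)
  moreover have "2 * real (card A) * lag (nsets A 2) x = real (card A) * (2 * lag (nsets A 2) x)" by simp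
  ultimately show ?thesis unfolding lag_pairs[OF assms] by (simp add: algebra_simps)
qed

text \<open>Maclaurin's inequality for the third symmetric function. Euler's identity turns it into
  a sum over \<open>v\<close> of pair sums on \<open>A - {v}\<close>; the bound for pairs leaves
  values of \<open>t * (1 - t)\<^sup>2\<close>, which a tangent line dominates.\<close>

lemma lag_triples_le:
  assumes A: "finite A" and n: "card A \<ge> 2" and x: "\<And>i. i \<in> A \<Longrightarrow> 0 \<le> x i" "sum x A = 1"
  shows "6 * real (card A) ^ 2 * lag (nsets A 3) x \<le> (real (card A) - 1) * (real (card A) - 2)"
proof -
  define n where "n = real (card A)"
  have n2: "n \<ge> 2" using n by (simp add: n_def)
  have x1: "x i \<le> 1" if "i \<in> A" for i using member_le_sum[of i A x] that x A by auto
  have three: "3 * lag (nsets A 3) x = (\<Sum>v\<in>A. x v * lag (nsets (A - {v}) 2) x)"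
    using sum_dlag[OF A, of "nsets A 3" 3 x] by (simp add: dlag_complete)
  have "6 * (n - 1) * lag (nsets A 3) x = 2 * (n - 1) * (3 * lag (nsets A 3) x)" by (simp add: algebra_simps)
  also have "\<dots> = (\<Sum>v\<in>A. x v * (2 * (n - 1) * lag (nsets (A - {v}) 2) x))"
    unfolding three sum_distrib_left by (intro sum.cong refl) simp
  also have "\<dots> \<le> (\<Sum>v\<in>A. x v * ((n - 2) * (1 - x v)\<^sup>2))"
  proof (intro sum_mono mult_left_mono x)
    fix v assume v: "v \<in> A"
    have "real (card (A - {v})) = n - 1" using v A n by (simp add: n_def of_nat_diff)
    moreover have "sum x (A - {v}) = 1 - x v" using v A x by (simp add: sum_diff1)
    ultimately show "2 * (n - 1) * lag (nsets (A - {v}) 2) x \<le> (n - 2) * (1 - x v)\<^sup>2"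
      using lag_pairs_le[of "A - {v}" x] A by simp
  qed
  also have "\<dots> = (n - 2) * (\<Sum>v\<in>A. x v * (1 - x v)\<^sup>2)" by (simp add: sum_distrib_left mult.left_commute)
  \<comment> \<open>The tangent of \<open>t * (1 - t)\<^sup>2\<close> at \<open>1/n\<close>; its
    linear part sums to zero because the weights sum to 1. The error has the factor
    \<open>x v - 2 + 2 / n\<close>, which is nonpositive for \<open>n \<ge> 2\<close>.\<close>
  also have "(\<Sum>v\<in>A. x v * (1 - x v)\<^sup>2) \<le> (\<Sum>v\<in>A. 1/n * (1 - 1/n)\<^sup>2 + (1 - 4/n + 3/n\<^sup>2) * (x v - 1/n))"
  proof (intro sum_mono)
    fix v assume v: "v \<in> A"
    define t where "t = 1 / n"
    have t: "t \<le> 1/2" using n2 by (simp add: t_def field_simps)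
    have "x v * (1 - x v)\<^sup>2 - (t * (1 - t)\<^sup>2 + (1 - 4 * t + 3 * t\<^sup>2) * (x v - t)) = (x v - t)\<^sup>2 * (x v - 2 + 2 * t)"
      by (simp add: power2_eq_square algebra_simps)
    also have "\<dots> \<le> 0" using x1[OF v] t by (intro mult_nonneg_nonpos) auto
    finally show "x v * (1 - x v)\<^sup>2 \<le> 1/n * (1 - 1/n)\<^sup>2 + (1 - 4/n + 3/n\<^sup>2) * (x v - 1/n)"
      by (simp add: t_def power_divide)
  qed
  also have "\<dots> = (1 - 1/n)\<^sup>2"
    using n2 x(2) by (simp add: sum.distrib sum_subtractf flip: sum_distrib_left n_def)
  finally have "6 * (n - 1) * lag (nsets A 3) x \<le> (n - 2) * (1 - 1/n)\<^sup>2"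
    using n2 by (simp add: mult_left_mono)
  also have "\<dots> = (n - 1) * ((n - 1) * (n - 2) / n\<^sup>2)" using n2 by (simp add: field_simps power2_eq_square)
  finally have "(n - 1) * (6 * lag (nsets A 3) x) \<le> (n - 1) * ((n - 1) * (n - 2) / n\<^sup>2)"
    by (simp only: mult.assoc mult.left_commute[of _ 6])
  hence "6 * lag (nsets A 3) x \<le> (n - 1) * (n - 2) / n\<^sup>2"
    using n2 by (simp only: mult_le_cancel_left_pos)
  thus ?thesis using n2 by (simp add: field_simps n_def)
qed

text \<open>Sum the degree condition over all vertices. The sets \<open>e - {v}\<close> are all
  different, as two edges never share \<open>r - 1\<close> vertices, so their monomials are among
  those of the complete \<open>(r - 1)\<close>-uniform hypergraph.\<close>

lemma lag_sparse_le:
  assumes opt: "opt_weights r S E x" and r: "r \<ge> 1"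
    and sparse: "\<And>A B. A \<in> E \<Longrightarrow> B \<in> E \<Longrightarrow> A \<noteq> B \<Longrightarrow> card (A \<inter> B) \<noteq> r - 1"
  shows "real (card S) * (real r * lag E x) \<le> lag (nsets S (r - 1)) x"
proof -
  note o = opt_weightsD[OF opt]
  have fE: "finite E" using finite_edges[OF o(1,2)] .
  define P where "P = (SIGMA v:S. {e\<in>E. v \<in> e})"
  define g where "g = (\<lambda>(v, e). e - {v :: 'a})"
  have inj: "inj_on g P"
  proof (rule inj_onI, clarify)
    fix v e v' e' assume "(v, e) \<in> P" "(v', e') \<in> P" "g (v, e) = g (v', e')"
    hence m: "v \<in> e" "e \<in> E" "v' \<in> e'" "e' \<in> E" "e - {v} = e' - {v'}" by (auto simp: P_def g_def)
    have ce: "finite e" "card e = r" "finite e'" "card e' = r" using m edgeD[OF o(2)] by auto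
    have "e = e'"
    proof (rule ccontr)
      assume ne: "e \<noteq> e'"
      have "v \<notin> e'"
      proof
        assume "v \<in> e'"
        hence vv: "v = v'" using m(5) by auto
        have "e = insert v (e - {v})" using m(1) by blast
        also have "\<dots> = insert v' (e' - {v'})" unfolding m(5) by (simp only: vv)
        also have "\<dots> = e'" using m(3) by blast
        finally show False using ne by simp
      qed
      hence "e \<inter> e' = e - {v}" using m(5) by auto
      hence "card (e \<inter> e') = r - 1" using m ce by simp
      thus False using sparse m ne by blast
    qed
    thus "v = v' \<and> e = e'" using m by auto
  qed
  have "real (card S) * (real r * lag E x) = (\<Sum>v\<in>S. dlag E v x)" using o(5) by simp
  also have "\<dots> = (\<Sum>q\<in>P. prod x (g q))"
    unfolding dlag_def P_def g_def using o(1) fE by (subst sum.Sigma) (auto simp: case_prod_beta)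
  also have "\<dots> = (\<Sum>f\<in>g ` P. prod x f)" using inj by (simp add: sum.reindex)
  also have "\<dots> \<le> (\<Sum>f\<in>nsets S (r - 1). prod x f)"
  proof (rule sum_mono2)
    show "g ` P \<subseteq> nsets S (r - 1)"
    proof
      fix f assume "f \<in> g ` P"
      then obtain v e where f: "e \<in> E" "v \<in> e" "f = e - {v}" by (auto simp: P_def g_def)
      thus "f \<in> nsets S (r - 1)" using edgeD[OF o(2) f(1)] by (auto simp: nsets_def)
    qed
    fix f assume "f \<in> nsets S (r - 1) - g ` P"
    hence fS: "f \<subseteq> S" by (simp add: nsets_def)
    show "0 \<le> prod x f"
    proof (rule prod_nonneg)
      fix i assume "i \<in> f"
      thus "0 \<le> x i" using fS o(3)[of i] by (simp add: subset_iff less_imp_le)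
    qed
  qed (rule finite_imp_finite_nsets[OF o(1)])
  finally show ?thesis by (simp add: lag_def)
qed

text \<open>On \<open>r + 1\<close> vertices any two different edges share \<open>r - 1\<close>,
  while covering the vertex outside an edge takes a second edge.\<close>

lemma sparse_card_neq:
  assumes opt: "opt_weights r S E x" and r: "r \<ge> 2"
    and sparse: "\<And>A B. A \<in> E \<Longrightarrow> B \<in> E \<Longrightarrow> A \<noteq> B \<Longrightarrow> card (A \<inter> B) \<noteq> r - 1"
  shows "card S \<noteq> r + 1"
proof
  assume c: "card S = r + 1"
  note o = opt_weightsD[OF opt]
  obtain e where e: "e \<in> E" by (rule opt_edge_ex[OF opt]) (use c r in auto)
  have e': "e \<subseteq> S" "finite e" "card e = r" using edgeD[OF o(2)] e by auto
  have "card (S - e) = 1" using c e' by (simp add: card_Diff_subset)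
  then obtain v where v: "S - e = {v}" by (auto simp: card_1_singleton_iff)
  obtain u where u: "u \<in> e" using e' r by fastforce
  obtain f where f: "f \<in> E" "u \<in> f" "v \<in> f" using o(6)[of u v] u v e' by auto
  have f': "f \<subseteq> S" "finite f" "card f = r" using edgeD[OF o(2)] f by auto
  have "e \<inter> f = f - {v}" using v f' by auto
  hence "card (e \<inter> f) = r - 1" using f f' by simp
  moreover have "e \<noteq> f" using v f by auto
  ultimately show False using sparse e f by blast
qed

text \<open>Beyond 3 vertices the support has at least 5, and
  \<open>n * 3 * lag E x \<le> 1/2\<close> gives 1/30. Four vertices would give only 1/24 in this
  estimate, hence their separate exclusion.\<close>

lemma lag3_sparse:
  assumes opt: "opt_weights 3 S E x" and rich: "rich \<theta> K S E" and K: "5 \<le> K" and \<theta>: "3/5 \<le> \<theta>"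
  shows "lag E x \<le> 1 / 27"
proof (cases "card S \<le> 3")
  case True
  thus ?thesis using lag_small_support[OF opt] by simp
next
  case False
  have sp: "A \<in> E \<Longrightarrow> B \<in> E \<Longrightarrow> A \<noteq> B \<Longrightarrow> card (A \<inter> B) \<noteq> 3 - 1" for A B
    using rich_sparse[OF opt _ rich, of A B] K \<theta> by simp
  have n: "card S \<ge> 5" using False sparse_card_neq[OF opt _ sp] by simp
  note o = opt_weightsD[OF opt]
  have sq: "(\<Sum>i\<in>S. (x i)\<^sup>2) \<ge> 0" by (intro sum_nonneg) auto
  have "real (card S) * (3 * lag E x) \<le> 1 / 2"
    using lag_sparse_le[OF opt _ sp] lag_pairs[OF o(1), of x] o(4) sq by simp
  moreover have "lag E x \<ge> 0"
    unfolding lag_def using edgeD[OF o(2)] o(3) by (intro sum_nonneg prod_nonneg) (meson less_imp_le subsetD)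
  hence "5 * (3 * lag E x) \<le> real (card S) * (3 * lag E x)" using n by (intro mult_right_mono) auto
  ultimately have "5 * (3 * lag E x) \<le> 1 / 2" by (meson order_trans)
  thus ?thesis by simp
qed

text \<open>For \<open>n \<ge> 6\<close> vertices the estimates combine to
  \<open>24 * n^3 * lag E x \<le> (n - 1) * (n - 2)\<close>, just enough: 1/259.2 at
  \<open>n = 6\<close>, but 1/250 at the excluded \<open>n = 5\<close>. With
  \<open>n = k + 6\<close> the final polynomial has nonnegative coefficients.\<close>

lemma lag4_sparse:
  assumes opt: "opt_weights 4 S E x" and rich: "rich \<theta> K S E" and K: "7 \<le> K" and \<theta>: "5/7 \<le> \<theta>"
  shows "lag E x \<le> 1 / 256"
proof (cases "card S \<le> 4")
  case True
  thus ?thesis using lag_small_support[OF opt] by simp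
next
  case False
  have sp: "A \<in> E \<Longrightarrow> B \<in> E \<Longrightarrow> A \<noteq> B \<Longrightarrow> card (A \<inter> B) \<noteq> 4 - 1" for A B
    using rich_sparse[OF opt _ rich, of A B] K \<theta> by simp
  have n: "card S \<ge> 6" using False sparse_card_neq[OF opt _ sp] by simp
  note o = opt_weightsD[OF opt]
  define k where "k = real (card S) - 6"
  have k: "k \<ge> 0" "real (card S) = k + 6" using n by (auto simp: k_def)
  have a: "(k + 6) * (4 * lag E x) \<le> lag (nsets S 3) x"
    using lag_sparse_le[OF opt _ sp] k by simp
  have b: "6 * (k + 6) ^ 2 * lag (nsets S 3) x \<le> (k + 5) * (k + 4)"
    using lag_triples_le[OF o(1) _ _ o(4)] o(3) n k by (simp add: less_imp_le algebra_simps)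
  have "24 * (k + 6) ^ 3 * lag E x = 6 * (k + 6) ^ 2 * ((k + 6) * (4 * lag E x))"
    by (simp add: power2_eq_square power3_eq_cube)
  also have "\<dots> \<le> 6 * (k + 6) ^ 2 * lag (nsets S 3) x" using a by (intro mult_left_mono) auto
  also have "\<dots> \<le> (k + 5) * (k + 4)" by (rule b)
  also have "\<dots> \<le> 24 * (k + 6) ^ 3 / 256"
  proof -
    have "0 \<le> 3 * k ^ 3 + 22 * k\<^sup>2 + 36 * k + 8" using k(1) by simp
    thus ?thesis by (simp add: power2_eq_square power3_eq_cube algebra_simps)
  qed
  finally have "(24 * (k + 6) ^ 3) * lag E x \<le> (24 * (k + 6) ^ 3) * (1 / 256)" by simp
  thus ?thesis using k(1) by (subst (asm) mult_le_cancel_left_pos) auto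
qed

section \<open>Quadratic and cubic forms\<close>

text \<open>Ordered pairs are summed, so an unordered pair counts twice and the constant 1 gives the
  square of the total weight.\<close>

definition quad :: "'a set \<Rightarrow> ('a \<Rightarrow> real) \<Rightarrow> ('a \<Rightarrow> 'a \<Rightarrow> real) \<Rightarrow> real" where
  "quad A x f = (\<Sum>j\<in>A. \<Sum>k\<in>A. f j k * (x j * x k))"

text \<open>Each place has its own range, so that a sum over ordered triples can be split by
  membership in a set and its complement.\<close>

definition tri :: "('a \<Rightarrow> 'a \<Rightarrow> 'a \<Rightarrow> real) \<Rightarrow> ('a \<Rightarrow> real) \<Rightarrow> 'a set \<Rightarrow> 'a set \<Rightarrow> 'a set \<Rightarrow> real" where
  "tri h x A B C = (\<Sum>a\<in>A. \<Sum>b\<in>B. \<Sum>c\<in>C. h a b c * (x a * x b * x c))"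

lemma sum_times_sum: "(\<Sum>j\<in>A. \<Sum>k\<in>B. x j * y k) = sum x A * (sum y B :: real)"
  by (simp add: sum_product)

text \<open>Removing equal weight from a pair on which \<open>f\<close> exceeds \<open>c\<close> loses at most as much as for the
  constant function \<open>c\<close>.\<close>

lemma quad_removal:
  assumes A: "finite A" and c: "c \<ge> 0"
    and sym: "\<And>j k. f j k = f k j" and diag: "\<And>j. f j j = 0"
    and step: "\<And>j k. j \<in> A \<Longrightarrow> k \<in> A \<Longrightarrow> j \<noteq> k \<Longrightarrow> f j k > c \<Longrightarrow>
      f j k \<le> 2 * c \<and> (\<forall>u\<in>A. u \<noteq> j \<longrightarrow> u \<noteq> k \<longrightarrow> f j u + f k u \<le> 2 * c)"
    and x: "\<And>i. i \<in> A \<Longrightarrow> 0 \<le> x i"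
  shows "quad A x f \<le> c * (sum x A)\<^sup>2"
  using x
proof (induction "card {i\<in>A. x i \<noteq> 0}" arbitrary: x rule: less_induct)
  case less
  show ?case
  proof (cases "\<exists>j\<in>A. \<exists>k\<in>A. x j \<noteq> 0 \<and> x k \<noteq> 0 \<and> f j k > c")
    case False
    have "quad A x f \<le> (\<Sum>j\<in>A. \<Sum>k\<in>A. c * (x j * x k))"
      unfolding quad_def
    proof (intro sum_mono)
      fix j k assume jk: "j \<in> A" "k \<in> A"
      show "f j k * (x j * x k) \<le> c * (x j * x k)"
      proof (cases "x j = 0 \<or> x k = 0")
        case F: False
        hence "f j k \<le> c" using False jk by (meson not_le)
        thus ?thesis using less.prems jk by (intro mult_right_mono mult_nonneg_nonneg)
      qed auto
    qed
    also have "\<dots> = c * (sum x A)\<^sup>2"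
      by (simp add: power2_eq_square flip: sum_distrib_left sum_distrib_right)
    finally show ?thesis .
  next
    case True
    then obtain j k where jk: "j \<in> A" "k \<in> A" "x j \<noteq> 0" "x k \<noteq> 0" "f j k > c" by blast
    have ne: "j \<noteq> k" using jk c diag by auto
    have st: "f j k \<le> 2 * c" "\<And>u. u \<in> A \<Longrightarrow> u \<noteq> j \<Longrightarrow> u \<noteq> k \<Longrightarrow> f j u + f k u \<le> 2 * c"
      using step[OF jk(1,2) ne jk(5)] by auto
    \<comment> \<open>Removing the smaller weight empties one of the two vertices, which drives the
      induction on the support.\<close>
    define \<delta> where "\<delta> = min (x j) (x k)"
    have \<delta>: "\<delta> > 0" "\<delta> \<le> x j" "\<delta> \<le> x k" using jk less.prems[of j] less.prems[of k] by (auto simp: \<delta>_def)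
    define d where "d = (\<lambda>i. if i = j \<or> i = k then \<delta> else 0)"
    define y where "y = (\<lambda>i. x i - d i)"
    have y: "0 \<le> y i" if "i \<in> A" for i using less.prems[OF that] \<delta> by (auto simp: y_def d_def)
    have xy: "x i = y i + d i" for i by (simp add: y_def)
    have dsum: "(\<Sum>i\<in>A. d i * h i) = \<delta> * (h j + h k)" for h
    proof -
      have "(\<Sum>i\<in>A. d i * h i) = (\<Sum>i\<in>{j,k}. d i * h i)"
        using A jk by (intro sum.mono_neutral_right) (auto simp: d_def)
      thus ?thesis using ne by (simp add: d_def distrib_left)
    qed
    have zero: "y j = 0 \<or> y k = 0" by (auto simp: y_def d_def \<delta>_def)
    have "{i\<in>A. y i \<noteq> 0} \<subseteq> {i\<in>A. x i \<noteq> 0}" using jk by (auto simp: y_def d_def)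
    moreover have "j \<in> {i\<in>A. x i \<noteq> 0}" "k \<in> {i\<in>A. x i \<noteq> 0}" using jk by auto
    ultimately have "{i\<in>A. y i \<noteq> 0} \<subset> {i\<in>A. x i \<noteq> 0}" using zero by auto
    hence "card {i\<in>A. y i \<noteq> 0} < card {i\<in>A. x i \<noteq> 0}" using A by (intro psubset_card_mono) auto
    from less.hyps[OF this] y have IH: "quad A y f \<le> c * (sum y A)\<^sup>2" by blast
    have s: "sum x A = sum y A + 2 * \<delta>"
      using dsum[of "\<lambda>_. 1"] by (simp add: xy sum.distrib)
    \<comment> \<open>A third vertex \<open>u\<close> loses at most
      \<open>f j u + f k u \<le> 2 * c\<close>; for \<open>u = j\<close> or \<open>u = k\<close> the
      diagonal is zero and \<open>f j k \<le> 2 * c\<close> takes its place.\<close>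
    have cross: "(\<Sum>a\<in>A. \<Sum>b\<in>A. f a b * (d a * y b)) \<le> \<delta> * (2 * c * sum y A)"
    proof -
      have "(\<Sum>a\<in>A. \<Sum>b\<in>A. f a b * (d a * y b)) = (\<Sum>a\<in>A. d a * (\<Sum>b\<in>A. f a b * y b))"
        by (simp add: sum_distrib_left mult.left_commute)
      also have "\<dots> = \<delta> * (\<Sum>b\<in>A. (f j b + f k b) * y b)"
        by (simp add: dsum sum.distrib distrib_right)
      also have "\<dots> \<le> \<delta> * (\<Sum>b\<in>A. 2 * c * y b)"
      proof (intro mult_left_mono sum_mono mult_right_mono)
        fix b assume b: "b \<in> A"
        show "f j b + f k b \<le> 2 * c"
          using st(1) st(2)[OF b] diag sym[of k j] by (cases "b = j \<or> b = k") auto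
      qed (use \<delta> y in auto)
      finally show ?thesis by (simp add: sum_distrib_left)
    qed
    have dd: "(\<Sum>a\<in>A. \<Sum>b\<in>A. f a b * (d a * d b)) \<le> \<delta> * (4 * c * \<delta>)"
    proof -
      have "(\<Sum>a\<in>A. \<Sum>b\<in>A. f a b * (d a * d b)) = (\<Sum>a\<in>A. d a * (\<Sum>b\<in>A. d b * f a b))"
        by (simp add: sum_distrib_left mult_ac)
      also have "\<dots> = \<delta> * (2 * f j k * \<delta>)" using diag sym[of k j] by (simp add: dsum)
      also have "\<dots> \<le> \<delta> * (4 * c * \<delta>)" using st(1) \<delta> by (intro mult_left_mono mult_right_mono) auto
      finally show ?thesis .
    qed
    have swap: "(\<Sum>a\<in>A. \<Sum>b\<in>A. f a b * (y a * d b)) = (\<Sum>a\<in>A. \<Sum>b\<in>A. f a b * (d a * y b))"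
      by (subst sum.swap) (intro sum.cong refl, simp add: sym mult.commute)
    have "quad A x f = quad A y f + (\<Sum>a\<in>A. \<Sum>b\<in>A. f a b * (d a * y b))
        + (\<Sum>a\<in>A. \<Sum>b\<in>A. f a b * (y a * d b)) + (\<Sum>a\<in>A. \<Sum>b\<in>A. f a b * (d a * d b))"
      unfolding quad_def xy by (simp add: algebra_simps sum.distrib)
    also have "\<dots> \<le> c * (sum y A)\<^sup>2 + \<delta> * (2 * c * sum y A) + \<delta> * (2 * c * sum y A) + \<delta> * (4 * c * \<delta>)"
      unfolding swap by (intro add_mono IH cross dd)
    also have "\<dots> = c * (sum x A)\<^sup>2" unfolding s by (simp add: power2_eq_square algebra_simps)
    finally show ?thesis .
  qed
qed

text \<open>Turan's theorem for weighted graphs. Take \<open>v\<close> of largest weighted degree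
  \<open>n\<close>: its neighbourhood contains smaller cliques only, which the induction bounds, and
  every vertex outside it has degree at most \<open>n\<close>.\<close>

lemma quad_turan:
  assumes A: "finite A" and t: "t \<ge> 1" and sym: "\<And>j k. g j k = g k j"
    and x: "\<And>i. i \<in> A \<Longrightarrow> 0 \<le> x i"
    and free: "\<And>C. C \<subseteq> A \<Longrightarrow> card C = t + 1 \<Longrightarrow> \<exists>i\<in>C. \<exists>j\<in>C. i \<noteq> j \<and> \<not> g i j"
    and irrefl: "\<And>i. \<not> g i i"
  shows "real t * quad A x (\<lambda>j k. of_bool (g j k)) \<le> (real t - 1) * (sum x A)\<^sup>2"
  using t A x free
proof (induction t arbitrary: A rule: nat_induct_at_least)
  case base
  have "\<not> g j k" if "j \<in> A" "k \<in> A" for j k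
  proof (cases "j = k")
    case False
    thus ?thesis using base(3)[of "{j,k}"] that sym by auto
  qed (use irrefl in auto)
  thus ?case by (simp add: quad_def)
next
  case (Suc t)
  show ?case
  proof (cases "A = {}")
    case True
    thus ?thesis by (simp add: quad_def)
  next
    case ne: False
    define q where "q = (\<lambda>j k. of_bool (g j k) :: real)"
    define d where "d = (\<lambda>j. \<Sum>k\<in>A. q j k * x k)"
    define n where "n = Max (d ` A)"
    have "n \<in> d ` A" unfolding n_def using Suc.prems(1) ne by (intro Max_in) auto
    then obtain v where v: "v \<in> A" "d v = n" by auto
    have dn: "d j \<le> n" if "j \<in> A" for j unfolding n_def using that Suc.prems(1) by simp
    define N where "N = {k\<in>A. g v k}"
    have N: "N \<subseteq> A" "finite N" unfolding N_def using Suc.prems(1) by simp_all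
    have sN: "sum x N = n"
    proof -
      have "sum x N = (\<Sum>k\<in>A. if g v k then x k else 0)"
        unfolding N_def using Suc.prems(1) by (intro sum.mono_neutral_cong_left) auto
      also have "\<dots> = d v" unfolding d_def q_def by (intro sum.cong) auto
      finally show ?thesis using v by simp
    qed
    have q0: "0 \<le> q j k" for j k by (simp add: q_def)
    have IH: "real t * quad N x q \<le> (real t - 1) * n\<^sup>2"
      unfolding sN[symmetric] q_def
    proof (rule Suc.IH[OF N(2)])
      fix C assume C: "C \<subseteq> N" "card C = t + 1"
      hence "v \<notin> C" "finite C" using irrefl N(2) finite_subset by (auto simp: N_def)
      hence "card (insert v C) = Suc t + 1" using C by simp
      moreover have "insert v C \<subseteq> A" using C N v by auto
      ultimately obtain i j where "i \<in> insert v C" "j \<in> insert v C" "i \<noteq> j" "\<not> g i j"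
        using Suc.prems(3) by blast
      moreover have "g v k" "g k v" if "k \<in> C" for k using that C sym by (auto simp: N_def)
      ultimately show "\<exists>i\<in>C. \<exists>j\<in>C. i \<noteq> j \<and> \<not> g i j" by blast
    qed (use N Suc.prems(2) in auto)
    define R where "R = A - N"
    have AR: "A = N \<union> R" "N \<inter> R = {}" "finite R" using N Suc.prems(1) by (auto simp: R_def)
    have sR: "sum x R = sum x A - n" unfolding R_def using N Suc.prems(1) sN by (simp add: sum_diff)
    have xR: "0 \<le> x j" if "j \<in> R" for j using that Suc.prems(2) by (auto simp: R_def)
    have RA: "(\<Sum>j\<in>R. \<Sum>k\<in>A. q j k * (x j * x k)) \<le> sum x R * n"
    proof -
      have "(\<Sum>j\<in>R. \<Sum>k\<in>A. q j k * (x j * x k)) = (\<Sum>j\<in>R. x j * d j)"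
        unfolding d_def by (simp add: sum_distrib_left mult.left_commute)
      also have "\<dots> \<le> (\<Sum>j\<in>R. x j * n)"
        using xR dn AR by (intro sum_mono mult_left_mono) auto
      finally show ?thesis by (simp add: sum_distrib_right)
    qed
    have "(\<Sum>j\<in>N. \<Sum>k\<in>R. q j k * (x j * x k)) = (\<Sum>k\<in>R. \<Sum>j\<in>N. q k j * (x k * x j))"
      by (subst sum.swap) (intro sum.cong refl, simp add: q_def sym mult.commute)
    also have "\<dots> \<le> (\<Sum>j\<in>R. \<Sum>k\<in>A. q j k * (x j * x k))"
      using N Suc.prems(1,2) xR q0 by (intro sum_mono sum_mono2) auto
    finally have NR: "(\<Sum>j\<in>N. \<Sum>k\<in>R. q j k * (x j * x k)) \<le> sum x R * n" using RA by linarith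
    have "quad A x q = (\<Sum>j\<in>N. \<Sum>k\<in>A. q j k * (x j * x k)) + (\<Sum>j\<in>R. \<Sum>k\<in>A. q j k * (x j * x k))"
      unfolding quad_def by (subst AR(1)) (rule sum.union_disjoint[OF N(2) AR(3,2)])
    also have "(\<Sum>j\<in>N. \<Sum>k\<in>A. q j k * (x j * x k)) = quad N x q + (\<Sum>j\<in>N. \<Sum>k\<in>R. q j k * (x j * x k))"
      unfolding quad_def by (subst AR(1)) (simp add: sum.union_disjoint[OF N(2) AR(3,2)] sum.distrib)
    finally have le: "quad A x q \<le> quad N x q + 2 * ((sum x A - n) * n)" using RA NR sR by simp
    define s where "s = sum x A"
    have t0: "real t > 0" using Suc.hyps by simp
    \<comment> \<open>The resulting bound is quadratic in \<open>n\<close>; completing the square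
      eliminates the unknown degree.\<close>
    have "real t * (real (Suc t) * quad A x q) \<le> real (Suc t) * (real t * (quad N x q + 2 * ((s - n) * n)))"
      using le t0 by (simp add: s_def mult_left_mono)
    also have "\<dots> \<le> real (Suc t) * ((real t - 1) * n\<^sup>2 + real t * (2 * ((s - n) * n)))"
      using IH by (intro mult_left_mono) (auto simp: distrib_left)
    also have "\<dots> = real t * (real t * s\<^sup>2) - (real t * s - (real t + 1) * n)\<^sup>2"
      by (simp add: power2_eq_square algebra_simps)
    also have "\<dots> \<le> real t * ((real (Suc t) - 1) * s\<^sup>2)" by simp
    finally show ?thesis using t0 by (simp add: q_def s_def)
  qed
qed

text \<open>De Caen's argument, relative to a graph \<open>g\<close>: in a triple system without four vertices spanning all
  four triples, an edge and a fourth vertex span at most two further edges.\<close>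

lemma deCaen_K4:
  assumes W: "finite W" and x: "\<And>i. i \<in> W \<Longrightarrow> 0 \<le> x i" and s: "sum x W > 0"
    and sym: "\<And>a b c. t a b c = t b a c" "\<And>a b c. t a b c = (t a c b :: real)"
    and t01: "\<And>a b c. t a b c = 0 \<or> t a b c = 1"
    and g: "\<And>a b c. t a b c \<noteq> 0 \<Longrightarrow> g a b = (1::real)" "\<And>a b. 0 \<le> g a b"
    and free: "\<And>a b c z. a \<in> W \<Longrightarrow> b \<in> W \<Longrightarrow> c \<in> W \<Longrightarrow> z \<in> W \<Longrightarrow> t a b c = 1 \<Longrightarrow>
        t a b z = 1 \<Longrightarrow> t a c z = 1 \<Longrightarrow> t b c z = 1 \<Longrightarrow> False"
  shows "3 * tri t x W W W \<le> 2 * sum x W * quad W x g"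
proof -
  define N where "N = tri t x W W W"
  \<comment> \<open>\<open>d\<close> is the weighted codegree. \<open>Z\<close> sums it over the
    edges, and by symmetry each of the three pairs of a triple gives the same sum.\<close>
  define d where "d = (\<lambda>a b. \<Sum>z\<in>W. t a b z * x z)"
  define Z where "Z = (\<Sum>a\<in>W. \<Sum>b\<in>W. \<Sum>c\<in>W. t a b c * (x a * x b * x c) * d a b)"
  define s where "s = sum x W"
  have Z2: "(\<Sum>a\<in>W. \<Sum>b\<in>W. \<Sum>c\<in>W. t a b c * (x a * x b * x c) * d a c) = Z"
    unfolding Z_def
  proof (rule sum.cong[OF refl])
    fix a
    have "(\<Sum>b\<in>W. \<Sum>c\<in>W. t a b c * (x a * x b * x c) * d a c)
        = (\<Sum>b\<in>W. \<Sum>c\<in>W. t a c b * (x a * x c * x b) * d a b)" by (rule sum.swap)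
    also have "\<dots> = (\<Sum>b\<in>W. \<Sum>c\<in>W. t a b c * (x a * x b * x c) * d a b)"
      by (intro sum.cong refl) (subst sym(2), simp)
    finally show "(\<Sum>b\<in>W. \<Sum>c\<in>W. t a b c * (x a * x b * x c) * d a c)
        = (\<Sum>b\<in>W. \<Sum>c\<in>W. t a b c * (x a * x b * x c) * d a b)" .
  qed
  have Z3: "(\<Sum>a\<in>W. \<Sum>b\<in>W. \<Sum>c\<in>W. t a b c * (x a * x b * x c) * d b c) = Z"
  proof -
    have "(\<Sum>a\<in>W. \<Sum>b\<in>W. \<Sum>c\<in>W. t a b c * (x a * x b * x c) * d b c)
        = (\<Sum>a\<in>W. \<Sum>b\<in>W. \<Sum>c\<in>W. t b a c * (x b * x a * x c) * d a c)" by (rule sum.swap)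
    also have "\<dots> = (\<Sum>a\<in>W. \<Sum>b\<in>W. \<Sum>c\<in>W. t a b c * (x a * x b * x c) * d a c)"
      by (intro sum.cong refl) (subst sym(1), simp)
    finally show ?thesis using Z2 by simp
  qed
  have dsum: "(\<Sum>a\<in>W. \<Sum>b\<in>W. x a * x b * d a b) = N"
    unfolding N_def tri_def d_def sum_distrib_left by (intro sum.cong refl) (simp add: mult_ac)
  have dsq: "(\<Sum>a\<in>W. \<Sum>b\<in>W. x a * x b * (d a b * d a b)) = Z"
  proof -
    have "x a * x b * (d a b * d a b) = (\<Sum>c\<in>W. t a b c * (x a * x b * x c) * d a b)" for a b
    proof -
      have "x a * x b * (d a b * d a b) = (x a * x b * d a b) * (\<Sum>c\<in>W. t a b c * x c)" by (simp add: d_def)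
      thus ?thesis unfolding sum_distrib_left by (simp add: mult_ac)
    qed
    thus ?thesis by (simp add: Z_def)
  qed
  have "3 * Z = (\<Sum>a\<in>W. \<Sum>b\<in>W. \<Sum>c\<in>W. t a b c * (x a * x b * x c) * (d a b + d a c + d b c))"
    using Z2 Z3 by (simp add: distrib_left sum.distrib Z_def[symmetric])
  also have "\<dots> \<le> (\<Sum>a\<in>W. \<Sum>b\<in>W. \<Sum>c\<in>W. t a b c * (x a * x b * x c) * (2 * s))"
  proof (intro sum_mono)
    fix a b c assume abc: "a \<in> W" "b \<in> W" "c \<in> W"
    show "t a b c * (x a * x b * x c) * (d a b + d a c + d b c) \<le> t a b c * (x a * x b * x c) * (2 * s)"
    proof (cases "t a b c = 1")
      case True
      have "d a b + d a c + d b c = (\<Sum>z\<in>W. (t a b z + t a c z + t b c z) * x z)"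
        by (simp add: d_def sum.distrib distrib_right)
      also have "\<dots> \<le> (\<Sum>z\<in>W. 2 * x z)"
      proof (intro sum_mono mult_right_mono x)
        fix z assume z: "z \<in> W"
        show "t a b z + t a c z + t b c z \<le> 2"
          using free[OF abc z True] t01[of a b z] t01[of a c z] t01[of b c z] by auto
      qed
      finally have "d a b + d a c + d b c \<le> 2 * s" by (simp add: s_def sum_distrib_left)
      thus ?thesis using x abc True by (intro mult_left_mono mult_nonneg_nonneg) auto
    qed (use t01[of a b c] in auto)
  qed
  also have "\<dots> = 2 * s * N" unfolding N_def tri_def by (simp add: sum_distrib_left sum_distrib_right mult_ac)
  finally have ZN: "3 * Z \<le> 2 * s * N" .
  \<comment> \<open>Cauchy-Schwarz in linear form: the sum of \<open>(d a b - l)\<^sup>2\<close>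
    over the graph \<open>g\<close> is nonnegative. The value of \<open>l\<close> is the ratio of
    \<open>N\<close> to \<open>quad W x g\<close> in the case of equality.\<close>
  define l where "l = 2 * s / 3"
  have "0 \<le> (\<Sum>a\<in>W. \<Sum>b\<in>W. g a b * (x a * x b) * (d a b - l)\<^sup>2)"
    using x g(2) by (intro sum_nonneg mult_nonneg_nonneg) auto
  also have "\<dots> = (\<Sum>a\<in>W. \<Sum>b\<in>W. x a * x b * (d a b * d a b) - 2 * l * (x a * x b * d a b) + l\<^sup>2 * (g a b * (x a * x b)))"
  proof (intro sum.cong refl)
    fix a b
    have "g a b * d a b = d a b"
    proof (cases "g a b = 1")
      case False
      hence "\<And>z. t a b z = 0" using g(1) by blast
      thus ?thesis by (simp add: d_def)
    qed auto
    moreover have "g a b * (x a * x b) * (d a b - l)\<^sup>2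
        = x a * x b * ((g a b * d a b) * d a b) - 2 * l * (x a * x b * (g a b * d a b)) + l\<^sup>2 * (g a b * (x a * x b))"
      by (simp add: power2_eq_square algebra_simps)
    ultimately show "g a b * (x a * x b) * (d a b - l)\<^sup>2
        = x a * x b * (d a b * d a b) - 2 * l * (x a * x b * d a b) + l\<^sup>2 * (g a b * (x a * x b))"
      by (simp only:)
  qed
  also have "\<dots> = Z - 2 * l * N + l\<^sup>2 * quad W x g"
    unfolding quad_def
    by (simp add: sum.distrib sum_subtractf dsq dsum flip: sum_distrib_left)
  finally have "2 * l * N - l\<^sup>2 * quad W x g \<le> 2 * s * N / 3" using ZN by simp
  hence "2 * s * (3 * N) \<le> 2 * s * (2 * s * quad W x g)"
    by (simp add: l_def power2_eq_square field_simps)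
  moreover have "2 * s > 0" using s by (simp add: s_def)
  ultimately have "3 * N \<le> 2 * s * quad W x g" by (simp only: mult_le_cancel_left_pos)
  thus ?thesis by (simp add: N_def s_def)
qed

text \<open>The vertices of a configuration are listed with their weights and may coincide;
  coinciding entries add up in \<open>w\<close>, so the roles need not be shown distinct.\<close>

lemma rich_roles:
  assumes rich: "rich \<theta> K S E" and S: "finite S" and ps: "fst ` set ps \<subseteq> S"
    and N: "0 < sum_list (map snd ps)" "sum_list (map snd ps) \<le> K"
    and \<theta>: "real a \<le> \<theta> * real (sum_list (map snd ps))"
  obtains I where "I \<subseteq> S" "indep E I" "a < (\<Sum>(v, c)\<leftarrow>ps. c * of_bool (v \<in> I))"
proof -
  define w where "w = (\<lambda>u. \<Sum>(v, c)\<leftarrow>ps. c * of_bool (u = v))"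
  have sw: "sum w A = (\<Sum>(v, c)\<leftarrow>ps. c * of_bool (v \<in> A))" if "finite A" for A
    unfolding w_def using that
  proof (induction ps)
    case (Cons p ps)
    obtain v c where p: "p = (v, c)" by (cases p)
    have "(\<Sum>u\<in>A. c * of_bool (u = v)) = c * of_bool (v \<in> A)"
    proof -
      have "(\<Sum>u\<in>A. c * of_bool (u = v)) = (\<Sum>u\<in>A. if u = v then c else 0)" by (intro sum.cong) auto
      thus ?thesis using Cons.prems by (simp add: sum.delta)
    qed
    thus ?case using Cons by (simp add: sum.distrib p)
  qed simp
  have "(\<Sum>(v, c)\<leftarrow>ps. c * of_bool (v \<in> S)) = sum_list (map snd ps)"
    using ps by (intro arg_cong[where f = sum_list] map_cong) auto
  hence t: "sum w S = sum_list (map snd ps)" using sw[OF S] by simp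
  then obtain I where I: "I \<subseteq> S" "indep E I" "\<theta> * real (sum w S) < real (sum w I)"
    using rich[unfolded rich_def, rule_format, of w] N by auto
  have "real a < real (sum w I)" using I(3) \<theta> unfolding t by linarith
  hence "a < sum w I" by (simp only: of_nat_less_iff)
  thus ?thesis using that I(1,2) sw[OF finite_subset[OF I(1) S]] by simp
qed

text \<open>Scale \<open>x\<close> by \<open>K\<close> and round down. On at most \<open>m\<close>
  vertices this loses at most \<open>m\<close>, which the second bound on \<open>K\<close> keeps
  within the gap between \<open>\<theta>\<close> and \<open>\<theta>0\<close>.\<close>

lemma heavy_indep:
  assumes rich: "rich \<theta> K S E" and S: "finite S" "card S \<le> m" and x: "\<And>i. i \<in> S \<Longrightarrow> 0 \<le> x i" "sum x S = 1"
    and K: "m < K" "\<theta> * real m \<le> real K * (\<theta> - \<theta>0)" and \<theta>: "\<theta> \<ge> 0"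
  obtains I where "I \<subseteq> S" "indep E I" "\<theta>0 < sum x I"
proof -
  define w where "w = (\<lambda>i. nat \<lfloor>real K * x i\<rfloor>)"
  have w: "real (w i) \<le> real K * x i" "real K * x i - 1 \<le> real (w i)" if "i \<in> S" for i
  proof -
    have "0 \<le> real K * x i" using x(1)[OF that] by simp
    thus "real (w i) \<le> real K * x i" "real K * x i - 1 \<le> real (w i)" unfolding w_def by linarith+
  qed
  have up: "real (sum w A) \<le> real K * sum x A" if "A \<subseteq> S" for A
    using that w(1) by (auto simp: sum_distrib_left intro!: sum_mono)
  have "(\<Sum>i\<in>S. real K * x i - 1) \<le> (\<Sum>i\<in>S. real (w i))" using w(2) by (intro sum_mono)
  hence lo: "real K - real m \<le> real (sum w S)"
    using x(2) S by (simp add: sum_subtractf flip: sum_distrib_left)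
  have "0 < real (sum w S)" using lo K(1) by linarith
  hence "0 < sum w S" by (simp only: of_nat_0_less_iff)
  moreover have "real (sum w S) \<le> real K" using up[of S] x(2) by simp
  hence "sum w S \<le> K" by (simp only: of_nat_le_iff)
  ultimately obtain I where I: "I \<subseteq> S" "indep E I" "\<theta> * real (sum w S) < real (sum w I)"
    using rich[unfolded rich_def, rule_format, of w] by blast
  have "\<theta> * (real K - real m) \<le> \<theta> * real (sum w S)" using lo \<theta> by (intro mult_left_mono)
  also have "\<dots> < real K * sum x I" using I(3) up[OF I(1)] by linarith
  finally have "real K * \<theta>0 < real K * sum x I" using K(2) by (simp add: algebra_simps)
  hence "\<theta>0 < sum x I" using K(1) by simp
  thus ?thesis using that I by blast
qed

section \<open>Symmetries and decompositions of the cubic and quadratic forms\<close>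

lemma tri_swap:
  assumes "\<And>a b c. h a b c = h b a c" "\<And>a b c. h a b c = h a c b"
  shows "tri h x A B C = tri h x B A C" "tri h x A B C = tri h x A C B"
proof -
  have "tri h x A B C = (\<Sum>b\<in>B. \<Sum>a\<in>A. \<Sum>c\<in>C. h a b c * (x a * x b * x c))"
    unfolding tri_def by (rule sum.swap)
  also have "\<dots> = tri h x B A C"
    unfolding tri_def by (intro sum.cong refl) (subst assms(1), simp)
  finally show "tri h x A B C = tri h x B A C" .
  show "tri h x A B C = tri h x A C B"
    unfolding tri_def
  proof (rule sum.cong[OF refl])
    fix a
    have "(\<Sum>b\<in>B. \<Sum>c\<in>C. h a b c * (x a * x b * x c)) = (\<Sum>c\<in>C. \<Sum>b\<in>B. h a b c * (x a * x b * x c))"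
      by (rule sum.swap)
    also have "\<dots> = (\<Sum>c\<in>C. \<Sum>b\<in>B. h a c b * (x a * x c * x b))"
      by (intro sum.cong refl) (subst assms(2), simp)
    finally show "(\<Sum>b\<in>B. \<Sum>c\<in>C. h a b c * (x a * x b * x c)) = (\<Sum>c\<in>C. \<Sum>b\<in>B. h a c b * (x a * x c * x b))" .
  qed
qed

lemma tri_quad: "tri h x A B B = (\<Sum>a\<in>A. x a * quad B x (h a))"
  unfolding tri_def quad_def sum_distrib_left by (intro sum.cong refl) (simp add: mult_ac)

lemma tri_union:
  assumes "finite B" "finite C" "B \<inter> C = {}"
  shows "tri h x A (B \<union> C) D = tri h x A B D + tri h x A C D"
  unfolding tri_def using assms by (simp add: sum.union_disjoint sum.distrib)

lemma tri_split:
  assumes sym: "\<And>a b c. h a b c = h b a c" "\<And>a b c. h a b c = h a c b"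
    and fin: "finite B" "finite C" "B \<inter> C = {}"
  shows "tri h x B (B \<union> C) (B \<union> C) = tri h x B B B + 2 * tri h x B B C + tri h x B C C"
proof -
  have 3: "tri h x A D (B \<union> C) = tri h x A D B + tri h x A D C" for A D
  proof -
    have "tri h x A D (B \<union> C) = tri h x A (B \<union> C) D" by (rule tri_swap(2)[OF sym])
    also have "\<dots> = tri h x A B D + tri h x A C D" by (rule tri_union[OF fin])
    also have "tri h x A B D = tri h x A D B" by (rule tri_swap(2)[OF sym])
    also have "tri h x A C D = tri h x A D C" by (rule tri_swap(2)[OF sym])
    finally show ?thesis .
  qed
  have "tri h x B C B = tri h x B B C" by (rule tri_swap(2)[OF sym])
  thus ?thesis by (simp add: tri_union[OF fin] 3)
qed

lemma quad_add: "quad A x (\<lambda>j k. f j k + g j k) = quad A x f + quad A x g"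
  by (simp add: quad_def distrib_right sum.distrib)

lemma tri_diff: "tri (\<lambda>a b c. h a b c - h' a b c) x A B C = tri h x A B C - tri h' x A B C"
  by (simp add: tri_def left_diff_distrib sum_subtractf)

lemma tri_mono:
  assumes "\<And>a b c. a \<in> A \<Longrightarrow> b \<in> B \<Longrightarrow> c \<in> C \<Longrightarrow> h a b c \<le> h' a b c"
    and "\<And>i. i \<in> A \<union> B \<union> C \<Longrightarrow> 0 \<le> x i"
  shows "tri h x A B C \<le> tri h' x A B C"
  unfolding tri_def using assms by (intro sum_mono mult_right_mono mult_nonneg_nonneg) auto

lemma tri_nonneg:
  assumes "\<And>a b c. 0 \<le> h a b c" and "\<And>i. i \<in> A \<union> B \<union> C \<Longrightarrow> 0 \<le> x i"
  shows "0 \<le> tri h x A B C"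
  unfolding tri_def using assms by (intro sum_nonneg mult_nonneg_nonneg) auto

lemma tri_pairs:
  "tri (\<lambda>a b c. q a b) x A A A = sum x A * quad A x q"
  "tri (\<lambda>a b c. q a c) x A A A = sum x A * quad A x q"
  "tri (\<lambda>a b c. q b c) x A A A = sum x A * quad A x q"
proof -
  have 1: "(\<Sum>a\<in>A. \<Sum>b\<in>A. \<Sum>c\<in>A. q a b * (x a * x b * x c)) = sum x A * quad A x q"
    unfolding quad_def sum_distrib_left sum_distrib_right
    by (intro sum.cong refl) (simp add: mult_ac sum_distrib_left)
  thus "tri (\<lambda>a b c. q a b) x A A A = sum x A * quad A x q" by (simp add: tri_def)
  show "tri (\<lambda>a b c. q a c) x A A A = sum x A * quad A x q"
    unfolding tri_def 1[symmetric]
  proof (rule sum.cong[OF refl])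
    fix a
    have "(\<Sum>b\<in>A. \<Sum>c\<in>A. q a c * (x a * x b * x c)) = (\<Sum>c\<in>A. \<Sum>b\<in>A. q a c * (x a * x b * x c))"
      by (rule sum.swap)
    thus "(\<Sum>b\<in>A. \<Sum>c\<in>A. q a c * (x a * x b * x c)) = (\<Sum>b\<in>A. \<Sum>c\<in>A. q a b * (x a * x b * x c))"
      by (simp add: mult_ac)
  qed
  show "tri (\<lambda>a b c. q b c) x A A A = sum x A * quad A x q"
    unfolding tri_quad by (simp add: sum_distrib_right)
qed

lemma quad_mono:
  assumes "\<And>j k. j \<in> A \<Longrightarrow> k \<in> A \<Longrightarrow> f j k \<le> g j k" "\<And>i. i \<in> A \<Longrightarrow> 0 \<le> x i"
  shows "quad A x f \<le> quad A x g"
  unfolding quad_def using assms by (intro sum_mono mult_right_mono mult_nonneg_nonneg) auto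

lemma quad_nonneg:
  assumes "\<And>j k. 0 \<le> f j k" "\<And>i. i \<in> A \<Longrightarrow> 0 \<le> x i"
  shows "0 \<le> quad A x f"
  unfolding quad_def using assms by (intro sum_nonneg mult_nonneg_nonneg) auto

lemma quad_const: "quad A x (\<lambda>_ _. c) = c * (sum x A)\<^sup>2"
  by (simp add: quad_def power2_eq_square flip: sum_distrib_left sum_distrib_right)

lemma quad_subset:
  assumes "finite B" "A \<subseteq> B" "\<And>j k. 0 \<le> f j k" "\<And>i. i \<in> B \<Longrightarrow> 0 \<le> x i"
  shows "quad A x f \<le> quad B x f"
proof -
  have "quad A x f \<le> (\<Sum>j\<in>A. \<Sum>k\<in>B. f j k * (x j * x k))"
    unfolding quad_def using assms by (intro sum_mono sum_mono2) auto
  also have "\<dots> \<le> quad B x f"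
    unfolding quad_def using assms by (intro sum_mono2 sum_nonneg) auto
  finally show ?thesis .
qed

lemma tri_subset:
  assumes "finite B" "A \<subseteq> B" "\<And>a b c. 0 \<le> h a b c" "\<And>i. i \<in> B \<Longrightarrow> 0 \<le> x i"
  shows "tri h x A A A \<le> tri h x B B B"
proof -
  have "tri h x A A A \<le> (\<Sum>a\<in>A. x a * quad B x (h a))"
    unfolding tri_quad using assms by (intro sum_mono mult_left_mono quad_subset) auto
  also have "\<dots> \<le> tri h x B B B"
    unfolding tri_quad using assms by (intro sum_mono2 mult_nonneg_nonneg quad_nonneg) auto
  finally show ?thesis .
qed

lemma quad_union:
  assumes "finite A" "finite B" "A \<inter> B = {}" and sym: "\<And>j k. f j k = f k j"
  shows "quad (A \<union> B) x f = quad A x f + 2 * (\<Sum>z\<in>A. x z * (\<Sum>k\<in>B. f z k * x k)) + quad B x f"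
proof -
  have 1: "(\<Sum>z\<in>A. \<Sum>k\<in>B. f z k * (x z * x k)) = (\<Sum>z\<in>A. x z * (\<Sum>k\<in>B. f z k * x k))"
    by (simp add: sum_distrib_left mult_ac)
  have "(\<Sum>z\<in>B. \<Sum>k\<in>A. f z k * (x z * x k)) = (\<Sum>k\<in>A. \<Sum>z\<in>B. f z k * (x z * x k))" by (rule sum.swap)
  also have "\<dots> = (\<Sum>z\<in>A. \<Sum>k\<in>B. f z k * (x z * x k))"
    by (intro sum.cong refl) (subst sym, simp)
  finally show ?thesis
    unfolding quad_def using assms(1-3) 1 by (simp add: sum.union_disjoint sum.distrib)
qed

text \<open>The closing estimate for K4^-: \<open>a\<close> is the weight of the apex,
  \<open>p\<close>, \<open>q\<close>, \<open>r\<close> are those of the base and \<open>y\<close> is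
  the rest. Equality holds at \<open>a = 1/3\<close>, \<open>p = q = r = 2/9\<close>,
  \<open>y = 0\<close>; the bound on \<open>a\<close> enters through the factor
  \<open>t - 2/3\<close>.\<close>

lemma cone_inequality:
  fixes a p q r y :: real
  assumes nn: "0 \<le> a" "0 \<le> q" "0 \<le> r" "0 \<le> y" "0 \<le> p" and s: "a + p + q + r + y = 1" and a: "a \<le> 1/3"
  shows "y\<^sup>2 + 2 * (y * (a + p)) + 2 * (2 * a * (p + q + r) + p * q + p * r + q * r) \<le> 32/27"
proof -
  define R where "R = q + r"
  define t where "t = 1 - a"
  have t: "2/3 \<le> t" "t \<le> 1" using a nn by (auto simp: t_def)
  have R: "R \<ge> 0" using nn by (simp add: R_def)
  have "4 * (q * r) \<le> R\<^sup>2"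
  proof -
    have "0 \<le> (q - r)\<^sup>2" by simp
    thus ?thesis by (simp add: R_def power2_eq_square algebra_simps)
  qed
  moreover have p: "p = t - y - R" "a = 1 - t" using s by (auto simp: t_def R_def)
  moreover have "p * q + p * r = p * R" "p + q + r = p + R" by (auto simp: R_def distrib_left)
  ultimately have le: "y\<^sup>2 + 2 * (y * (a + p)) + 2 * (2 * a * (p + q + r) + p * q + p * r + q * r)
      \<le> 2 * (y\<^sup>2 / 2 + y * (a + p) + 2 * a * (p + R) + p * R + R\<^sup>2 / 4)" by (simp add: algebra_simps)
  \<comment> \<open>Here \<open>p\<close> and \<open>a\<close> are eliminated and
    \<open>q * r\<close> is replaced by \<open>R\<^sup>2 / 4\<close>. As a function of
    \<open>R\<close> the maximum is at \<open>2/3 * (t - 2 * y)\<close>, and the cases ask whether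
    this is positive.\<close>
  define F where "F = 2 * t - 2 * t\<^sup>2 - y\<^sup>2 / 2 - y + 2 * t * y + t * R - 2 * y * R - 3/4 * R\<^sup>2"
  have Feq: "y\<^sup>2 / 2 + y * (a + p) + 2 * a * (p + R) + p * R + R\<^sup>2 / 4 = F"
    unfolding p F_def by (simp add: power2_eq_square field_simps)
  have "F \<le> 16/27"
  proof (cases "t / 2 \<le> y")
    case True
    hence "(t - 2 * y) * R \<le> 0" using R by (intro mult_nonpos_nonneg) auto
    moreover have "F = 1/2 - 1/2 * (y - (2 * t - 1))\<^sup>2 + (t - 2 * y) * R - 3/4 * R\<^sup>2"
      unfolding F_def by (simp add: power2_eq_square field_simps)
    moreover have "0 \<le> (y - (2 * t - 1))\<^sup>2" "0 \<le> R\<^sup>2" by simp_all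
    ultimately show ?thesis by linarith
  next
    case False
    have "F = 2 * t - 5/3 * t\<^sup>2 + y * (2/3 * t - 1 + 5/6 * y) - 3/4 * (R - 2/3 * (t - 2 * y))\<^sup>2"
      unfolding F_def by (simp add: power2_eq_square field_simps)
    moreover have "0 \<le> (R - 2/3 * (t - 2 * y))\<^sup>2" by simp
    moreover have "y * (2/3 * t - 1 + 5/6 * y) \<le> y * (13/12 * t - 1)" using False nn by (intro mult_left_mono) auto
    ultimately have F: "F \<le> 2 * t - 5/3 * t\<^sup>2 + y * (13/12 * t - 1)" by linarith
    have Q: "16/27 - (2 * t - 5/3 * t\<^sup>2) = (t - 2/3) * (5/3 * t - 8/9)"
      by (simp add: power2_eq_square field_simps)
    show ?thesis
    proof (cases "t \<le> 12/13")
      case True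
      hence "y * (13/12 * t - 1) \<le> 0" using nn by (intro mult_nonneg_nonpos) auto
      moreover have "0 \<le> (t - 2/3) * (5/3 * t - 8/9)" using t by (intro mult_nonneg_nonneg) auto
      ultimately show ?thesis using F Q by linarith
    next
      case t2: False
      have "y * (13/12 * t - 1) \<le> 1/2 * (1/12)" using False t t2 nn by (intro mult_mono) auto
      moreover have "1/4 * (1/2) \<le> (t - 2/3) * (5/3 * t - 8/9)" using t2 by (intro mult_mono) auto
      ultimately show ?thesis using F Q by linarith
    qed
  qed
  hence "2 * (y\<^sup>2 / 2 + y * (a + p) + 2 * a * (p + R) + p * R + R\<^sup>2 / 4) \<le> 32/27"
    unfolding Feq by linarith
  with le show ?thesis by (rule order_trans)
qed

section \<open>Triple systems\<close>

locale triples =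
  fixes S :: "'a set" and E x \<theta> K
  assumes opt: "opt_weights 3 S E x" and rich: "rich \<theta> K S E"
begin

lemmas o = opt_weightsD[OF opt]

definition m :: "'a \<Rightarrow> 'a \<Rightarrow> 'a \<Rightarrow> real" where "m a b c = of_bool ({a, b, c} \<in> E)"

text \<open>The edge density of the blow-up with proportions \<open>x\<close>; with this factor it
  is also the ordered pair density of every link.\<close>

definition D :: real where "D = 6 * lag E x"

lemma m_swap: "m a b c = m b a c" "m a b c = m a c b" by (simp_all add: m_def insert_commute)

lemma m01: "m a b c = 0 \<or> m a b c = 1" by (simp add: m_def)

lemma m_nonneg: "0 \<le> m a b c" and m_le: "m a b c \<le> 1" by (simp_all add: m_def)

lemma m_edge: "m a b c = 1 \<longleftrightarrow> {a, b, c} \<in> E" by (simp add: m_def)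

lemma edge_mem:
  assumes "{a, b, c} \<in> E"
  shows "a \<in> S" "b \<in> S" "c \<in> S" "a \<noteq> b" "a \<noteq> c" "b \<noteq> c"
proof -
  have e: "{a, b, c} \<subseteq> S" "card {a, b, c} = 3" using edgeD[OF o(2) assms] by auto
  thus "a \<in> S" "b \<in> S" "c \<in> S" by auto
  show "a \<noteq> b" "a \<noteq> c" "b \<noteq> c" using e(2) by (auto simp: card_insert_if split: if_splits)
qed

lemma m_diag: "m a a c = 0" "m a c a = 0" "m c a a = 0"
  using edge_mem[of a a c] edge_mem[of a c a] edge_mem[of c a a] by (auto simp: m_def)

lemma cover:
  assumes "u \<in> S" "v \<in> S" "u \<noteq> v"
  obtains w where "{u, v, w} \<in> E"
proof -
  obtain e where e: "e \<in> E" "u \<in> e" "v \<in> e" using o(6)[OF assms] by blast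
  hence "card (e - {u, v}) = 1" using edgeD[OF o(2) e(1)] assms(3) by (simp add: card_Diff_subset)
  then obtain w where "e - {u, v} = {w}" by (auto simp: card_1_singleton_iff)
  hence "e = {u, v, w}" using e by blast
  thus ?thesis using that e by blast
qed

lemma xpos: "i \<in> S \<Longrightarrow> 0 \<le> x i" using o(3) by (simp add: less_imp_le)

text \<open>By the degree condition each link has Lagrange polynomial \<open>3 * lag E x\<close>;
  ordered pairs double it.\<close>

lemma quad_m: assumes v: "v \<in> S" shows "quad S x (m v) = D"
proof -
  define F where "F = (\<lambda>e. e - {v}) ` {e\<in>E. v \<in> e}"
  have inj: "inj_on (\<lambda>e. e - {v}) {e\<in>E. v \<in> e}" by (auto simp: inj_on_def)
  have F: "F \<subseteq> nsets S 2"
  proof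
    fix f assume "f \<in> F"
    then obtain e where "e \<in> E" "v \<in> e" "f = e - {v}" by (auto simp: F_def)
    thus "f \<in> nsets S 2" using edgeD[OF o(2), of e] by (auto simp: nsets_def)
  qed
  have lF: "lag F x = 3 * lag E x"
    using o(5)[OF v] inj unfolding F_def lag_def dlag_def by (simp add: sum.reindex)
  have mem: "{j, k} \<in> F \<longleftrightarrow> {v, j, k} \<in> E" for j k
  proof
    assume "{j, k} \<in> F"
    then obtain e where e: "e \<in> E" "v \<in> e" "{j, k} = e - {v}" by (auto simp: F_def)
    hence "e = {v, j, k}" by blast
    thus "{v, j, k} \<in> E" using e by simp
  next
    assume vjk: "{v, j, k} \<in> E"
    have "{j, k} = {v, j, k} - {v}" using edge_mem[OF vjk] by auto
    moreover have "{v, j, k} \<in> {e\<in>E. v \<in> e}" using vjk by simp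
    ultimately show "{j, k} \<in> F" unfolding F_def by (rule image_eqI)
  qed
  have dF: "dlag F j x = (\<Sum>k\<in>S. m v j k * x k)" if j: "j \<in> S" for j
  proof -
    have "bij_betw (\<lambda>k. {j, k}) {k\<in>S. {j, k} \<in> F} {e\<in>F. j \<in> e}"
    proof (rule bij_betwI')
      fix k l assume "k \<in> {k\<in>S. {j, k} \<in> F}" "l \<in> {k\<in>S. {j, k} \<in> F}"
      show "({j, k} = {j, l}) = (k = l)" by (auto simp: doubleton_eq_iff)
    next
      fix e assume e: "e \<in> {e\<in>F. j \<in> e}"
      hence "card (e - {j}) = 1" "e \<subseteq> S" using F by (auto simp: nsets_def)
      then obtain k where "e - {j} = {k}" by (auto simp: card_1_singleton_iff)
      hence "e = {j, k}" using e by blast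
      thus "\<exists>k\<in>{k\<in>S. {j, k} \<in> F}. e = {j, k}" using e \<open>e \<subseteq> S\<close> by auto
    qed auto
    hence "dlag F j x = (\<Sum>k\<in>{k\<in>S. {j, k} \<in> F}. prod x ({j, k} - {j}))"
      unfolding dlag_def by (rule sum.reindex_bij_betw[symmetric])
    also have "\<dots> = (\<Sum>k\<in>{k\<in>S. {j, k} \<in> F}. x k)"
    proof (intro sum.cong refl)
      fix k assume "k \<in> {k\<in>S. {j, k} \<in> F}"
      hence "j \<noteq> k" using mem edge_mem by blast
      hence "{j, k} - {j} = {k}" by auto
      thus "prod x ({j, k} - {j}) = x k" by simp
    qed
    also have "\<dots> = (\<Sum>k\<in>S. m v j k * x k)"
      using o(1) by (intro sum.mono_neutral_cong_left) (auto simp: m_def mem)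
    finally show ?thesis .
  qed
  have "quad S x (m v) = (\<Sum>j\<in>S. x j * dlag F j x)"
    unfolding quad_def by (intro sum.cong refl) (simp add: dF sum_distrib_left mult_ac)
  also have "\<dots> = 2 * lag F x" using sum_dlag[OF o(1) F] by simp
  finally show ?thesis by (simp add: lF D_def)
qed

lemma quad_one: "quad S x (\<lambda>_ _. c) = c"
  using o(4) by (simp add: quad_def flip: sum_distrib_left sum_distrib_right)

lemma tri_m: "A \<subseteq> S \<Longrightarrow> tri m x A S S = sum x A * D"
  unfolding tri_quad sum_distrib_right by (intro sum.cong refl) (use quad_m in auto)

lemma indepD: "indep E I \<Longrightarrow> {a, b, c} \<in> E \<Longrightarrow> \<not> (a \<in> I \<and> b \<in> I \<and> c \<in> I)"
  by (auto simp: indep_def)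

text \<open>De Caen's argument relative to the complete graph: without K4 the ordered triple density
  is at most 2/3.\<close>

lemma K4_ex:
  assumes "D > 2 / 3"
  obtains a b c d where "{a,b,c} \<in> E" "{a,b,d} \<in> E" "{a,c,d} \<in> E" "{b,c,d} \<in> E"
proof (rule ccontr)
  assume no: "\<not> thesis"
  have "3 * tri m x S S S \<le> 2 * sum x S * quad S x (\<lambda>_ _. 1)"
  proof (rule deCaen_K4[OF o(1) xpos])
    show "\<And>a b c z. m a b c = 1 \<Longrightarrow> m a b z = 1 \<Longrightarrow> m a c z = 1 \<Longrightarrow> m b c z = 1 \<Longrightarrow> False"
      using no that unfolding m_edge by blast
  qed (use o(4) m01 m_swap in auto)
  moreover have "tri m x S S S = D" using tri_m[of S] o(4) by simp
  ultimately show False using assms o(4) quad_one by simp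
qed

lemma roles:
  assumes "fst ` set ps \<subseteq> S" "0 < sum_list (map snd ps)" "sum_list (map snd ps) \<le> K"
    "real a \<le> \<theta> * real (sum_list (map snd ps))"
    and "\<And>I. indep E I \<Longrightarrow> (\<Sum>(v, c)\<leftarrow>ps. c * of_bool (v \<in> I)) \<le> a"
  shows False
  using rich_roles[OF rich o(1) assms(1-4)] assms(5) by (metis leD)

text \<open>Overlay the links of a K4: a pair lies in \<open>4 * D > 3\<close> of them on average.
  By \<open>quad_removal\<close> with \<open>c = 3\<close> some pair \<open>j\<close>,
  \<open>k\<close> lies in all four, and there is \<open>u\<close> such that the pairs
  \<open>j\<close>, \<open>u\<close> and \<open>k\<close>, \<open>u\<close> miss at most one link in
  total. Of seven unit weights on these vertices an independent set gets at most 3.\<close>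

lemma density_two_parts:
  assumes \<theta>: "3/7 \<le> \<theta>" and K: "7 \<le> K"
  shows "D \<le> 3/4"
proof (rule ccontr)
  assume "\<not> ?thesis"
  hence D: "D > 3/4" by simp
  obtain a b c d where K4: "{a,b,c} \<in> E" "{a,b,d} \<in> E" "{a,c,d} \<in> E" "{b,c,d} \<in> E"
    by (rule K4_ex) (use D in auto)
  define f where "f = (\<lambda>j k. (m a j k + m b j k) + (m c j k + m d j k))"
  have abcd: "a \<in> S" "b \<in> S" "c \<in> S" "d \<in> S" using edge_mem K4 by auto
  have "quad S x f = 4 * D" unfolding f_def by (simp add: quad_add quad_m abcd)
  hence "\<not> quad S x f \<le> 3 * (sum x S)\<^sup>2" using D o(4) by simp
  moreover have "f j k \<le> 4" for j k using m_le[of a j k] m_le[of b j k] m_le[of c j k] m_le[of d j k] by (simp add: f_def)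
  ultimately obtain j k u where jku: "f j k > 3" "f j u + f k u > 6" "j \<in> S" "k \<in> S" "u \<in> S"
    using quad_removal[OF o(1), of 3 f x] xpos by (force simp: f_def m_diag m_swap(2)[of _ _ _])
  have all: "{s, j, k} \<in> E" if "s \<in> {a, b, c, d}" for s
    using jku(1) that m01[of a j k] m01[of b j k] m01[of c j k] m01[of d j k] unfolding f_def m_edge[symmetric] by auto
  have two: "{s, i, u} \<in> E \<or> {t, i, u} \<in> E" if "s \<in> {a, b, c, d}" "t \<in> {a, b, c, d}" "s \<noteq> t" "i \<in> {j, k}" for s t i
  proof (rule ccontr)
    assume "\<not> ?thesis"
    hence z: "m s i u = 0" "m t i u = 0" by (auto simp: m_def)
    have L: "m a i' u \<le> 1" "m b i' u \<le> 1" "m c i' u \<le> 1" "m d i' u \<le> 1" for i' by (rule m_le)+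
    show False using that z jku(2) L[of j] L[of k] unfolding f_def by (elim insertE emptyE) simp_all
  qed
  have ne: "a \<noteq> b" "a \<noteq> c" "a \<noteq> d" "b \<noteq> c" "b \<noteq> d" "c \<noteq> d" using K4 edge_mem by auto
  show False
  proof (rule roles[of "[(a,1),(b,1),(c,1),(d,1),(j,1),(k,1),(u,1)]" 3])
    fix I assume "indep E I"
    note I = indepD[OF this]
    have A: "\<not> (s \<in> I \<and> j \<in> I \<and> k \<in> I)" if "s \<in> {a,b,c,d}" for s using I[OF all[OF that]] .
    have B: "\<not> (s \<in> I \<and> t \<in> I \<and> i \<in> I \<and> u \<in> I)"
      if "s \<in> {a, b, c, d}" "t \<in> {a, b, c, d}" "s \<noteq> t" "i \<in> {j, k}" for s t i
      using two[OF that] I[of s i u] I[of t i u] by blast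
    define X where "X = of_bool (a \<in> I) + of_bool (b \<in> I) + of_bool (c \<in> I) + (of_bool (d \<in> I) :: nat)"
    have X2: "X \<le> 2"
      using K4[THEN I] unfolding X_def by (cases "a \<in> I"; cases "b \<in> I"; cases "c \<in> I"; cases "d \<in> I"; simp)
    have X0: "X = 0" if "j \<in> I" "k \<in> I"
      using A[of a] A[of b] A[of c] A[of d] that by (simp add: X_def)
    have X1: "X \<le> 1" if "i \<in> I" "u \<in> I" "i \<in> {j, k}" for i
      using B[of a b i] B[of a c i] B[of a d i] B[of b c i] B[of b d i] B[of c d i] ne that(1,2) that(3)
      unfolding X_def by (cases "a \<in> I"; cases "b \<in> I"; cases "c \<in> I"; cases "d \<in> I"; simp)
    \<comment> \<open>Of the K4, \<open>I\<close> has at most two vertices, at most one together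
      with \<open>u\<close> and one of \<open>j\<close>, \<open>k\<close>, and none together with
      both \<open>j\<close> and \<open>k\<close>.\<close>
    have "X + of_bool (j \<in> I) + of_bool (k \<in> I) + of_bool (u \<in> I) \<le> 3"
      using X2 X0 X1[of j] X1[of k] by (cases "j \<in> I"; cases "k \<in> I"; cases "u \<in> I"; simp)
    thus "(\<Sum>(v, c)\<leftarrow>[(a,1),(b,1),(c,1),(d,1),(j,1),(k,1),(u,1)]. c * of_bool (v \<in> I)) \<le> (3::nat)"
      by (simp add: X_def)
  qed (use abcd jku \<theta> K in auto)
qed

text \<open>Pairs in more than four of the six links form a graph; if it had no clique of size 4,
  Turan's bound 2/3 would give \<open>6 * D \<le> 4 + 2 * 2/3\<close>. Weights 3 on the K6 and 1 on
  that clique have total 22, and an independent set gets at most 7, as \<open>3 + 4\<close> or as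
  \<open>6 + 1\<close>.\<close>

lemma density_three_parts:
  assumes \<theta>: "7/22 \<le> \<theta>" and K: "22 \<le> K"
    and b: "\<And>i j k. i < j \<Longrightarrow> j < k \<Longrightarrow> k < (6::nat) \<Longrightarrow> {b i, b j, b k} \<in> E"
  shows "D \<le> 8/9"
proof (rule ccontr)
  assume "\<not> ?thesis"
  hence D: "D > 8/9" by simp
  have bS: "b i \<in> S" if "i < 6" for i
  proof -
    have "i < 4 \<or> i = 4 \<or> i = 5" using that by auto
    thus ?thesis using edge_mem(1)[OF b[of i 4 5]] edge_mem(2)[OF b[of 0 4 5]] edge_mem(3)[OF b[of 0 4 5]] by auto
  qed
  have bne: "b i \<noteq> b j" if "i < j" "j < 6" for i j
  proof (cases "j = 5")
    case True
    show ?thesis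
    proof (cases "i = 4")
      case True thus ?thesis using \<open>j = 5\<close> edge_mem(6)[OF b[of 0 4 5]] by simp
    next
      case False thus ?thesis using \<open>j = 5\<close> that edge_mem(5)[OF b[of i 4 5]] by simp
    qed
  next
    case False thus ?thesis using that edge_mem(4)[OF b[of i j 5]] by simp
  qed
  define B where "B = b ` {..<6}"
  have inj: "inj_on b {..<6}" using bne by (intro inj_onI) (metis lessThan_iff linorder_neqE_nat)
  have B: "B \<subseteq> S" "finite B" "card B = 6" using bS inj by (auto simp: B_def card_image)
  have clique: "{p, q, r} \<in> E" if pqr: "p \<in> B" "q \<in> B" "r \<in> B" "p \<noteq> q" "p \<noteq> r" "q \<noteq> r" for p q r
  proof -
    obtain i where i: "p = b i" "i < 6" using pqr(1) unfolding B_def by blast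
    obtain j where j: "q = b j" "j < 6" using pqr(2) unfolding B_def by blast
    obtain k where k: "r = b k" "k < 6" using pqr(3) unfolding B_def by blast
    note ijk = i j k
    have "i \<noteq> j" "i \<noteq> k" "j \<noteq> k" using pqr ijk by auto
    then consider "i < j" "j < k" | "i < k" "k < j" | "j < i" "i < k" | "j < k" "k < i" | "k < i" "i < j" | "k < j" "j < i"
      by linarith
    thus ?thesis
      using b[of i j k] b[of i k j] b[of j i k] b[of j k i] b[of k i j] b[of k j i] ijk
      by cases (simp_all add: insert_commute)
  qed
  define f where "f = (\<lambda>j k. \<Sum>s\<in>B. m s j k)"
  define g where "g = (\<lambda>j k. f j k > 4)"
  have f6: "f j k \<le> 6" for j k using sum_mono[of B "\<lambda>s. m s j k" "\<lambda>_. 1"] m_le B by (simp add: f_def)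
  have qf: "quad S x f = 6 * D"
  proof -
    have "quad S x f = (\<Sum>j\<in>S. \<Sum>s\<in>B. \<Sum>k\<in>S. m s j k * (x j * x k))"
      unfolding quad_def f_def sum_distrib_right by (intro sum.cong refl sum.swap)
    also have "\<dots> = (\<Sum>s\<in>B. quad S x (m s))" unfolding quad_def by (rule sum.swap)
    also have "\<dots> = (\<Sum>s\<in>B. D)" using B quad_m by (intro sum.cong) auto
    finally show ?thesis using B by simp
  qed
  have "\<exists>C\<subseteq>S. card C = 4 \<and> (\<forall>i\<in>C. \<forall>j\<in>C. i \<noteq> j \<longrightarrow> g i j)"
  proof (rule ccontr)
    assume no: "\<not> ?thesis"
    have "real 3 * quad S x (\<lambda>j k. of_bool (g j k)) \<le> (real 3 - 1) * (sum x S)\<^sup>2"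
    proof (rule quad_turan[OF o(1)])
      fix C assume "C \<subseteq> S" "card C = 3 + 1"
      thus "\<exists>i\<in>C. \<exists>j\<in>C. i \<noteq> j \<and> \<not> g i j" using no by auto
    qed (use xpos in \<open>auto simp: g_def f_def m_diag m_swap(2)\<close>)
    hence t: "quad S x (\<lambda>j k. of_bool (g j k)) \<le> 2/3" using o(4) by simp
    have "quad S x f \<le> quad S x (\<lambda>j k. 4 + 2 * of_bool (g j k))"
      unfolding quad_def
    proof (intro sum_mono mult_right_mono)
      fix j k assume "j \<in> S" "k \<in> S"
      thus "0 \<le> x j * x k" using xpos by simp
      show "f j k \<le> 4 + 2 * of_bool (g j k)" using f6[of j k] by (auto simp: g_def)
    qed
    also have "\<dots> = 4 + 2 * quad S x (\<lambda>j k. of_bool (g j k))"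
      using quad_one[of 4] unfolding quad_add by (simp add: quad_def sum_distrib_left mult_ac)
    finally show False using t qf D by simp
  qed
  then obtain C where C: "C \<subseteq> S" "card C = 4" "\<And>i j. i \<in> C \<Longrightarrow> j \<in> C \<Longrightarrow> i \<noteq> j \<Longrightarrow> g i j" by blast
  have fC: "finite C" using C(2) by (metis card.infinite zero_neq_numeral)
  define w where "w = (\<lambda>u. 3 * of_bool (u \<in> B) + of_bool (u \<in> C) :: nat)"
  have sw: "sum w A = 3 * card (A \<inter> B) + card (A \<inter> C)" if "finite A" for A
    unfolding w_def by (simp only: sum.distrib sum_of_bool_mem[OF that] of_nat_id flip: sum_distrib_left)
  have t: "sum w S = 22" using sw[OF o(1)] B C by (simp add: Int_absorb1)
  obtain I where I: "I \<subseteq> S" "indep E I" "\<theta> * real (sum w S) < real (sum w I)"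
    using rich[unfolded rich_def, rule_format, of w] t K by auto
  have fI: "finite I" using I(1) o(1) finite_subset by blast
  have I3: "{p, q, r} \<in> E \<Longrightarrow> \<not> (p \<in> I \<and> q \<in> I \<and> r \<in> I)" for p q r using I(2) by (auto simp: indep_def)
  have le4: "card (I \<inter> C) \<le> 4" using card_mono[OF fC, of "I \<inter> C"] C(2) by simp
  have b2: "card (I \<inter> B) \<le> 2"
  proof (rule ccontr)
    assume "\<not> ?thesis"
    hence "Suc (Suc (Suc 0)) \<le> card (I \<inter> B)" by simp
    then obtain p q r where "p \<in> I \<inter> B" "q \<in> I \<inter> B" "r \<in> I \<inter> B" "p \<noteq> q" "p \<noteq> r" "q \<noteq> r"
      by (auto simp: card_le_Suc_iff)
    thus False using clique[of p q r] I3[of p q r] by blast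
  qed
  have "sum w I \<le> 7"
  proof (cases "card (I \<inter> B) \<le> 1")
    case True
    thus ?thesis using sw[OF fI] le4 by simp
  next
    case False
    hence "Suc (Suc 0) \<le> card (I \<inter> B)" by simp
    then obtain p q where pq: "p \<in> I \<inter> B" "q \<in> I \<inter> B" "p \<noteq> q" by (auto simp: card_le_Suc_iff)
    \<comment> \<open>A pair of \<open>C\<close> misses at most one of the six links, so it forms an
      edge with \<open>p\<close> or with \<open>q\<close>.\<close>
    have "card (I \<inter> C) \<le> 1"
    proof (rule ccontr)
      assume "\<not> ?thesis"
      hence "Suc (Suc 0) \<le> card (I \<inter> C)" by simp
      then obtain j k where jk: "j \<in> I \<inter> C" "k \<in> I \<inter> C" "j \<noteq> k" by (auto simp: card_le_Suc_iff)
      have z: "m p j k = 0" "m q j k = 0" using I3[of p j k] I3[of q j k] pq jk m01 m_edge by blast+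
      have "f j k = (\<Sum>s\<in>B - {p, q}. m s j k)"
        unfolding f_def using B z by (intro sum.mono_neutral_right) auto
      also have "\<dots> \<le> (\<Sum>s\<in>B - {p, q}. 1)" by (intro sum_mono m_le)
      also have "\<dots> = 4" using B pq by (simp add: card_Diff_subset)
      finally show False using C(3)[of j k] jk by (simp add: g_def)
    qed
    thus ?thesis using sw[OF fI] b2 by simp
  qed
  hence "real (sum w I) \<le> 7" by (simp only: of_nat_le_numeral_iff)
  thus False using I(3) \<theta> unfolding t by simp
qed

text \<open>Without K4^- all links are triangle-free. With \<open>s\<close> the weight of
  \<open>I\<close>, twice the degree sum over \<open>I\<close> minus the one over the complement
  shows that \<open>(3 * s - 1) * D\<close> is at most three times
  \<open>tri m x (S - I) I I\<close>, which Mantel's theorem inside \<open>I\<close> bounds by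
  \<open>(1 - s) * s\<^sup>2 / 2\<close>. At \<open>s = 4/7\<close> this reads
  \<open>D \<le> 72/245\<close>.\<close>

lemma indep_weight_le:
  assumes no: "\<And>v a b c. {v,a,b} \<in> E \<Longrightarrow> {v,a,c} \<in> E \<Longrightarrow> {v,b,c} \<in> E \<Longrightarrow> False"
    and D: "D > 72/245" and I: "I \<subseteq> S" "indep E I"
  shows "sum x I \<le> 4/7"
proof (rule ccontr)
  define s where "s = sum x I"
  assume "\<not> ?thesis"
  hence s: "s > 4/7" by (simp add: s_def)
  define C where "C = S - I"
  have fin: "finite I" "finite C" "I \<inter> C = {}" "C \<inter> I = {}" "S = I \<union> C" "S = C \<union> I"
    using I(1) o(1) finite_subset by (auto simp: C_def)
  have sC: "sum x C = 1 - s" unfolding C_def s_def using o(4) I(1) o(1) fin(1) by (simp add: sum_diff)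
  have x0: "\<And>i. i \<in> I \<Longrightarrow> 0 \<le> x i" "\<And>i. i \<in> C \<Longrightarrow> 0 \<le> x i" using xpos I(1) by (auto simp: C_def)
  have "tri m x I S S = s * D" using tri_m[OF I(1)] by (simp add: s_def)
  moreover have "tri m x I S S = tri m x I I I + 2 * tri m x I I C + tri m x I C C"
    unfolding fin(5) by (rule tri_split[OF m_swap fin(1-3)])
  moreover have "tri m x I I I = 0"
    unfolding tri_def
  proof (intro sum.neutral ballI)
    fix a b c assume "a \<in> I" "b \<in> I" "c \<in> I"
    thus "m a b c * (x a * x b * x c) = 0" using indepD[OF I(2), of a b c] by (auto simp: m_def)
  qed
  moreover have "tri m x C S S = (1 - s) * D" using tri_m[of C] sC by (simp add: C_def)
  moreover have "tri m x C S S = tri m x C C C + 2 * tri m x C C I + tri m x C I I"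
    unfolding fin(6) by (rule tri_split[OF m_swap fin(2,1,4)])
  moreover have "tri m x C C I = tri m x I C C"
    by (rule trans[OF tri_swap(2)[OF m_swap] tri_swap(1)[OF m_swap]])
  moreover have "tri m x I I C = tri m x C I I"
    by (rule trans[OF tri_swap(2)[OF m_swap] tri_swap(1)[OF m_swap]])
  moreover have "0 \<le> tri m x C C C" using m_nonneg x0 by (intro tri_nonneg) auto
  ultimately have "(3 * s - 1) * D \<le> 3 * tri m x C I I" by (simp add: algebra_simps)
  also have "tri m x C I I \<le> (\<Sum>v\<in>C. x v * (s\<^sup>2 / 2))"
    unfolding tri_quad
  proof (intro sum_mono mult_left_mono x0(2))
    fix v assume "v \<in> C"
    have "real 2 * quad I x (\<lambda>j k. of_bool ({v, j, k} \<in> E)) \<le> (real 2 - 1) * (sum x I)\<^sup>2"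
    proof (rule quad_turan[OF fin(1)])
      fix T assume "T \<subseteq> I" "card T = 2 + 1"
      then obtain i j k where "T = {i, j, k}" "i \<noteq> j" "i \<noteq> k" "j \<noteq> k" by (auto simp: card_Suc_eq numeral_2_eq_2)
      thus "\<exists>i\<in>T. \<exists>j\<in>T. i \<noteq> j \<and> {v, i, j} \<notin> E" using no[of v i j k] by blast
    qed (use x0 m_diag in \<open>auto simp: insert_commute m_def\<close>)
    thus "quad I x (m v) \<le> s\<^sup>2 / 2" by (simp add: m_def[abs_def] s_def)
  qed
  also have "\<dots> = sum x C * (s\<^sup>2 / 2)" by (simp only: sum_distrib_right)
  also have "\<dots> = (1 - s) * s\<^sup>2 / 2" by (simp add: sC)
  finally have "(3 * s - 1) * D \<le> 3 * ((1 - s) * s\<^sup>2 / 2)" by simp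
  also have "3 * ((1 - s) * s\<^sup>2 / 2) = 3 / 2 * (1 - s) * s\<^sup>2" by simp
  finally have A: "(3 * s - 1) * D \<le> 3 / 2 * (1 - s) * s\<^sup>2" .
  have "(3 * s - 1) * (72/245) < (3 * s - 1) * D" using D s by (intro mult_strict_left_mono) auto
  with A have "(3 * s - 1) * (72/245) < 3 / 2 * (1 - s) * s\<^sup>2" by linarith
  moreover have "3 / 2 * (1 - s) * s\<^sup>2 \<le> (3 * s - 1) * (72/245)"
  proof -
    \<comment> \<open>Expanding at 4/7 leaves no constant term and only positive
      coefficients.\<close>
    define e where "e = s - 4/7"
    have e: "e \<ge> 0" "s = 4/7 + e" using s by (auto simp: e_def)
    have "(3 * s - 1) * (72/245) - 3 / 2 * (1 - s) * s\<^sup>2 = (216/245 - 12/49) * e + 15/14 * e\<^sup>2 + 3/2 * e ^ 3"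
      unfolding e(2) by (simp add: power2_eq_square power3_eq_cube algebra_simps)
    also have "\<dots> \<ge> 0" using e(1) by simp
    finally show ?thesis by simp
  qed
  ultimately show False by linarith
qed

section \<open>Forcing a K6 by counting missing triples\<close>

definition h :: "'a \<Rightarrow> 'a \<Rightarrow> 'a \<Rightarrow> real" where "h a b c = 1 - m a b c"

lemma h_swap: "h a b c = h b a c" "h a b c = h a c b" using m_swap[of a b c] by (simp_all add: h_def)

lemma h_nonneg: "0 \<le> h a b c" by (simp add: h_def m_le)

lemma tri_h: "A \<subseteq> S \<Longrightarrow> tri h x A S S = sum x A * (1 - D)"
proof -
  assume A: "A \<subseteq> S"
  have "tri h x A S S = tri (\<lambda>_ _ _. 1) x A S S - tri m x A S S"
    unfolding h_def[abs_def] by (rule tri_diff)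
  moreover have "tri (\<lambda>_ _ _. 1) x A S S = sum x A"
    unfolding tri_quad using o(4) by (simp add: quad_const)
  ultimately show ?thesis using tri_m[OF A] by (simp add: algebra_simps)
qed

text \<open>Among the \<open>z\<close> with \<open>{u, u', z}\<close> an edge, take the edges whose
  pairs all lie in both links. Four vertices spanning all triples there would complete a K6 with
  \<open>u\<close> and \<open>u'\<close>, so De Caen's argument relative to the graph of common
  pairs applies; the right side collects what is missing. For \<open>u = u'\<close> no
  \<open>z\<close> qualifies and the bound is trivial.\<close>

lemma K6_step:
  assumes no: "\<nexists>b :: nat \<Rightarrow> 'a. \<forall>i j k. i < j \<longrightarrow> j < k \<longrightarrow> k < 6 \<longrightarrow> {b i, b j, b k} \<in> E"
    and W: "W \<subseteq> S"
  shows "(sum x W) ^ 3 \<le> 3 * (sum x W)\<^sup>2 * (\<Sum>z\<in>W. h u u' z * x z)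
      + 7 * sum x W * (quad W x (h u) + quad W x (h u')) + 3 * tri h x W W W"
proof -
  define w where "w = sum x W"
  define W' where "W' = {z\<in>W. {u, u', z} \<in> E}"
  define w' where "w' = sum x W'"
  define \<delta> where "\<delta> = (\<Sum>z\<in>W. h u u' z * x z)"
  define G where "G = (\<lambda>j k. {u, j, k} \<in> E \<and> {u', j, k} \<in> E)"
  define g where "g = (\<lambda>j k. of_bool (G j k) :: real)"
  define q where "q = (\<lambda>j k. 1 - g j k)"
  define t where "t = (\<lambda>a b c. of_bool ({a, b, c} \<in> E \<and> G a b \<and> G a c \<and> G b c) :: real)"
  define B where "B = quad W x (h u) + quad W x (h u')"
  have fW: "finite W" "W' \<subseteq> W" "finite W'" using finite_subset[OF W o(1)] by (auto simp: W'_def)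
  have xW: "\<And>i. i \<in> W \<Longrightarrow> 0 \<le> x i" using xpos W by auto
  hence xW': "\<And>i. i \<in> W' \<Longrightarrow> 0 \<le> x i" using fW(2) by auto
  have Gs: "G j k = G k j" for j k by (simp add: G_def insert_commute)
  have w0: "0 \<le> w'" "0 \<le> w" unfolding w_def w'_def using xW xW' by (auto intro!: sum_nonneg)
  have "\<delta> = (\<Sum>z\<in>W. x z - (if z \<in> W' then x z else 0))"
    unfolding \<delta>_def by (intro sum.cong refl) (auto simp: h_def m_def W'_def)
  hence w': "w' = w - \<delta>" using fW by (simp add: sum_subtractf w_def w'_def sum.If_cases Int_absorb1)
  have \<delta>0: "0 \<le> \<delta>" unfolding \<delta>_def using xW h_nonneg by (intro sum_nonneg mult_nonneg_nonneg) auto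
  have B0: "0 \<le> B" unfolding B_def using xW h_nonneg by (intro add_nonneg_nonneg quad_nonneg) auto
  have H0: "0 \<le> tri h x W W W" using xW h_nonneg by (intro tri_nonneg) auto
  have "w' ^ 3 \<le> 7 * w * B + 3 * tri h x W W W"
  proof (cases "w' = 0")
    case True
    thus ?thesis using w0 B0 H0 by simp
  next
    case False
    hence pos: "sum x W' > 0" using w0 by (simp add: w'_def)
    have "3 * tri t x W' W' W' \<le> 2 * sum x W' * quad W' x g"
    proof (rule deCaen_K4[OF fW(3) xW' pos])
      fix a b c z assume "a \<in> W'" "b \<in> W'" "c \<in> W'" "z \<in> W'" "t a b c = 1" "t a b z = 1" "t a c z = 1" "t b c z = 1"
      hence *: "{a,b,c} \<in> E" "{a,b,z} \<in> E" "{a,c,z} \<in> E" "{b,c,z} \<in> E" "{u,u',a} \<in> E" "{u,u',b} \<in> E" "{u,u',c} \<in> E"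
        "{u,u',z} \<in> E" "G a b" "G a c" "G a z" "G b c" "G b z" "G c z"
        by (auto simp: t_def W'_def)
      have "\<forall>i j k. i < j \<longrightarrow> j < k \<longrightarrow> k < 6 \<longrightarrow> {[u,u',a,b,c,z] ! i, [u,u',a,b,c,z] ! j, [u,u',a,b,c,z] ! k} \<in> E"
      proof (intro allI impI)
        fix i j k :: nat assume "i < j" "j < k" "k < 6"
        hence "(i,j,k) \<in> {(0,1,2),(0,1,3),(0,1,4),(0,1,5),(0,2,3),(0,2,4),(0,2,5),(0,3,4),(0,3,5),(0,4,5),
            (1,2,3),(1,2,4),(1,2,5),(1,3,4),(1,3,5),(1,4,5),(2,3,4),(2,3,5),(2,4,5),(3,4,5)}"
          by simp presburger
        thus "{[u,u',a,b,c,z] ! i, [u,u',a,b,c,z] ! j, [u,u',a,b,c,z] ! k} \<in> E"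
          using * by (elim insertE emptyE) (simp_all add: G_def)
      qed
      thus False using no by blast
    next
      show "\<And>a b c. t a b c = t b a c" "\<And>a b c. t a b c = t a c b"
        using Gs by (auto simp: t_def insert_commute)
    qed (auto simp: t_def g_def)
    hence T: "3 * tri t x W' W' W' \<le> 2 * w' * quad W' x g" by (simp add: w'_def)
    \<comment> \<open>Union bound: a triple not counted by \<open>t\<close> is missing from
      \<open>E\<close> or has a pair outside \<open>G\<close>.\<close>
    have "tri (\<lambda>a b c. 1 - h a b c - q a b - q a c - q b c) x W' W' W' \<le> tri t x W' W' W'"
      using xW' by (intro tri_mono) (auto simp: h_def m_def q_def g_def t_def)
    moreover have "tri (\<lambda>a b c. 1 - h a b c - q a b - q a c - q b c) x W' W' W'
        = w' ^ 3 - tri h x W' W' W' - 3 * (w' * quad W' x q)"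
      by (simp add: tri_diff tri_pairs w'_def tri_pairs(1)[of "\<lambda>_ _. 1"] quad_const power2_eq_square power3_eq_cube)
    moreover have "quad W' x g = w'\<^sup>2 - quad W' x q"
      unfolding q_def using quad_add[of W' x "\<lambda>j k. 1 - g j k" g] quad_const[of W' x 1] by (simp add: w'_def)
    ultimately have "3 * (w' ^ 3 - tri h x W' W' W' - 3 * (w' * quad W' x q)) \<le> 2 * w' * (w'\<^sup>2 - quad W' x q)"
      using T by (smt (verit))
    \<comment> \<open>The 7 is 9, from the three pairs of a triple, minus 2, from the pairs that
      \<open>G\<close> lacks in De Caen's bound.\<close>
    hence 1: "w' ^ 3 \<le> 7 * (w' * quad W' x q) + 3 * tri h x W' W' W'"
      by (simp add: algebra_simps power2_eq_square power3_eq_cube)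
    have "quad W' x q \<le> quad W' x (\<lambda>j k. h u j k + h u' j k)"
      using xW' by (intro quad_mono) (auto simp: q_def g_def G_def h_def m_def)
    also have "\<dots> \<le> B"
      unfolding quad_add B_def using fW xW h_nonneg by (intro add_mono quad_subset) auto
    finally have "w' * quad W' x q \<le> w * B"
      using w0 w' \<delta>0 xW' by (intro mult_mono) (auto intro!: quad_nonneg simp: q_def g_def)
    moreover have "tri h x W' W' W' \<le> tri h x W W W"
      using fW xW h_nonneg by (intro tri_subset) auto
    ultimately show ?thesis using 1 by linarith
  qed
  moreover have "w ^ 3 - 3 * w\<^sup>2 * \<delta> \<le> w' ^ 3"
  proof -
    have "w' ^ 3 - (w ^ 3 - 3 * w\<^sup>2 * \<delta>) = \<delta>\<^sup>2 * (2 * w + w')"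
      unfolding w' by (simp add: power2_eq_square power3_eq_cube algebra_simps)
    also have "\<dots> \<ge> 0" using w0 by simp
    finally show ?thesis by simp
  qed
  ultimately show ?thesis unfolding w_def[symmetric] \<delta>_def[symmetric] B_def[symmetric] by linarith
qed

text \<open>\<open>K6_step\<close> is averaged over \<open>u\<close>, \<open>u'\<close> in
  \<open>I\<close>. With \<open>A\<close>, \<open>B\<close>, \<open>H\<close> the missing triples
  having two, one, no vertices in \<open>I\<close>, the degree conditions of \<open>I\<close> and of
  its complement eliminate \<open>H\<close> and fix \<open>2 * A + B\<close>. The remaining
  inequality in \<open>s\<close> fails from 7/22 up to the largest weight an independent set can
  have at this density.\<close>

lemma K6_ex:
  assumes D: "D \<ge> 8886/10000" and I: "I \<subseteq> S" "indep E I" "sum x I > 7/22"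
  shows "\<exists>b :: nat \<Rightarrow> 'a. \<forall>i j k. i < j \<longrightarrow> j < k \<longrightarrow> k < 6 \<longrightarrow> {b i, b j, b k} \<in> E"
proof (rule ccontr)
  assume no: "\<not> ?thesis"
  define s where "s = sum x I"
  define W where "W = S - I"
  define w where "w = sum x W"
  define \<eta> where "\<eta> = 1 - D"
  have \<eta>: "\<eta> \<le> 1114/10000" using D by (simp add: \<eta>_def)
  have fin: "finite I" "finite W" "I \<inter> W = {}" "W \<inter> I = {}" "S = I \<union> W" "S = W \<union> I"
    using I(1) o(1) finite_subset by (auto simp: W_def)
  have w: "w = 1 - s" unfolding w_def W_def s_def using o(4) I(1) o(1) fin(1) by (simp add: sum_diff)
  have x0: "\<And>i. i \<in> I \<Longrightarrow> 0 \<le> x i" "\<And>i. i \<in> W \<Longrightarrow> 0 \<le> x i" using xpos I(1) by (auto simp: W_def)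
  have s: "s > 7/22" using I(3) by (simp add: s_def)
  have w0: "w \<ge> 0" unfolding w_def using x0 by (intro sum_nonneg)
  define A where "A = tri h x I I W"
  define B where "B = tri h x I W W"
  define H where "H = tri h x W W W"
  have nn: "A \<ge> 0" "B \<ge> 0" unfolding A_def B_def using h_nonneg x0 by (auto intro!: tri_nonneg)
  \<comment> \<open>Degenerate triples count as missing for \<open>h\<close>, so every ordered
    triple of \<open>I\<close> does.\<close>
  have "tri h x I I I = tri (\<lambda>_ _ _. 1) x I I I"
    unfolding tri_def
  proof (intro sum.cong refl)
    fix a b c assume "a \<in> I" "b \<in> I" "c \<in> I"
    thus "h a b c * (x a * x b * x c) = 1 * (x a * x b * x c)"
      using indepD[OF I(2), of a b c] by (auto simp: h_def m_def)
  qed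
  also have "\<dots> = s ^ 3" by (simp add: tri_quad quad_const s_def power2_eq_square power3_eq_cube flip: sum_distrib_right)
  finally have III: "tri h x I I I = s ^ 3" .
  have "tri h x I S S = tri h x I I I + 2 * tri h x I I W + tri h x I W W"
    unfolding fin(5) by (rule tri_split[OF h_swap fin(1-3)])
  hence e1: "s * \<eta> = s ^ 3 + 2 * A + B" using tri_h[OF I(1)] III by (simp add: s_def \<eta>_def A_def B_def)
  have "tri h x W S S = tri h x W W W + 2 * tri h x W W I + tri h x W I I"
    unfolding fin(6) by (rule tri_split[OF h_swap fin(2,1,4)])
  moreover have "tri h x W W I = B"
    unfolding B_def by (rule trans[OF tri_swap(2)[OF h_swap] tri_swap(1)[OF h_swap]])
  moreover have "tri h x W I I = A"
    unfolding A_def by (rule trans[OF tri_swap(1)[OF h_swap] tri_swap(2)[OF h_swap]])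
  ultimately have e2: "w * \<eta> = H + 2 * B + A" using tri_h[of W] by (simp add: w_def \<eta>_def H_def W_def)
  define dl where "dl = (\<lambda>u u'. \<Sum>z\<in>W. h u u' z * x z)"
  have "(\<Sum>u\<in>I. \<Sum>u'\<in>I. x u * x u' * w ^ 3)
      \<le> (\<Sum>u\<in>I. \<Sum>u'\<in>I. x u * x u' * (3 * w\<^sup>2 * dl u u'
          + 7 * w * (quad W x (h u) + quad W x (h u')) + 3 * H))"
    unfolding w_def H_def dl_def using x0(1) no
    by (intro sum_mono mult_left_mono K6_step mult_nonneg_nonneg) (auto simp: W_def)
  also have "\<dots> = 3 * w\<^sup>2 * (\<Sum>u\<in>I. \<Sum>u'\<in>I. x u * x u' * dl u u')
      + 7 * w * ((\<Sum>u\<in>I. \<Sum>u'\<in>I. x u * x u' * quad W x (h u)) + (\<Sum>u\<in>I. \<Sum>u'\<in>I. x u * x u' * quad W x (h u')))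
      + 3 * H * (\<Sum>u\<in>I. \<Sum>u'\<in>I. x u * x u')"
    unfolding sum_distrib_left sum.distrib[symmetric] by (intro sum.cong refl) (simp add: algebra_simps)
  also have "(\<Sum>u\<in>I. \<Sum>u'\<in>I. x u * x u' * dl u u') = A"
    unfolding A_def tri_def dl_def sum_distrib_left by (intro sum.cong refl) (simp add: mult_ac)
  also have "(\<Sum>u\<in>I. \<Sum>u'\<in>I. x u * x u' * quad W x (h u)) = s * B"
    unfolding B_def tri_quad s_def by (simp add: sum_product mult_ac, subst sum.swap, simp add: mult_ac)
  also have "(\<Sum>u\<in>I. \<Sum>u'\<in>I. x u * x u' * quad W x (h u')) = s * B"
    unfolding B_def tri_quad s_def by (simp add: sum_product mult_ac)
  also have "(\<Sum>u\<in>I. \<Sum>u'\<in>I. x u * x u') = s\<^sup>2" by (simp add: sum_times_sum s_def power2_eq_square)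
  also have "(\<Sum>u\<in>I. \<Sum>u'\<in>I. x u * x u' * w ^ 3) = s\<^sup>2 * w ^ 3"
    by (simp add: s_def power2_eq_square sum_product flip: sum_distrib_right)
  finally have "s\<^sup>2 * w ^ 3 \<le> 3 * w\<^sup>2 * A + 7 * w * (s * B + s * B) + 3 * H * s\<^sup>2" .
  also have "H = w * \<eta> - 2 * B - A" using e2 by simp
  finally have main: "s\<^sup>2 * w ^ 3 \<le> 3 * s\<^sup>2 * (w * \<eta>) + (3 * w\<^sup>2 - 3 * s\<^sup>2) * A + (14 * w * s - 6 * s\<^sup>2) * B"
    by (simp add: algebra_simps)
  have s2: "s\<^sup>2 \<le> \<eta>"
  proof -
    have "s * s\<^sup>2 \<le> s * \<eta>" using e1 nn by (simp add: power2_eq_square power3_eq_cube)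
    thus ?thesis using s by simp
  qed
  \<comment> \<open>A vertex of \<open>I\<close> misses pairs of weight at least
    \<open>s\<^sup>2\<close>, so \<open>s\<close> is at most about 1/3 when \<open>D\<close> is near
    8/9.\<close>
  have s3: "s \<le> 1/3 + 1/1000"
  proof (rule ccontr)
    assume "\<not> ?thesis"
    hence "(1/3 + 1/1000)\<^sup>2 \<le> s\<^sup>2" by (intro power_mono) auto
    thus False using s2 \<eta> by (simp add: power2_eq_square)
  qed
  \<comment> \<open>Only the combination \<open>2 * A + B\<close> is known; the coefficient of
    \<open>A\<close> is at most twice that of \<open>B\<close>.\<close>
  have "(3 * w\<^sup>2 - 3 * s\<^sup>2) * A \<le> (14 * w * s - 6 * s\<^sup>2) * (2 * A)"
  proof -
    have "3 * w\<^sup>2 - 3 * s\<^sup>2 \<le> 2 * (14 * w * s - 6 * s\<^sup>2)"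
    proof -
      have "2 * (14 * w * s - 6 * s\<^sup>2) - (3 * w\<^sup>2 - 3 * s\<^sup>2) = 34 * s - 3 - 40 * (s * s)"
        unfolding w by (simp add: power2_eq_square algebra_simps)
      moreover have "s * s \<le> s * (1/3 + 1/1000)" using s s3 by (intro mult_left_mono) auto
      ultimately have "2 * (14 * w * s - 6 * s\<^sup>2) - (3 * w\<^sup>2 - 3 * s\<^sup>2) \<ge> 34 * s - 3 - 40 * (s * (1/3 + 1/1000))" by linarith
      moreover have "34 * s - 3 - 40 * (s * (1/3 + 1/1000)) \<ge> 0" using s by (simp add: field_simps)
      ultimately show ?thesis by linarith
    qed
    from mult_right_mono[OF this nn(1)] show ?thesis by (simp add: algebra_simps)
  qed
  with main have "s\<^sup>2 * w ^ 3 \<le> 3 * s\<^sup>2 * (w * \<eta>) + (14 * w * s - 6 * s\<^sup>2) * (2 * A + B)"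
    by (simp add: algebra_simps)
  also have "2 * A + B = s * \<eta> - s ^ 3" using e1 by simp
  also have "3 * s\<^sup>2 * (w * \<eta>) + (14 * w * s - 6 * s\<^sup>2) * (s * \<eta> - s ^ 3)
      = s\<^sup>2 * (3 * (w * \<eta>) + (14 * w - 6 * s) * (\<eta> - s\<^sup>2))"
    by (simp add: power2_eq_square power3_eq_cube algebra_simps)
  finally have "w ^ 3 \<le> 3 * (w * \<eta>) + (14 * w - 6 * s) * (\<eta> - s\<^sup>2)" using s by simp
  also have "\<dots> \<le> 3 * (w * (1114/10000)) + (14 * w - 6 * s) * (1114/10000 - s\<^sup>2)"
    using \<eta> w0 s3 w by (intro add_mono mult_left_mono diff_right_mono) auto
  finally have fin: "w ^ 3 \<le> 3 * (w * (1114/10000)) + (14 * w - 6 * s) * (1114/10000 - s\<^sup>2)" .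
  \<comment> \<open>In powers of \<open>e\<close> the constant and the linear coefficient are
    positive; \<open>e \<le> 2/100\<close> lets the linear term absorb the square and the
    cube.\<close>
  define e where "e = s - 7/22"
  have e: "e > 0" "e \<le> 2/100" "s = 7/22 + e" "w = 15/22 - e" using s s3 w by (auto simp: e_def)
  have ee: "e\<^sup>2 \<le> 2/100 * e" "e ^ 3 \<le> 4/10000 * e"
  proof -
    show a: "e\<^sup>2 \<le> 2/100 * e" using e mult_right_mono[of e "2/100" e] by (simp add: power2_eq_square)
    have "e ^ 3 = e * e\<^sup>2" by (simp add: power2_eq_square power3_eq_cube)
    also have "\<dots> \<le> (2/100) * (2/100 * e)" using a e by (intro mult_mono) auto
    finally show "e ^ 3 \<le> 4/10000 * e" by simp
  qed
  have "w ^ 3 - (3 * (w * (1114/10000)) + (14 * w - 6 * s) * (1114/10000 - s\<^sup>2)) > 0"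
  proof -
    have "w ^ 3 - (3 * (w * (1114/10000)) + (14 * w - 6 * s) * (1114/10000 - s\<^sup>2))
      = ((15/22)^3 - 3 * (15/22) * (1114/10000) - (168/22) * (1114/10000 - (7/22)^2))
        + (- 3 * (15/22)^2 + 3 * (1114/10000) + 20 * (1114/10000 - (7/22)^2) + 2 * (7/22) * (168/22)) * e
        + (3 * (15/22) - 40 * (7/22) + 168/22) * e\<^sup>2 - 21 * e ^ 3"
      unfolding e(3,4) by (simp add: power2_eq_square power3_eq_cube algebra_simps) (simp add: field_simps)
    also have "\<dots> > 0"
    proof -
      have "((15/22)^3 - 3 * (15/22) * (1114/10000) - (168/22) * (1114/10000 - (7/22)^2))
        + (- 3 * (15/22)^2 + 3 * (1114/10000) + 20 * (1114/10000 - (7/22)^2) + 2 * (7/22) * (168/22)) * e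
        + (3 * (15/22) - 40 * (7/22) + 168/22) * q - 21 * r > 0" if "q \<le> 2/100 * e" "r \<le> 4/10000 * e" for q r
        using e(1) that by (simp add: power2_eq_square power3_eq_cube)
      from this[OF ee] show ?thesis .
    qed
    finally show ?thesis .
  qed
  thus False using fin by linarith
qed

text \<open>Apex \<open>v\<close> with base \<open>a\<close>, \<open>b\<close>, \<open>c\<close>:
  the link of \<open>v\<close> contains a triangle. The triple \<open>{a, b, c}\<close> is left open
  here and ruled out by \<open>no_base\<close> at the threshold 4/7.\<close>

definition K4_minus :: "'a \<Rightarrow> 'a \<Rightarrow> 'a \<Rightarrow> 'a \<Rightarrow> bool" where
  "K4_minus v a b c \<longleftrightarrow> {v,a,b} \<in> E \<and> {v,a,c} \<in> E \<and> {v,b,c} \<in> E"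

lemma K4_minus_perm: "K4_minus v a b c \<Longrightarrow> K4_minus v b a c" "K4_minus v a b c \<Longrightarrow> K4_minus v a c b"
  "K4_minus v a b c \<Longrightarrow> K4_minus v c b a"
  by (auto simp: K4_minus_def insert_commute)

section \<open>Configurations excluded around K4^-\<close>

context
  assumes \<theta>: "4/7 \<le> \<theta>" and K: "9 \<le> K"
begin

text \<open>The following configurations have fractional chromatic number at least \<open>7/4\<close>; the weights were found
  by linear programming.\<close>

lemma no_cone:
  assumes "{v,a,b} \<in> E" "{v,a,c} \<in> E" "{v,a,d} \<in> E" "{v,b,c} \<in> E" "{v,b,d} \<in> E" "{v,c,d} \<in> E"
  shows False
proof (rule roles[of "[(v,3),(a,1),(b,1),(c,1),(d,1)]" 4])
  fix I assume "indep E I"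
  note I = indepD[OF this]
  show "(\<Sum>(v, c)\<leftarrow>[(v,3),(a,1),(b,1),(c,1),(d,1)]. c * of_bool (v \<in> I)) \<le> (4::nat)"
    using assms[THEN I] by (cases "v \<in> I"; cases "a \<in> I"; cases "b \<in> I"; cases "c \<in> I"; cases "d \<in> I"; simp)
qed (use assms edge_mem \<theta> K in auto)

context
  fixes v a b c
  assumes K4m: "K4_minus v a b c"
begin

lemma K4_minus_edges: "{v,a,b} \<in> E" "{v,a,c} \<in> E" "{v,b,c} \<in> E" using K4m by (auto simp: K4_minus_def)

lemma no_base: "{a,b,c} \<notin> E"
proof
  assume f: "{a,b,c} \<in> E"
  show False
  proof (rule roles[of "[(v,1),(a,1),(b,1),(c,1)]" 2])
    fix I assume "indep E I"
    note I = indepD[OF this]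
    show "(\<Sum>(v, c)\<leftarrow>[(v,1),(a,1),(b,1),(c,1)]. c * of_bool (v \<in> I)) \<le> (2::nat)"
      using K4_minus_edges[THEN I] I[OF f] by (cases "v \<in> I"; cases "a \<in> I"; cases "b \<in> I"; cases "c \<in> I"; simp)
  qed (use K4_minus_edges edge_mem \<theta> K in auto)
qed

lemma no_side:
  assumes f: "{a,b,z} \<in> E" and z: "z \<noteq> v"
  shows False
proof -
  \<comment> \<open>Any two vertices share an edge, which supplies the triple that the weighting
    lacks; its third vertex may coincide with another role, since weights add up.\<close>
  obtain w where w: "{v,z,w} \<in> E" by (rule cover[of v z]) (use K4_minus_edges edge_mem f z in auto)
  show False
  proof (rule roles[of "[(v,2),(a,1),(b,1),(c,1),(z,1),(w,1)]" 4])
    fix I assume "indep E I"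
    note I = indepD[OF this]
    show "(\<Sum>(v, c)\<leftarrow>[(v,2),(a,1),(b,1),(c,1),(z,1),(w,1)]. c * of_bool (v \<in> I)) \<le> (4::nat)"
      using K4_minus_edges[THEN I] I[OF f] I[OF w]
      by (cases "v \<in> I"; cases "a \<in> I"; cases "b \<in> I"; cases "c \<in> I"; cases "z \<in> I"; cases "w \<in> I"; simp)
  qed (use K4_minus_edges edge_mem f w \<theta> K in auto)
qed

lemma no_diamond:
  assumes f: "{v,z,a} \<in> E" "{v,z,b} \<in> E" and z: "z \<noteq> c"
  shows False
proof -
  obtain w where w: "{c,z,w} \<in> E" by (rule cover[of c z]) (use K4_minus_edges edge_mem f z in auto)
  show False
  proof (rule roles[of "[(v,2),(a,1),(b,1),(c,1),(z,1),(w,1)]" 4])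
    fix I assume "indep E I"
    note I = indepD[OF this]
    show "(\<Sum>(v, c)\<leftarrow>[(v,2),(a,1),(b,1),(c,1),(z,1),(w,1)]. c * of_bool (v \<in> I)) \<le> (4::nat)"
      using K4_minus_edges[THEN I] f[THEN I] I[OF w]
      by (cases "v \<in> I"; cases "a \<in> I"; cases "b \<in> I"; cases "c \<in> I"; cases "z \<in> I"; cases "w \<in> I"; simp)
  qed (use K4_minus_edges edge_mem f w \<theta> K in auto)
qed

lemma no_apex_base:
  assumes f: "{v,z,z'} \<in> E" "{a,z,z'} \<in> E"
  shows False
proof (rule roles[of "[(v,2),(a,1),(b,1),(c,1),(z,1),(z',1)]" 4])
  fix I assume "indep E I"
  note I = indepD[OF this]
  show "(\<Sum>(v, c)\<leftarrow>[(v,2),(a,1),(b,1),(c,1),(z,1),(z',1)]. c * of_bool (v \<in> I)) \<le> (4::nat)"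
    using K4_minus_edges[THEN I] f[THEN I]
    by (cases "v \<in> I"; cases "a \<in> I"; cases "b \<in> I"; cases "c \<in> I"; cases "z \<in> I"; cases "z' \<in> I"; simp)
qed (use K4_minus_edges edge_mem f \<theta> K in auto)

lemma no_three_base:
  assumes f: "{a,z,z'} \<in> E" "{b,z,z'} \<in> E" "{c,z,z'} \<in> E"
  shows False
proof (rule roles[of "[(v,2),(a,1),(b,1),(c,1),(z,1),(z',1)]" 4])
  fix I assume "indep E I"
  note I = indepD[OF this]
  show "(\<Sum>(v, c)\<leftarrow>[(v,2),(a,1),(b,1),(c,1),(z,1),(z',1)]. c * of_bool (v \<in> I)) \<le> (4::nat)"
    using K4_minus_edges[THEN I] f[THEN I]
    by (cases "v \<in> I"; cases "a \<in> I"; cases "b \<in> I"; cases "c \<in> I"; cases "z \<in> I"; cases "z' \<in> I"; simp)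
qed (use K4_minus_edges edge_mem f \<theta> K in auto)

lemma no_double_path:
  assumes f: "{a,z,z'} \<in> E" "{b,z,z'} \<in> E" "{a,z,u} \<in> E" "{b,z,u} \<in> E" and u: "z' \<noteq> u"
  shows False
proof -
  obtain w where w: "{z',u,w} \<in> E" by (rule cover[of z' u]) (use edge_mem f u in auto)
  show False
  proof (rule roles[of "[(v,1),(a,1),(b,1),(z,1),(z',1),(u,1),(w,1)]" 4])
    fix I assume "indep E I"
    note I = indepD[OF this]
    show "(\<Sum>(v, c)\<leftarrow>[(v,1),(a,1),(b,1),(z,1),(z',1),(u,1),(w,1)]. c * of_bool (v \<in> I)) \<le> (4::nat)"
      using K4_minus_edges[THEN I] f[THEN I] I[OF w]
      by (cases "z \<in> I"; cases "a \<in> I"; cases "b \<in> I"; cases "z' \<in> I"; cases "u \<in> I"; cases "v \<in> I"; cases "w \<in> I"; simp)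
  qed (use K4_minus_edges edge_mem f w \<theta> K in auto)
qed

lemma no_double_triangle:
  assumes f: "{a,z,z'} \<in> E" "{b,z,z'} \<in> E" "{a,z,u} \<in> E" "{c,z,u} \<in> E"
    and g: "{v,z',u} \<in> E \<or> {a,z',u} \<in> E \<or> {b,z',u} \<in> E" and u: "u \<noteq> b"
  shows False
  using g
proof (elim disjE)
  assume g: "{v,z',u} \<in> E"
  obtain w where w: "{b,u,w} \<in> E" by (rule cover[of b u]) (use edge_mem f u in auto)
  show False
  proof (rule roles[of "[(v,1),(a,1),(b,1),(z,1),(z',1),(u,1),(w,1)]" 4])
    fix I assume "indep E I"
    note I = indepD[OF this]
    show "(\<Sum>(v, c)\<leftarrow>[(v,1),(a,1),(b,1),(z,1),(z',1),(u,1),(w,1)]. c * of_bool (v \<in> I)) \<le> (4::nat)"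
      using K4_minus_edges[THEN I] f[THEN I] I[OF g] I[OF w]
      by (cases "z \<in> I"; cases "a \<in> I"; cases "b \<in> I"; cases "z' \<in> I"; cases "u \<in> I"; cases "v \<in> I"; cases "w \<in> I"; simp)
  qed (use K4_minus_edges edge_mem f w \<theta> K in auto)
next
  assume g: "{a,z',u} \<in> E"
  show False
  proof (rule roles[of "[(v,2),(a,2),(b,1),(c,1),(z,1),(z',1),(u,1)]" 5])
    fix I assume "indep E I"
    note I = indepD[OF this]
    show "(\<Sum>(v, c)\<leftarrow>[(v,2),(a,2),(b,1),(c,1),(z,1),(z',1),(u,1)]. c * of_bool (v \<in> I)) \<le> (5::nat)"
      using K4_minus_edges[THEN I] f[THEN I] I[OF g]
      by (cases "z \<in> I"; cases "a \<in> I"; cases "b \<in> I"; cases "z' \<in> I"; cases "u \<in> I"; cases "v \<in> I"; cases "c \<in> I"; simp)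
  qed (use K4_minus_edges edge_mem f \<theta> K in auto)
next
  assume g: "{b,z',u} \<in> E"
  show False
  proof (rule roles[of "[(v,1),(a,1),(b,1),(c,1),(z,1),(z',1),(u,1)]" 4])
    fix I assume "indep E I"
    note I = indepD[OF this]
    show "(\<Sum>(v, c)\<leftarrow>[(v,1),(a,1),(b,1),(c,1),(z,1),(z',1),(u,1)]. c * of_bool (v \<in> I)) \<le> (4::nat)"
      using K4_minus_edges[THEN I] f[THEN I] I[OF g]
      by (cases "z \<in> I"; cases "a \<in> I"; cases "b \<in> I"; cases "z' \<in> I"; cases "u \<in> I"; cases "v \<in> I"; cases "c \<in> I"; simp)
  qed (use K4_minus_edges edge_mem f \<theta> K in auto)
qed

end

end

text \<open>Up to a permutation of the base, either the same two base vertices serve both pairs at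
  \<open>j\<close>, which is \<open>no_double_path\<close>, or only one of them does, which is
  \<open>no_double_triangle\<close>.\<close>

lemma no_double_pair:
  assumes \<theta>: "4/7 \<le> \<theta>" and K: "9 \<le> K" and K4m: "K4_minus v p q r"
    and jk: "{p,j,k} \<in> E" "{q,j,k} \<in> E"
    and two: "({p,j,u} \<in> E \<and> {q,j,u} \<in> E) \<or> ({p,j,u} \<in> E \<and> {r,j,u} \<in> E) \<or> ({q,j,u} \<in> E \<and> {r,j,u} \<in> E)"
    and one: "{v,k,u} \<in> E \<or> {p,k,u} \<in> E \<or> {q,k,u} \<in> E \<or> {r,k,u} \<in> E"
    and u: "u \<notin> {p,q,r}" "k \<notin> {p,q,r}"
  shows False
proof -
  have ku: "k \<noteq> u" using one edge_mem by blast
  \<comment> \<open>If the edge on \<open>k\<close>, \<open>u\<close> uses \<open>r\<close>,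
    exchanging \<open>q\<close> with \<open>r\<close> and \<open>k\<close> with \<open>u\<close>
    leads to the third alternative of \<open>no_double_triangle\<close>.\<close>
  have X: False if K4: "K4_minus v p q r" and f: "{p,j,k} \<in> E" "{q,j,k} \<in> E" "{p,j,u} \<in> E" "{r,j,u} \<in> E"
    and g: "{v,k,u} \<in> E \<or> {p,k,u} \<in> E \<or> {q,k,u} \<in> E \<or> {r,k,u} \<in> E" and uk: "u \<noteq> q" "k \<noteq> r" for p q r
  proof (cases "{r,k,u} \<in> E")
    case True
    hence "{r,u,k} \<in> E" by (simp add: insert_commute)
    thus False using no_double_triangle[OF \<theta> K K4_minus_perm(2)[OF K4] f(3,4,1,2)] uk by blast
  next
    case False
    thus False using no_double_triangle[OF \<theta> K K4 f _ uk(1)] g by blast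
  qed
  from two show False
  proof (elim disjE conjE)
    assume "{p,j,u} \<in> E" "{q,j,u} \<in> E"
    thus False using no_double_path[OF \<theta> K K4m jk _ _ ku] by blast
  next
    assume "{p,j,u} \<in> E" "{r,j,u} \<in> E"
    thus False using X[OF K4m jk] one u by blast
  next
    assume "{q,j,u} \<in> E" "{r,j,u} \<in> E"
    thus False using X[OF K4_minus_perm(1)[OF K4m] jk(2,1)] one u by blast
  qed
qed

text \<open>By \<open>no_cone\<close> the link of \<open>v\<close> has no clique on four vertices,
  and it avoids \<open>v\<close>, so Turan's theorem gives
  \<open>3 * D \<le> 2 * (1 - x v)\<^sup>2\<close>; a weight above 1/3 would push \<open>D\<close>
  down to 8/27.\<close>

lemma apex_weight:
  assumes \<theta>: "4/7 \<le> \<theta>" and K: "9 \<le> K" and D: "D > 8/27" and v: "v \<in> S"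
  shows "x v \<le> 1/3"
proof (rule ccontr)
  assume "\<not> ?thesis"
  hence xv: "x v > 1/3" by simp
  have fin: "finite (S - {v})" "finite {v}" using o(1) by auto
  have s: "sum x (S - {v}) = 1 - x v" using o(1,4) v by (simp add: sum_diff1)
  have "real 3 * quad (S - {v}) x (\<lambda>j k. of_bool ({v, j, k} \<in> E)) \<le> (real 3 - 1) * (sum x (S - {v}))\<^sup>2"
  proof (rule quad_turan[OF fin(1)])
    fix T assume "T \<subseteq> S - {v}" "card T = 3 + 1"
    then obtain i j k l where T: "T = {i, j, k, l}" "i \<noteq> j" "i \<noteq> k" "j \<noteq> k" "i \<noteq> l" "j \<noteq> l" "k \<noteq> l"
      by (auto simp: card_Suc_eq eval_nat_numeral)
    show "\<exists>i\<in>T. \<exists>j\<in>T. i \<noteq> j \<and> {v, i, j} \<notin> E"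
    proof (rule ccontr)
      assume "\<not> ?thesis"
      hence "\<And>i j. i \<in> T \<Longrightarrow> j \<in> T \<Longrightarrow> i \<noteq> j \<Longrightarrow> {v, i, j} \<in> E" by blast
      thus False using no_cone[OF \<theta> K, of v i j k l] T by simp
    qed
  qed (use xpos m_diag in \<open>auto simp: insert_commute m_def\<close>)
  hence "3 * quad (S - {v}) x (m v) \<le> 2 * (1 - x v)\<^sup>2" by (simp add: m_def[abs_def] s)
  moreover have "quad S x (m v) = quad (S - {v}) x (m v)"
  proof -
    have S: "S = (S - {v}) \<union> {v}" using v by auto
    have "quad S x (m v) = quad (S - {v}) x (m v) + 2 * (\<Sum>z\<in>S - {v}. x z * (\<Sum>k\<in>{v}. m v z k * x k)) + quad {v} x (m v)"
      by (subst S) (rule quad_union[OF fin _ m_swap(2)], simp)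
    thus ?thesis by (simp add: quad_def m_diag)
  qed
  ultimately have "3 * D \<le> 2 * (1 - x v)\<^sup>2" using quad_m[OF v] by simp
  moreover have "(1 - x v)\<^sup>2 \<le> (2/3)\<^sup>2"
  proof (rule power_mono)
    show "0 \<le> 1 - x v" using s xpos sum_nonneg[of "S - {v}" x] by auto
  qed (use xv in auto)
  ultimately show False using D by (simp add: power2_eq_square)
qed

text \<open>Summing the degree condition over the four vertices of the configuration: outside them, the pairs
  lying in two of the four links are so restricted that on average at most one link contains a pair.\<close>

lemma density_K4_minus:
  assumes \<theta>: "4/7 \<le> \<theta>" and K: "9 \<le> K" and K4m: "K4_minus v a b c"
  shows "D \<le> 8/27"
proof (rule ccontr)
  assume "\<not> ?thesis"
  hence D: "D > 8/27" by simp
  note e = K4_minus_edges[OF \<theta> K K4m]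
  have vS: "v \<in> S" "a \<in> S" "b \<in> S" "c \<in> S" using e edge_mem by auto
  have ne: "v \<noteq> a" "v \<noteq> b" "v \<noteq> c" "a \<noteq> b" "a \<noteq> c" "b \<noteq> c" using e edge_mem by auto
  note P1 = K4_minus_perm(1)[OF K4m] and P2 = K4_minus_perm(2)[OF K4m] and P3 = K4_minus_perm(3)[OF K4m]
  have Pbca: "K4_minus v b c a" using P2 K4_minus_perm(1)[of v a c b] K4_minus_perm by blast
  define f where "f = (\<lambda>j k. (m v j k + m a j k) + (m b j k + m c j k))"
  have fsym: "f j k = f k j" for j k by (simp add: f_def m_swap(2)[of _ j k])
  have fdiag: "f j j = 0" for j by (simp add: f_def m_diag)
  have qf: "quad S x f = 4 * D" unfolding f_def by (simp add: quad_add quad_m vS)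
  define V where "V = S - {v,a,b,c}"
  define B where "B = {v,a,b,c}"
  have SV: "S = V \<union> B" "finite V" "finite B" "V \<inter> B = {}" using vS o(1) by (auto simp: V_def B_def)
  \<comment> \<open>A pair in the link of the apex lies in no base link
    (\<open>no_apex_base\<close>), and the three base links have no common pair
    (\<open>no_three_base\<close>).\<close>
  have f2: "f j k \<le> 2" for j k
  proof (cases "{v,j,k} \<in> E")
    case True
    hence "{a,j,k} \<notin> E" "{b,j,k} \<notin> E" "{c,j,k} \<notin> E"
      using no_apex_base[OF \<theta> K K4m True] no_apex_base[OF \<theta> K P1 True] no_apex_base[OF \<theta> K P3 True] by blast+
    thus ?thesis using True by (simp add: f_def m_def)
  next
    case False
    thus ?thesis using no_three_base[OF \<theta> K K4m, of j k] by (auto simp: f_def m_def)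
  qed
  have two: "({a,j,k} \<in> E \<and> {b,j,k} \<in> E) \<or> ({a,j,k} \<in> E \<and> {c,j,k} \<in> E) \<or> ({b,j,k} \<in> E \<and> {c,j,k} \<in> E)" if "f j k > 1" for j k
  proof (cases "{v,j,k} \<in> E")
    case True
    hence "{a,j,k} \<notin> E" "{b,j,k} \<notin> E" "{c,j,k} \<notin> E"
      using no_apex_base[OF \<theta> K K4m True] no_apex_base[OF \<theta> K P1 True] no_apex_base[OF \<theta> K P3 True] by blast+
    thus ?thesis using that True by (simp add: f_def m_def)
  next
    case False
    thus ?thesis using that by (auto simp: f_def m_def of_bool_def split: if_splits)
  qed
  have one: "{v,j,k} \<in> E \<or> {a,j,k} \<in> E \<or> {b,j,k} \<in> E \<or> {c,j,k} \<in> E" if "f j k > 0" for j k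
    using that by (auto simp: f_def m_def of_bool_def split: if_splits)
  have key: False if jk: "f j k > 1" and ju: "f j u > 1" and ku: "f k u > 0" and mem: "k \<in> V" "u \<in> V" for j k u
  proof -
    have out: "u \<notin> {a,b,c}" "k \<notin> {a,b,c}" using mem by (auto simp: V_def)
    from two[OF jk] show False
    proof (elim disjE conjE)
      assume "{a,j,k} \<in> E" "{b,j,k} \<in> E"
      thus False using no_double_pair[OF \<theta> K K4m _ _ two[OF ju] one[OF ku] out] by blast
    next
      assume "{a,j,k} \<in> E" "{c,j,k} \<in> E"
      thus False using no_double_pair[OF \<theta> K P2, of j k u] two[OF ju] one[OF ku] out by blast
    next
      assume "{b,j,k} \<in> E" "{c,j,k} \<in> E"
      thus False using no_double_pair[OF \<theta> K Pbca, of j k u] two[OF ju] one[OF ku] out by blast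
    qed
  qed
  \<comment> \<open>When a pair lies in two links, \<open>key\<close> keeps any third vertex from
    gaining more than 2 from it, so \<open>quad_removal\<close> works with
    \<open>c = 1\<close>.\<close>
  have qV: "quad V x f \<le> 1 * (sum x V)\<^sup>2"
  proof (rule quad_removal[OF SV(2) _ fsym fdiag])
    fix j k assume jk: "j \<in> V" "k \<in> V" "j \<noteq> k" "f j k > 1"
    have "f j u + f k u \<le> 2" if u: "u \<in> V" for u
    proof (rule ccontr)
      assume "\<not> ?thesis"
      hence gt: "f j u + f k u > 2" by simp
      show False
      proof (cases "f j u > 1")
        case True
        thus False using key[of j k u] jk u gt f2[of j u] by simp
      next
        case False
        thus False using key[of k j u] jk u gt f2[of k u] fsym[of k j] by simp
      qed
    qed
    thus "f j k \<le> 2 * 1 \<and> (\<forall>u\<in>V. u \<noteq> j \<longrightarrow> u \<noteq> k \<longrightarrow> f j u + f k u \<le> 2 * 1)" using f2 by simp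
  qed (use xpos in \<open>auto simp: V_def\<close>)
  \<comment> \<open>For \<open>z\<close> outside, \<open>no_side\<close> leaves only triples of
    \<open>v\<close>, \<open>z\<close> and one base vertex, and \<open>no_diamond\<close> allows at
    most one of them. It is counted once with \<open>x v\<close> and once with the weight of that
    base vertex.\<close>
  define M where "M = max (x a) (max (x b) (x c))"
  have cross: "(\<Sum>k\<in>B. f z k * x k) \<le> x v + M" if z: "z \<in> V" for z
  proof -
    have zn: "z \<noteq> v" "z \<noteq> a" "z \<noteq> b" "z \<noteq> c" using z by (auto simp: V_def)
    have side: "{a,b,z} \<notin> E" "{a,c,z} \<notin> E" "{b,c,z} \<notin> E"
      using no_side[OF \<theta> K K4m _ zn(1)] no_side[OF \<theta> K P2 _ zn(1)] no_side[OF \<theta> K Pbca _ zn(1)] by blast+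
    have dia: "\<not> ({v,z,a} \<in> E \<and> {v,z,b} \<in> E)" "\<not> ({v,z,a} \<in> E \<and> {v,z,c} \<in> E)" "\<not> ({v,z,b} \<in> E \<and> {v,z,c} \<in> E)"
      using no_diamond[OF \<theta> K K4m _ _ zn(4)] no_diamond[OF \<theta> K P2 _ _ zn(3)] no_diamond[OF \<theta> K Pbca _ _ zn(2)] by blast+
    have z0: "m b z a = 0" "m c z a = 0" "m a z b = 0" "m c z b = 0" "m a z c = 0" "m b z c = 0"
      using side by (auto simp: m_def insert_commute)
    have sw: "m a z v = m v z a" "m b z v = m v z b" "m c z v = m v z c"
      by (simp_all add: m_def insert_commute)
    have "(\<Sum>k\<in>B. f z k * x k) = f z v * x v + f z a * x a + f z b * x b + f z c * x c"
      using ne by (simp add: B_def)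
    also have "\<dots> = m v z a * (x v + x a) + m v z b * (x v + x b) + m v z c * (x v + x c)"
      by (simp add: f_def m_diag z0 sw algebra_simps)
    also have "\<dots> \<le> x v + M"
      using dia xpos[OF vS(1)] xpos[OF vS(2)] by (auto simp: m_def M_def of_bool_def)
    finally show ?thesis .
  qed
  have qB: "quad B x f = 2 * (2 * x v * (x a + x b + x c) + x a * x b + x a * x c + x b * x c)"
  proof -
    have E1: "m v a b = 1" "m v a c = 1" "m v b c = 1" using e by (simp_all add: m_edge)
    have E0: "m a b c = 0" using no_base[OF \<theta> K K4m] by (simp add: m_def)
    have "f v a = 2" "f v b = 2" "f v c = 2" "f a b = 1" "f a c = 1" "f b c = 1"
      using E1 E0 by (simp_all add: f_def m_diag, simp_all add: m_def insert_commute)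
    moreover have "f a v = f v a" "f b v = f v b" "f c v = f v c" "f b a = f a b" "f c a = f a c" "f c b = f b c"
      by (rule fsym)+
    ultimately show ?thesis using ne fdiag by (simp add: quad_def B_def algebra_simps)
  qed
  define y where "y = sum x V"
  have "sum x B = x v + x a + x b + x c" using ne by (simp add: B_def)
  hence tot: "x v + x a + x b + x c + y = 1"
    using o(4) SV(2-4) unfolding y_def by (subst (asm) SV(1)) (simp add: sum.union_disjoint)
  have y0: "0 \<le> y" unfolding y_def using xpos by (intro sum_nonneg) (auto simp: V_def)
  have "4 * D = quad V x f + 2 * (\<Sum>z\<in>V. x z * (\<Sum>k\<in>B. f z k * x k)) + quad B x f"
    unfolding qf[symmetric] by (subst SV(1)) (rule quad_union[OF SV(2,3,4) fsym])
  also have "\<dots> \<le> y\<^sup>2 + 2 * (y * (x v + M)) + quad B x f"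
  proof -
    have "(\<Sum>z\<in>V. x z * (\<Sum>k\<in>B. f z k * x k)) \<le> (\<Sum>z\<in>V. x z * (x v + M))"
      using xpos cross by (intro sum_mono mult_left_mono) (auto simp: V_def)
    thus ?thesis using qV by (simp add: y_def flip: sum_distrib_right)
  qed
  also have "\<dots> \<le> 32/27"
  proof -
    have nn: "0 \<le> x v" "0 \<le> x a" "0 \<le> x b" "0 \<le> x c" using xpos vS by auto
    have xv: "x v \<le> 1/3" by (rule apex_weight[OF \<theta> K D vS(1)])
    \<comment> \<open>The outside weight is charged to the heaviest base vertex, which takes the
      place of \<open>p\<close> in \<open>cone_inequality\<close>; the bound 32/27 is
      \<open>4 * 8/27\<close>.\<close>
    have "M = x a \<or> M = x b \<or> M = x c" unfolding M_def by linarith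
    then consider "M = x a" | "M = x b" | "M = x c" by blast
    thus ?thesis
    proof cases
      case 1
      show ?thesis using cone_inequality[where a="x v" and p="x a" and q="x b" and r="x c" and y=y] nn y0 xv tot unfolding qB 1
        by (simp add: algebra_simps)
    next
      case 2
      show ?thesis using cone_inequality[where a="x v" and p="x b" and q="x a" and r="x c" and y=y] nn y0 xv tot unfolding qB 2
        by (simp add: algebra_simps)
    next
      case 3
      show ?thesis using cone_inequality[where a="x v" and p="x c" and q="x a" and r="x b" and y=y] nn y0 xv tot unfolding qB 3
        by (simp add: algebra_simps)
    qed
  qed
  finally show False using D by simp
qed

end

section \<open>Sampling\<close>

text \<open>As \<open>g\<close> maps edges to edges, preimages of independent sets are independent;
  the weighting is pushed forward along \<open>g\<close>.\<close>

lemma rich_pullback: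
  fixes g :: "'b \<Rightarrow> 'a"
  assumes rich: "rich \<theta> K S E" and S: "finite S" "finite S'" and g: "g ` S' \<subseteq> S" "\<And>e. e \<in> F \<Longrightarrow> g ` e \<in> E"
  shows "rich \<theta> K S' F"
  unfolding rich_def
proof (intro allI impI)
  fix w :: "'b \<Rightarrow> nat" assume w: "0 < sum w S'" "sum w S' \<le> K"
  define w' where "w' = (\<lambda>i. sum w {z\<in>S'. g z = i})"
  have w': "sum w' I = sum w {z\<in>S'. g z \<in> I}" if "I \<subseteq> S" for I
  proof -
    have "finite I" using that S finite_subset by blast
    hence "sum w (\<Union>i\<in>I. {z\<in>S'. g z = i}) = sum w' I"
      unfolding w'_def using S by (intro sum.UNION_disjoint) auto
    moreover have "(\<Union>i\<in>I. {z\<in>S'. g z = i}) = {z\<in>S'. g z \<in> I}" by auto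
    ultimately show ?thesis by simp
  qed
  have "{z\<in>S'. g z \<in> S} = S'" using g(1) by auto
  hence s: "sum w' S = sum w S'" using w'[of S] by simp
  then obtain I where I: "I \<subseteq> S" "indep E I" "\<theta> * real (sum w' S) < real (sum w' I)"
    using rich w unfolding rich_def by metis
  have "indep F {z\<in>S'. g z \<in> I}"
    unfolding indep_def
  proof (intro ballI notI)
    fix e assume "e \<in> F" "e \<subseteq> {z\<in>S'. g z \<in> I}"
    hence "g ` e \<in> E" "g ` e \<subseteq> I" using g(2) by auto
    thus False using I(2) by (auto simp: indep_def)
  qed
  thus "\<exists>I\<subseteq>S'. indep F I \<and> \<theta> * real (sum w S') < real (sum w I)"
    using I(3) w'[OF I(1)] s by (intro exI[of _ "{z\<in>S'. g z \<in> I}"]) auto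
qed

text \<open>The factor \<open>fact r * (m choose r) / m ^ r\<close> is the loss from sampling \<open>m\<close> vertices without replacement
  while the Lagrangian allows repetitions.\<close>

lemma sample_blowup:
  assumes opt: "opt_weights r S E x" and rich: "rich \<theta> K S E" and m: "1 \<le> m" "r \<le> m"
    and c: "0 \<le> c" "c < fact r * lag E x"
  obtains S' :: "('a \<times> nat) set" and F y where "opt_weights r S' F y" "rich \<theta> K S' F" "card S' \<le> m"
    "c * (fact r * real (m choose r) / real m ^ r) \<le> fact r * lag F y" "\<And>e. e \<in> F \<Longrightarrow> fst ` e \<in> E"
proof -
  have o: "finite S" "E \<subseteq> nsets S r" "\<And>i. i \<in> S \<Longrightarrow> 0 < x i" "sum x S = 1"
    using opt unfolding opt_weights_def by auto
  have eE: "e \<subseteq> S" "finite e" "card e = r" if "e \<in> E" for e using edgeD[OF o(2) that] by auto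
  \<comment> \<open>Part sizes of a blow-up of \<open>E\<close> on about \<open>N\<close> vertices,
    rounded down; their proportions tend to \<open>x\<close>.\<close>
  define s where "s = (\<lambda>N i. nat \<lfloor>real N * x i\<rfloor>)"
  define \<epsilon> where "\<epsilon> = (fact r * lag E x - c) / 2"
  have \<epsilon>: "\<epsilon> > 0" using c by (simp add: \<epsilon>_def)
  have lim: "(\<lambda>N. real (s N i) / real N) \<longlonglongrightarrow> x i" if "i \<in> S" for i
  proof -
    have l: "(\<lambda>N. x i - 1 / real N) \<longlonglongrightarrow> x i - 0"
      by (intro tendsto_diff tendsto_const lim_1_over_n)
    have "\<forall>\<^sub>F N in sequentially. x i - 1 / real N \<le> real (s N i) / real N"
    proof (rule eventually_sequentiallyI[of 1])
      fix N :: nat assume "1 \<le> N"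
      have "real N * x i - 1 \<le> real (s N i)" unfolding s_def using o(3)[OF that] by linarith
      hence "(real N * x i - 1) / real N \<le> real (s N i) / real N" by (intro divide_right_mono) auto
      with \<open>1 \<le> N\<close> show "x i - 1 / real N \<le> real (s N i) / real N" by (simp add: diff_divide_distrib)
    qed
    moreover have "\<forall>\<^sub>F N in sequentially. real (s N i) / real N \<le> x i"
    proof (rule eventually_sequentiallyI[of 1])
      fix N :: nat assume "1 \<le> N"
      moreover have "real (s N i) \<le> real N * x i" unfolding s_def using o(3)[OF that] by simp
      ultimately show "real (s N i) / real N \<le> x i" by (simp add: field_simps)
    qed
    moreover have "(\<lambda>N. x i - 1 / real N) \<longlonglongrightarrow> x i" using l by simp
    ultimately show ?thesis using tendsto_const by (rule real_tendsto_sandwich)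
  qed
  have "(\<lambda>N. fact r * lag E (\<lambda>i. real (s N i) / real N)) \<longlonglongrightarrow> fact r * lag E x"
    unfolding lag_def using eE(1) lim by (intro tendsto_mult tendsto_const tendsto_sum tendsto_prod) blast
  moreover have "c + \<epsilon> < fact r * lag E x" using c by (simp add: \<epsilon>_def field_simps)
  ultimately have ev1: "\<forall>\<^sub>F N in sequentially. c + \<epsilon> < fact r * lag E (\<lambda>i. real (s N i) / real N)"
    by (rule order_tendstoD)
  have "(\<lambda>N. \<Sum>i\<in>S. real (s N i) / real N) \<longlonglongrightarrow> sum x S" using lim by (intro tendsto_sum)
  moreover have "1/2 < sum x S" using o by simp
  ultimately have ev2: "\<forall>\<^sub>F N in sequentially. 1/2 < (\<Sum>i\<in>S. real (s N i) / real N)"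
    by (rule order_tendstoD)
  have "\<forall>\<^sub>F N in sequentially. 2 * m \<le> N" by (rule eventually_ge_at_top)
  with ev1 ev2 have "\<forall>\<^sub>F N in sequentially. c + \<epsilon> < fact r * lag E (\<lambda>i. real (s N i) / real N) \<and>
      1/2 < (\<Sum>i\<in>S. real (s N i) / real N) \<and> 2 * m \<le> N" by eventually_elim auto
  then obtain N where N: "c + \<epsilon> < fact r * lag E (\<lambda>i. real (s N i) / real N)"
      "1/2 < (\<Sum>i\<in>S. real (s N i) / real N)" "2 * m \<le> N"
    using eventually_happens trivial_limit_sequentially by blast
  have N0: "N > 0" using N m by linarith
  define V where "V = (SIGMA i:S. {..<s N i})"
  define G where "G = {e \<in> nsets V r. fst ` e \<in> E}"
  define n where "n = card V"
  have V: "finite V" "n = (\<Sum>i\<in>S. s N i)" using o(1) by (auto simp: V_def n_def)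
  \<comment> \<open>More than half of \<open>N \<ge> 2 * m\<close> vertices survive the rounding,
    enough to sample \<open>m\<close> of them.\<close>
  have "real n / real N > 1/2" using N(2) V(2) by (simp add: sum_divide_distrib)
  hence mn: "m \<le> n" using N(3) N0 by (simp add: field_simps)
  have "real n \<le> (\<Sum>i\<in>S. real N * x i)"
    unfolding V(2) of_nat_sum using o(3) by (intro sum_mono) (simp add: s_def less_imp_le)
  hence nN: "real n \<le> real N" using o(4) by (simp flip: sum_distrib_left)
  have "lag E (\<lambda>i. real (s N i) / real N) = (\<Sum>e\<in>E. \<Prod>i\<in>e. real (s N i)) / real N ^ r"
    unfolding lag_def sum_divide_distrib using eE by (intro sum.cong) (auto simp: prod_dividef)
  hence "c + \<epsilon> \<le> fact r * (\<Sum>e\<in>E. \<Prod>i\<in>e. real (s N i)) / real N ^ r" using N(1) by simp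
  hence "(c + \<epsilon>) * real N ^ r \<le> fact r * (\<Sum>e\<in>E. \<Prod>i\<in>e. real (s N i))"
    using N0 by (subst (asm) pos_le_divide_eq) auto
  also have "\<dots> \<le> fact r * real (card G)"
  proof -
    have "real (\<Sum>e\<in>E. prod (s N) e) \<le> real (card G)"
      unfolding G_def V_def using card_transversals[OF o(2,1)] by (simp only: of_nat_le_iff)
    thus ?thesis by simp
  qed
  finally have G: "(c + \<epsilon>) * real N ^ r \<le> fact r * real (card G)" .
  have "fact r * ((c + \<epsilon>) * real (n choose r)) \<le> (c + \<epsilon>) * real N ^ r"
  proof -
    have "real ((n choose r) * fact r) \<le> real (n ^ r)" using binomial_fact_pow by (simp only: of_nat_le_iff)
    also have "\<dots> \<le> real N ^ r" using nN by (simp add: power_mono)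
    finally have "(c + \<epsilon>) * (real (n choose r) * fact r) \<le> (c + \<epsilon>) * real N ^ r"
      using c \<epsilon> by (intro mult_left_mono) auto
    thus ?thesis by (simp add: mult_ac)
  qed
  hence "fact r * ((c + \<epsilon>) * real (n choose r)) \<le> fact r * real (card G)" using G by linarith
  hence "(c + \<epsilon>) * real (n choose r) \<le> real (card G)" by simp
  hence "\<epsilon> * real (n choose m) \<le> real (card {A\<in>nsets V m. c * real (m choose r) \<le> real (card (G \<inter> nsets A r))})"
    using m mn c V(1) by (intro many_dense_subsets) (auto simp: n_def G_def)
  moreover have "0 < \<epsilon> * real (n choose m)" using \<epsilon> mn by simp
  ultimately have "{A\<in>nsets V m. c * real (m choose r) \<le> real (card (G \<inter> nsets A r))} \<noteq> {}" by force
  then obtain A where A: "A \<subseteq> V" "finite A" "card A = m" "c * real (m choose r) \<le> real (card (G \<inter> nsets A r))"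
    by (auto simp: nsets_def)
  have y: "(\<Sum>z\<in>A. 1 / real m) = 1" using A m by simp
  \<comment> \<open>The sample has edge density at least \<open>c\<close>; uniform weights on it
    lead to a new optimum, now supported on at most \<open>m\<close> vertices.\<close>
  obtain S' y where S': "S' \<subseteq> A" "opt_weights r S' (G \<inter> nsets A r \<inter> nsets S' r) y"
      "lag (G \<inter> nsets A r) (\<lambda>z. 1 / real m) \<le> lag (G \<inter> nsets A r \<inter> nsets S' r) y"
    by (rule optimal_weights_exist[OF A(2), of "G \<inter> nsets A r" r "\<lambda>z. 1 / real m"]) (use y in auto)
  have "lag (G \<inter> nsets A r) (\<lambda>z. 1 / real m) = real (card (G \<inter> nsets A r)) / real m ^ r"
  proof -
    have "lag (G \<inter> nsets A r) (\<lambda>z. 1 / real m) = (\<Sum>e\<in>G \<inter> nsets A r. 1 / real m ^ r)"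
      unfolding lag_def by (intro sum.cong refl) (auto simp: nsets_def power_one_over)
    thus ?thesis by simp
  qed
  moreover have "c * real (m choose r) / real m ^ r \<le> real (card (G \<inter> nsets A r)) / real m ^ r"
    using A(4) by (intro divide_right_mono) auto
  ultimately have "c * real (m choose r) / real m ^ r \<le> lag (G \<inter> nsets A r \<inter> nsets S' r) y" using S'(3) by linarith
  hence "fact r * (c * real (m choose r) / real m ^ r) \<le> fact r * lag (G \<inter> nsets A r \<inter> nsets S' r) y"
    by (intro mult_left_mono) auto
  moreover have "rich \<theta> K S' (G \<inter> nsets A r \<inter> nsets S' r)"
  proof (rule rich_pullback[OF rich o(1)])
    show "finite S'" using S' A finite_subset by blast
    show "fst ` S' \<subseteq> S" using S'(1) A(1) by (auto simp: V_def)
  qed (auto simp: G_def)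
  moreover have "card S' \<le> m" using card_mono[OF A(2) S'(1)] A(3) by simp
  ultimately show thesis
    by (intro that[OF S'(2)]) (simp_all add: G_def mult.left_commute)
qed

lemma binomial_10000_3: "real (10000 choose 3) = 166616670000"
proof -
  have "3 * (10000 choose 3) = 10000 * (9999 choose 2)"
    using times_binomial_minus1_eq[of 3 "10000 :: nat"] by simp
  moreover have "2 * (9999 choose 2) = (9999 * 9998 :: nat)"
    using times_binomial_minus1_eq[of 2 "9999 :: nat"] by simp
  ultimately have "10000 choose 3 = (166616670000 :: nat)" by linarith
  thus ?thesis by simp
qed

text \<open>A sample of \<open>10000\<close> vertices is large enough to stay above the densities \<open>72/245\<close> and \<open>8886/10000\<close> when
  starting above \<open>8/27\<close> and \<open>8/9\<close>.\<close>

lemma lag3_K4_minus: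
  assumes opt: "opt_weights 3 S E x" and rich: "rich \<theta> K S E"
    and \<theta>: "4/7 < \<theta>" and K: "9 \<le> K" "10000 < K" "\<theta> * 10000 \<le> real K * (\<theta> - 4/7)"
  shows "6 * lag E x \<le> 8/27"
proof (rule ccontr)
  assume "\<not> ?thesis"
  hence D: "8/27 < fact 3 * lag E x" by (simp add: fact_numeral)
  interpret triples S E x \<theta> K by unfold_locales (fact opt, fact rich)
  obtain S' :: "('a \<times> nat) set" and F y where F: "opt_weights 3 S' F y" "rich \<theta> K S' F" "card S' \<le> 10000"
      "8/27 * (fact 3 * real (10000 choose 3) / real 10000 ^ 3) \<le> fact 3 * lag F y" "\<And>e. e \<in> F \<Longrightarrow> fst ` e \<in> E"
    using sample_blowup[OF opt rich _ _ _ D, of 10000] by auto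
  interpret F: triples S' F y \<theta> K by unfold_locales (fact F)+
  have D': "F.D > 72/245" using F(4) unfolding F.D_def by (simp add: fact_numeral binomial_10000_3)
  show False
  \<comment> \<open>A K4^- in the sample projects by \<open>fst\<close> to one in the original
    optimum, where \<open>density_K4_minus\<close> applies; without one, the sample contradicts
    \<open>indep_weight_le\<close>.\<close>
  proof (cases "\<exists>v a b c. {v,a,b} \<in> F \<and> {v,a,c} \<in> F \<and> {v,b,c} \<in> F")
    case True
    then obtain v a b c where "{v,a,b} \<in> F" "{v,a,c} \<in> F" "{v,b,c} \<in> F" by blast
    hence "K4_minus (fst v) (fst a) (fst b) (fst c)" using F(5) by (fastforce simp: K4_minus_def)
    hence "D \<le> 8/27" using \<theta> K by (intro density_K4_minus) auto
    thus False using D by (simp add: D_def fact_numeral)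
  next
    case False
    obtain I where I: "I \<subseteq> S'" "indep F I" "4/7 < sum y I"
      by (rule heavy_indep[OF F(2), of 10000 y "4/7"]) (use F F.o \<theta> K in \<open>auto simp: less_imp_le\<close>)
    have "sum y I \<le> 4/7" by (rule F.indep_weight_le[OF _ D' I(1,2)]) (use False in blast)
    thus False using I(3) by simp
  qed
qed

lemma lag3_K6:
  assumes opt: "opt_weights 3 S E x" and rich: "rich \<theta> K S E"
    and \<theta>: "7/22 < \<theta>" and K: "22 \<le> K" "10000 < K" "\<theta> * 10000 \<le> real K * (\<theta> - 7/22)"
  shows "6 * lag E x \<le> 8/9"
proof (rule ccontr)
  assume "\<not> ?thesis"
  hence D: "8/9 < fact 3 * lag E x" by (simp add: fact_numeral)
  interpret triples S E x \<theta> K by unfold_locales (fact opt, fact rich)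
  obtain S' :: "('a \<times> nat) set" and F y where F: "opt_weights 3 S' F y" "rich \<theta> K S' F" "card S' \<le> 10000"
      "8/9 * (fact 3 * real (10000 choose 3) / real 10000 ^ 3) \<le> fact 3 * lag F y" "\<And>e. e \<in> F \<Longrightarrow> fst ` e \<in> E"
    using sample_blowup[OF opt rich _ _ _ D, of 10000] by auto
  interpret F: triples S' F y \<theta> K by unfold_locales (fact F)+
  have D': "F.D \<ge> 8886/10000" using F(4) unfolding F.D_def by (simp add: fact_numeral binomial_10000_3)
  obtain I where I: "I \<subseteq> S'" "indep F I" "7/22 < sum y I"
    by (rule heavy_indep[OF F(2), of 10000 y "7/22"]) (use F F.o \<theta> K in \<open>auto simp: less_imp_le\<close>)
  \<comment> \<open>The K6 is found in the sample but projected by \<open>fst\<close>, so that the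
    final count runs in the original optimum with its density above 8/9.\<close>
  obtain b :: "nat \<Rightarrow> 'a \<times> nat" where b: "\<And>i j k. i < j \<Longrightarrow> j < k \<Longrightarrow> k < 6 \<Longrightarrow> {b i, b j, b k} \<in> F"
    using F.K6_ex[OF D' I] by blast
  have "{fst (b i), fst (b j), fst (b k)} \<in> E" if "i < j" "j < k" "k < 6" for i j k
    using F(5)[OF b[OF that]] by simp
  hence "D \<le> 8/9" using \<theta> K by (intro density_three_parts[of "\<lambda>i. fst (b i)"]) auto
  thus False using D by (simp add: D_def fact_numeral)
qed

section \<open>Turan densities\<close>

lemma lag3_three_quarters:
  assumes "opt_weights 3 S E x" "rich \<theta> K S E" "3/7 \<le> \<theta>" "7 \<le> K"
  shows "6 * lag E x \<le> 3/4"
proof -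
  interpret triples S E x \<theta> K by unfold_locales (fact assms)+
  show ?thesis using density_two_parts assms by (simp add: D_def)
qed

text \<open>Upper bounds are asked for every integer \<open>q\<close> above
  \<open>\<gamma> * p\<close>, which hides the floor from the constructions.\<close>

lemma turan_dens_gamma_eqI:
  assumes \<gamma>: "1 \<le> \<gamma>" and \<theta>: "0 < \<theta>" "\<theta> * \<gamma> < 1" and c: "c \<le> 1"
    and core: "\<And>S E x. opt_weights r (S :: nat set) E x \<Longrightarrow> rich \<theta> K S E \<Longrightarrow> fact r * lag E x \<le> 1 - c"
    and upper: "\<And>p q. p + 1 \<le> q \<Longrightarrow> \<gamma> * real p < real q \<Longrightarrow> turan_dens r q (p + 1) \<le> c"
  shows "\<exists>p0>0. \<forall>p\<ge>p0. turan_dens r (nat \<lfloor>\<gamma> * real p\<rfloor> + 1) (p + 1) = c"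
proof -
  obtain p0 where p0: "p0 > 0" "\<And>p. p \<ge> p0 \<Longrightarrow> 1 - (1 - c) \<le> turan_dens r (nat \<lfloor>\<gamma> * real p\<rfloor> + 1) (p + 1)"
    using turan_dens_ge_gamma[OF \<gamma> \<theta>, of "1 - c" r K] core c by auto
  have "turan_dens r (nat \<lfloor>\<gamma> * real p\<rfloor> + 1) (p + 1) \<le> c" for p
  proof (rule upper)
    have "1 * real p \<le> \<gamma> * real p" using \<gamma> by (intro mult_right_mono) auto
    thus "p + 1 \<le> nat \<lfloor>\<gamma> * real p\<rfloor> + 1" by (simp add: le_nat_floor)
    show "\<gamma> * real p < real (nat \<lfloor>\<gamma> * real p\<rfloor> + 1)" by linarith
  qed
  with p0 show ?thesis by (metis (no_types, lifting) add_diff_cancel_left' diff_diff_eq2 antisym add.commute)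
qed

lemma gamma_mult_le: "c \<le> \<gamma> \<Longrightarrow> \<gamma> * real p < real q \<Longrightarrow> c * real p < real q"
  by (meson mult_right_mono of_nat_0_le_iff order.strict_trans1)

lemma turan_dens3_7_9:
  assumes "3/2 \<le> \<gamma>" "\<gamma> < 5/3"
  shows "\<exists>p0>0. \<forall>p\<ge>p0. turan_dens 3 (nat \<lfloor>\<gamma> * real p\<rfloor> + 1) (p + 1) = 7/9"
proof (rule turan_dens_gamma_eqI[where \<theta> = "3/5" and K = 5])
  fix S :: "nat set" and E x assume "opt_weights 3 S E x" "rich (3/5) 5 S E"
  thus "fact 3 * lag E x \<le> 1 - 7/9" using lag3_sparse[of S E x "3/5" 5] by (simp add: fact_numeral)
next
  fix p q assume q: "p + 1 \<le> q" "\<gamma> * real p < real q"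
  have "3 * (p + 1) < (3 - 1) * q + 3" using gamma_mult_le[OF assms(1) q(2)] by simp
  hence "turan_dens 3 q (p + 1) \<le> 1 - fact 3 / real 3 ^ 3" using q by (intro turan_dens_partite) auto
  thus "turan_dens 3 q (p + 1) \<le> 7/9" by (simp add: fact_numeral)
qed (use assms in auto)

text \<open>\<open>heavy_indep\<close> needs room between the threshold \<open>\<tau>\<close> and
  \<open>\<theta>\<close>, which the strict bound on \<open>\<gamma>\<close> provides;
  \<open>K\<close> is then large enough for the rounding loss on \<open>m\<close> vertices.\<close>

lemma threshold_between:
  fixes \<gamma> \<tau> :: real
  assumes "0 < \<tau>" "\<gamma> < 1 / \<tau>" "0 < \<gamma>"
  obtains \<theta> K where "\<tau> < \<theta>" "\<theta> * \<gamma> < 1" "m < K" "\<theta> * real m \<le> real K * (\<theta> - \<tau>)"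
proof -
  have "\<tau> < 1 / \<gamma>" using assms by (simp add: field_simps)
  then obtain \<theta> where \<theta>: "\<tau> < \<theta>" "\<theta> < 1 / \<gamma>" using dense by blast
  obtain K0 :: nat where K0: "\<theta> * real m / (\<theta> - \<tau>) \<le> real K0" using real_arch_simple by blast
  have "\<theta> * real m / (\<theta> - \<tau>) \<le> real (max K0 (Suc m))" using K0 by (rule order_trans) simp
  hence "\<theta> * real m \<le> real (max K0 (Suc m)) * (\<theta> - \<tau>)" using \<theta> by (simp add: pos_divide_le_eq)
  moreover have "\<theta> * \<gamma> < 1" using \<theta>(2) assms by (simp add: field_simps)
  ultimately show thesis using that[of \<theta> "max K0 (Suc m)"] \<theta> by auto
qed

lemma turan_dens3_19_27:
  assumes "5/3 \<le> \<gamma>" "\<gamma> < 7/4"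
  shows "\<exists>p0>0. \<forall>p\<ge>p0. turan_dens 3 (nat \<lfloor>\<gamma> * real p\<rfloor> + 1) (p + 1) = 19/27"
proof -
  obtain \<theta> K where \<theta>: "4/7 < \<theta>" "\<theta> * \<gamma> < 1" and K: "10000 < K" "\<theta> * real 10000 \<le> real K * (\<theta> - 4/7)"
    by (rule threshold_between[of "4/7" \<gamma> 10000]) (use assms in auto)
  show ?thesis
  proof (rule turan_dens_gamma_eqI[where \<theta> = \<theta> and K = K])
    fix S :: "nat set" and E x assume "opt_weights 3 S E x" "rich \<theta> K S E"
    thus "fact 3 * lag E x \<le> 1 - 19/27" using lag3_K4_minus[of S E x \<theta> K] \<theta> K by (simp add: fact_numeral)
  next
    fix p q assume q: "p + 1 \<le> q" "\<gamma> * real p < real q"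
    have "5 * (p + 1) < 3 * q + 5" using gamma_mult_le[OF assms(1) q(2)] by simp
    thus "turan_dens 3 q (p + 1) \<le> 19/27" by (rule turan_dens_K4_minus[OF q(1)])
  qed (use assms \<theta> in auto)
qed

lemma turan_dens3_1_4:
  assumes "2 \<le> \<gamma>" "\<gamma> < 7/3"
  shows "\<exists>p0>0. \<forall>p\<ge>p0. turan_dens 3 (nat \<lfloor>\<gamma> * real p\<rfloor> + 1) (p + 1) = 1/4"
proof (rule turan_dens_gamma_eqI[where \<theta> = "3/7" and K = 7])
  fix S :: "nat set" and E x assume "opt_weights 3 S E x" "rich (3/7) 7 S E"
  thus "fact 3 * lag E x \<le> 1 - 1/4" using lag3_three_quarters[of S E x "3/7" 7] by (simp add: fact_numeral)
next
  fix p q assume q: "p + 1 \<le> q" "\<gamma> * real p < real q"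
  have "2 * (p + 1) < q + 2" using gamma_mult_le[OF assms(1) q(2)] by simp
  hence "turan_dens 3 q (p + 1) \<le> 1 / real 2 ^ (3 - 1)" using q by (intro turan_dens_cliques) auto
  thus "turan_dens 3 q (p + 1) \<le> 1/4" by simp
qed (use assms in auto)

lemma turan_dens3_1_9:
  assumes "3 \<le> \<gamma>" "\<gamma> < 22/7"
  shows "\<exists>p0>0. \<forall>p\<ge>p0. turan_dens 3 (nat \<lfloor>\<gamma> * real p\<rfloor> + 1) (p + 1) = 1/9"
proof -
  obtain \<theta> K where \<theta>: "7/22 < \<theta>" "\<theta> * \<gamma> < 1" and K: "10000 < K" "\<theta> * real 10000 \<le> real K * (\<theta> - 7/22)"
    by (rule threshold_between[of "7/22" \<gamma> 10000]) (use assms in auto)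
  show ?thesis
  proof (rule turan_dens_gamma_eqI[where \<theta> = \<theta> and K = K])
    fix S :: "nat set" and E x assume "opt_weights 3 S E x" "rich \<theta> K S E"
    thus "fact 3 * lag E x \<le> 1 - 1/9" using lag3_K6[of S E x \<theta> K] \<theta> K by (simp add: fact_numeral)
  next
    fix p q assume q: "p + 1 \<le> q" "\<gamma> * real p < real q"
    have "3 * (p + 1) < q + 3" using gamma_mult_le[OF assms(1) q(2)] by simp
    hence "turan_dens 3 q (p + 1) \<le> 1 / real 3 ^ (3 - 1)" using q by (intro turan_dens_cliques) auto
    thus "turan_dens 3 q (p + 1) \<le> 1/9" by simp
  qed (use assms \<theta> in auto)
qed

lemma turan_dens4_partite:
  assumes "4/3 \<le> \<gamma>" "\<gamma> < 7/5"
  shows "\<exists>p0>0. \<forall>p\<ge>p0. turan_dens 4 (nat \<lfloor>\<gamma> * real p\<rfloor> + 1) (p + 1) = 1 - fact 4 / 4 ^ 4"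
proof (rule turan_dens_gamma_eqI[where \<theta> = "5/7" and K = 7])
  fix S :: "nat set" and E x assume "opt_weights 4 S E x" "rich (5/7) 7 S E"
  thus "fact 4 * lag E x \<le> 1 - (1 - fact 4 / 4 ^ 4)" using lag4_sparse[of S E x "5/7" 7] by (simp add: fact_numeral)
next
  fix p q assume q: "p + 1 \<le> q" "\<gamma> * real p < real q"
  have "4 * (p + 1) < (4 - 1) * q + 4" using gamma_mult_le[OF assms(1) q(2)] by simp
  hence "turan_dens 4 q (p + 1) \<le> 1 - fact 4 / real 4 ^ 4" using q by (intro turan_dens_partite) auto
  thus "turan_dens 4 q (p + 1) \<le> 1 - fact 4 / 4 ^ 4" by simp
qed (use assms in auto)

text \<open>As \<open>p\<close> is explicit, \<open>turan_dens_ge\<close> is applied directly with a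
  weighting that depends on \<open>p\<close>. For \<open>r = s + 2\<close> the hypothesis reads
  \<open>p + 1 \<ge> (s + 1) + (s + 1)\<^sup>2\<close>, which is the condition
  \<open>a \<ge> s + 1\<close> of \<open>lag_le_partite\<close>.\<close>

lemma turan_dens_r_partite:
  assumes r: "r \<ge> 3" and p: "int p \<ge> (int r)\<^sup>2 - int r - 1"
  shows "turan_dens r (r * p + 1) ((r - 1) * p + 1) = 1 - fact r / real r ^ r"
proof (rule antisym)
  obtain s where s: "r = s + 2" using r by (metis add.commute le_add_diff_inverse2 numeral_3_eq_3 Suc_leD numeral_2_eq_2)
  show "turan_dens r (r * p + 1) ((r - 1) * p + 1) \<le> 1 - fact r / real r ^ r"
    by (rule turan_dens_partite) (auto simp: s algebra_simps)
  have "int p \<ge> (int s + 2)\<^sup>2 - (int s + 2) - 1" using p s by (simp add: add.commute)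
  hence "int (s + 1) + (int s + 1)\<^sup>2 \<le> int (p + 1)" by (simp add: power2_eq_square algebra_simps)
  hence "int ((s + 1) + (s + 1)\<^sup>2) \<le> int (p + 1)" by (simp add: power2_eq_square algebra_simps)
  hence sp: "(s + 1) + (s + 1)\<^sup>2 \<le> p + 1" by (simp only: of_nat_le_iff)
  define a where "a = p + 1 - (s + 1)\<^sup>2"
  have a: "p + 1 = a + (s + 1)\<^sup>2" "a \<ge> s + 1" using sp by (auto simp: a_def)
  show "1 - fact r / real r ^ r \<le> turan_dens r (r * p + 1) ((r - 1) * p + 1)"
  proof (rule turan_dens_ge)
    fix S :: "nat set" and E x assume opt: "opt_weights r S E x"
      and ex: "\<And>w. r * p + 1 \<le> sum w S \<Longrightarrow> \<exists>I\<subseteq>S. indep E I \<and> (r - 1) * p + 1 \<le> sum w I"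
    have "fact r * lag E x \<le> fact r * (1 / real r ^ r)"
      using lag_le_partite[OF opt s a ex] by (intro mult_left_mono) auto
    thus "fact r * lag E x \<le> fact r / real r ^ r" by simp
  qed (auto simp: s)
qed

theorem theorem1p8:
  shows
   "(\<forall>\<gamma>::real. \<gamma> > 0 \<longrightarrow> (\<exists>p\<^sub>0::nat. p\<^sub>0 > 0 \<and> (\<forall>p::nat. p \<ge> p\<^sub>0 \<longrightarrow>
        (3/2 \<le> \<gamma> \<and> \<gamma> < 5/3 \<longrightarrow> turan_dens 3 (nat \<lfloor>\<gamma> * real p\<rfloor> + 1) (p + 1) = 7/9) \<and>
        (5/3 \<le> \<gamma> \<and> \<gamma> < 7/4 \<longrightarrow> turan_dens 3 (nat \<lfloor>\<gamma> * real p\<rfloor> + 1) (p + 1) = 19/27) \<and>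
        (2 \<le> \<gamma> \<and> \<gamma> < 7/3 \<longrightarrow> turan_dens 3 (nat \<lfloor>\<gamma> * real p\<rfloor> + 1) (p + 1) = 1/4) \<and>
        (3 \<le> \<gamma> \<and> \<gamma> < 22/7 \<longrightarrow> turan_dens 3 (nat \<lfloor>\<gamma> * real p\<rfloor> + 1) (p + 1) = 1/9)))) \<and>
    (\<forall>\<gamma>::real. 4/3 \<le> \<gamma> \<and> \<gamma> < 7/5 \<longrightarrow> (\<exists>p\<^sub>0::nat. p\<^sub>0 > 0 \<and> (\<forall>p::nat. p \<ge> p\<^sub>0 \<longrightarrow>
        turan_dens 4 (nat \<lfloor>\<gamma> * real p\<rfloor> + 1) (p + 1) = 1 - fact 4 / 4 ^ 4))) \<and>
    (\<forall>r p :: nat. r \<ge> 3 \<and> int p \<ge> (int r)\<^sup>2 - int r - 1 \<longrightarrow>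
        turan_dens r (r * p + 1) ((r - 1) * p + 1) = 1 - fact r / real r ^ r)"
proof (intro conjI allI impI)
  fix \<gamma> :: real
  let ?d = "\<lambda>p. turan_dens 3 (nat \<lfloor>\<gamma> * real p\<rfloor> + 1) (p + 1)"
  consider "3/2 \<le> \<gamma>" "\<gamma> < 5/3" | "5/3 \<le> \<gamma>" "\<gamma> < 7/4" | "2 \<le> \<gamma>" "\<gamma> < 7/3" | "3 \<le> \<gamma>" "\<gamma> < 22/7"
    | "\<gamma> < 3/2 \<or> 7/4 \<le> \<gamma> \<and> \<gamma> < 2 \<or> 7/3 \<le> \<gamma> \<and> \<gamma> < 3 \<or> 22/7 \<le> \<gamma>" by linarith
  thus "\<exists>p\<^sub>0::nat. p\<^sub>0 > 0 \<and> (\<forall>p::nat. p \<ge> p\<^sub>0 \<longrightarrow>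
        (3/2 \<le> \<gamma> \<and> \<gamma> < 5/3 \<longrightarrow> ?d p = 7/9) \<and> (5/3 \<le> \<gamma> \<and> \<gamma> < 7/4 \<longrightarrow> ?d p = 19/27) \<and>
        (2 \<le> \<gamma> \<and> \<gamma> < 7/3 \<longrightarrow> ?d p = 1/4) \<and> (3 \<le> \<gamma> \<and> \<gamma> < 22/7 \<longrightarrow> ?d p = 1/9))"
  proof cases
    case 1 thus ?thesis using turan_dens3_7_9[of \<gamma>] by auto
  next
    case 2 thus ?thesis using turan_dens3_19_27[of \<gamma>] by auto
  next
    case 3 thus ?thesis using turan_dens3_1_4[of \<gamma>] by auto
  next
    case 4 thus ?thesis using turan_dens3_1_9[of \<gamma>] by auto
  next
    case 5 thus ?thesis by auto
  qed
qed (use turan_dens4_partite turan_dens_r_partite in blast)+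

end
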